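(* Every model $\mathcal{M}$ of $\mathsf{ZF}+\exists p\,(\mathrm{V}=\mathrm{HOD}(p))$ has a cofinal conservative elementary extension $\mathcal{M}^*$ such that $\mathcal{M}^*$ possesses a minimal elementary end extension, i.e. there is $\mathcal{N}$ with $\mathcal{M}^*\prec\mathcal{N}$, $\mathcal{N}$ an end extension of $\mathcal{M}^*$, and no $\mathcal{K}$ with $\mathcal{M}^*\prec\mathcal{K}\prec\mathcal{N}$.
   Context: For a structure $\mathcal{K}$ and $c\in K$, $\mathrm{Ext}_{\mathcal{K}}(c)=\{m\in K: m\in^{\mathcal{K}}c\}$. For $\mathcal{M}\subseteq\mathcal{N}$: $\mathcal{N}$ is an end extension of $\mathcal{M}$ if $\mathrm{Ext}_{\mathcal{N}}(a)=\mathrm{Ext}_{\mathcal{M}}(a)$ for all $a\in M$; $\mathcal{N}$ is a cofinal extension of $\mathcal{M}$ if every $b\in N$ lies in $\mathrm{Ext}_{\mathcal{N}}(a)$ for some $a\in M$; $\mathcal{N}$ is a conservative extension of $\mathcal{M}$ if for every parametrically $\mathcal{N}$-definable $D$, $D\cap M$ is parametrically $\mathcal{M}$-definable. $\prec$ denotes proper elementary submodel. The sentence $\exists p\,(\mathrm{V}=\mathrm{HOD}(p))$ expresses that for some $p$ every set is definable in some $(\mathrm{V}_\alpha,\in,p,\beta)_{\beta<\alpha}$ with $p\in\mathrm{V}_\alpha$ (equivalently over $\mathsf{ZF}$: there is a parametrically definable global well-ordering). *)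

theory Defs
  imports Main
begin

section \<open>First-order logic of set theory\<close>

record 'a struct =
  univ :: "'a set"
  mem :: "'a \<Rightarrow> 'a \<Rightarrow> bool"

abbreviation mem_in :: "'a \<Rightarrow> 'a struct \<Rightarrow> 'a \<Rightarrow> bool" ("_ \<in>\<^bsub>_\<^esub> _" [51, 0, 51] 50) where
  "x \<in>\<^bsub>M\<^esub> y \<equiv> mem M x y"

text \<open>Variables are named by natural numbers; \<open>Ex i \<phi>\<close> binds the variable \<open>i\<close>.\<close>

datatype fm = Mem nat nat | Eq nat nat | Nand fm fm | Ex nat fm

primrec sat :: "'a struct \<Rightarrow> (nat \<Rightarrow> 'a) \<Rightarrow> fm \<Rightarrow> bool" where
  "sat M s (Mem i j) \<longleftrightarrow> s i \<in>\<^bsub>M\<^esub> s j"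
| "sat M s (Eq i j) \<longleftrightarrow> s i = s j"
| "sat M s (Nand \<phi> \<psi>) \<longleftrightarrow> \<not> (sat M s \<phi> \<and> sat M s \<psi>)"
| "sat M s (Ex i \<phi>) \<longleftrightarrow> (\<exists>a\<in>univ M. sat M (s(i := a)) \<phi>)"

text \<open>Parametric definability: variable 0 ranges over the structure, all the other
  variables carry parameters.\<close>

definition definable :: "'a struct \<Rightarrow> 'a set \<Rightarrow> bool" where
  "definable M D \<longleftrightarrow> (\<exists>\<phi> s. range s \<subseteq> univ M \<and> D = {x \<in> univ M. sat M (s(0 := x)) \<phi>})"


section \<open>Extensions\<close>

definition Ext :: "'a struct \<Rightarrow> 'a \<Rightarrow> 'a set" where
  "Ext M c = {m \<in> univ M. m \<in>\<^bsub>M\<^esub> c}"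

definition submodel :: "'a struct \<Rightarrow> 'a struct \<Rightarrow> bool" where
  "submodel M N \<longleftrightarrow> univ M \<subseteq> univ N \<and>
     (\<forall>x\<in>univ M. \<forall>y\<in>univ M. x \<in>\<^bsub>M\<^esub> y \<longleftrightarrow> x \<in>\<^bsub>N\<^esub> y)"

text \<open>\<open>M \<prec> N\<close> includes properness.\<close>

definition elem_submodel :: "'a struct \<Rightarrow> 'a struct \<Rightarrow> bool" (infix "\<prec>" 50) where
  "M \<prec> N \<longleftrightarrow> submodel M N \<and> univ M \<noteq> univ N \<and>
     (\<forall>\<phi> s. range s \<subseteq> univ M \<longrightarrow> (sat M s \<phi> \<longleftrightarrow> sat N s \<phi>))"

definition end_extension :: "'a struct \<Rightarrow> 'a struct \<Rightarrow> bool" where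
  "end_extension M N \<longleftrightarrow> submodel M N \<and> (\<forall>a\<in>univ M. Ext N a = Ext M a)"

definition cofinal_extension :: "'a struct \<Rightarrow> 'a struct \<Rightarrow> bool" where
  "cofinal_extension M N \<longleftrightarrow> submodel M N \<and> (\<forall>b\<in>univ N. \<exists>a\<in>univ M. b \<in> Ext N a)"

definition conservative_extension :: "'a struct \<Rightarrow> 'a struct \<Rightarrow> bool" where
  "conservative_extension M N \<longleftrightarrow> submodel M N \<and>
     (\<forall>D. definable N D \<longrightarrow> definable M (D \<inter> univ M))"

definition minimal_elem_end_extension :: "'a struct \<Rightarrow> 'a struct \<Rightarrow> bool" where
  "minimal_elem_end_extension M N \<longleftrightarrow> M \<prec> N \<and> end_extension M N \<and> \<not> (\<exists>K. M \<prec> K \<and> K \<prec> N)"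

text \<open>The isomorphic copy of a structure along an injection. It is used to make room for new
  elements, since the universe of a structure may exhaust its type.\<close>

definition copy :: "('a \<Rightarrow> 'b) \<Rightarrow> 'a struct \<Rightarrow> 'b struct" where
  "copy j M = \<lparr>univ = j ` univ M,
     mem = (\<lambda>x y. \<exists>a\<in>univ M. \<exists>b\<in>univ M. x = j a \<and> y = j b \<and> a \<in>\<^bsub>M\<^esub> b)\<rparr>"


section \<open>Set-theoretic notions inside a structure\<close>

text \<open>In the following definitions \<open>M\<close> is a structure and the other arguments are elements of it.
  All quantifiers over objects are restricted to \<open>univ M\<close>, so each definition spells out the
  satisfaction in \<open>M\<close> of a first-order formula in the language of set theory; numbers, formulas
  and so on are those of \<open>M\<close>, which may be nonstandard.\<close>

definition is_empty :: "'a struct \<Rightarrow> 'a \<Rightarrow> bool" where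
  "is_empty M x \<longleftrightarrow> (\<forall>z\<in>univ M. \<not> z \<in>\<^bsub>M\<^esub> x)"

definition is_subset :: "'a struct \<Rightarrow> 'a \<Rightarrow> 'a \<Rightarrow> bool" where
  "is_subset M x y \<longleftrightarrow> (\<forall>z\<in>univ M. z \<in>\<^bsub>M\<^esub> x \<longrightarrow> z \<in>\<^bsub>M\<^esub> y)"

definition is_upair :: "'a struct \<Rightarrow> 'a \<Rightarrow> 'a \<Rightarrow> 'a \<Rightarrow> bool" where
  "is_upair M a b z \<longleftrightarrow> (\<forall>w\<in>univ M. w \<in>\<^bsub>M\<^esub> z \<longleftrightarrow> w = a \<or> w = b)"

definition is_pair :: "'a struct \<Rightarrow> 'a \<Rightarrow> 'a \<Rightarrow> 'a \<Rightarrow> bool" where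
  "is_pair M a b z \<longleftrightarrow>
     (\<exists>c\<in>univ M. \<exists>d\<in>univ M. is_upair M a a c \<and> is_upair M a b d \<and> is_upair M c d z)"

definition is_succ :: "'a struct \<Rightarrow> 'a \<Rightarrow> 'a \<Rightarrow> bool" where
  "is_succ M x y \<longleftrightarrow> (\<forall>w\<in>univ M. w \<in>\<^bsub>M\<^esub> y \<longleftrightarrow> w \<in>\<^bsub>M\<^esub> x \<or> w = x)"

definition is_transitive :: "'a struct \<Rightarrow> 'a \<Rightarrow> bool" where
  "is_transitive M x \<longleftrightarrow> (\<forall>y\<in>univ M. y \<in>\<^bsub>M\<^esub> x \<longrightarrow> is_subset M y x)"

definition is_ordinal :: "'a struct \<Rightarrow> 'a \<Rightarrow> bool" where
  "is_ordinal M x \<longleftrightarrow> is_transitive M x \<and> (\<forall>y\<in>univ M. y \<in>\<^bsub>M\<^esub> x \<longrightarrow> is_transitive M y)"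

definition is_inductive :: "'a struct \<Rightarrow> 'a \<Rightarrow> bool" where
  "is_inductive M I \<longleftrightarrow> (\<exists>e\<in>univ M. is_empty M e \<and> e \<in>\<^bsub>M\<^esub> I) \<and>
     (\<forall>x\<in>univ M. x \<in>\<^bsub>M\<^esub> I \<longrightarrow> (\<exists>y\<in>univ M. is_succ M x y \<and> y \<in>\<^bsub>M\<^esub> I))"

definition is_omega :: "'a struct \<Rightarrow> 'a \<Rightarrow> bool" where
  "is_omega M w \<longleftrightarrow> is_inductive M w \<and> (\<forall>I\<in>univ M. is_inductive M I \<longrightarrow> is_subset M w I)"

fun is_numeral :: "'a struct \<Rightarrow> nat \<Rightarrow> 'a \<Rightarrow> bool" where
  "is_numeral M 0 z \<longleftrightarrow> is_empty M z"
| "is_numeral M (Suc k) z \<longleftrightarrow> (\<exists>y\<in>univ M. is_numeral M k y \<and> is_succ M y z)"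

text \<open>\<open>rel M r x y\<close>: the ordered pair of \<open>x\<close> and \<open>y\<close> belongs to \<open>r\<close>; if \<open>r\<close> is a function, this
  means \<open>r(x) = y\<close>.\<close>

definition rel :: "'a struct \<Rightarrow> 'a \<Rightarrow> 'a \<Rightarrow> 'a \<Rightarrow> bool" where
  "rel M r x y \<longleftrightarrow> (\<exists>z\<in>univ M. is_pair M x y z \<and> z \<in>\<^bsub>M\<^esub> r)"

definition is_function :: "'a struct \<Rightarrow> 'a \<Rightarrow> 'a \<Rightarrow> 'a \<Rightarrow> bool" where
  "is_function M f a b \<longleftrightarrow>
     (\<forall>z\<in>univ M. z \<in>\<^bsub>M\<^esub> f \<longrightarrow>
        (\<exists>x\<in>univ M. \<exists>y\<in>univ M. x \<in>\<^bsub>M\<^esub> a \<and> y \<in>\<^bsub>M\<^esub> b \<and> is_pair M x y z)) \<and>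
     (\<forall>x\<in>univ M. x \<in>\<^bsub>M\<^esub> a \<longrightarrow> (\<exists>!y. y \<in> univ M \<and> rel M f x y))"

text \<open>\<open>v\<close> is the level \<open>V\<^sub>\<alpha>\<close> of the cumulative hierarchy: \<open>f\<close> is the function
  on \<open>\<alpha> + 1\<close> with \<open>f(\<beta>) = (\<Union>\<gamma><\<beta>. Pow (f(\<gamma>)))\<close>, and \<open>v = f(\<alpha>)\<close>.\<close>

definition is_V :: "'a struct \<Rightarrow> 'a \<Rightarrow> 'a \<Rightarrow> bool" where
  "is_V M \<alpha> v \<longleftrightarrow> is_ordinal M \<alpha> \<and>
     (\<exists>d\<in>univ M. \<exists>r\<in>univ M. \<exists>f\<in>univ M. is_succ M \<alpha> d \<and> is_function M f d r \<and>
        (\<forall>\<beta>\<in>univ M. \<forall>y\<in>univ M. \<beta> \<in>\<^bsub>M\<^esub> d \<and> rel M f \<beta> y \<longrightarrow>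
           (\<forall>x\<in>univ M. x \<in>\<^bsub>M\<^esub> y \<longleftrightarrow>
              (\<exists>\<gamma>\<in>univ M. \<exists>z\<in>univ M. \<gamma> \<in>\<^bsub>M\<^esub> \<beta> \<and> rel M f \<gamma> z \<and> is_subset M x z))) \<and>
        rel M f \<alpha> v)"


section \<open>Internal syntax and semantics\<close>

text \<open>The internal formulas are coded by triples mirroring the type \<open>fm\<close>: with \<open>w\<close> the set of
  natural numbers of \<open>M\<close>, \<open>(0, i, j)\<close> codes \<open>v\<^sub>i \<in> v\<^sub>j\<close>, \<open>(1, i, j)\<close> codes \<open>v\<^sub>i = v\<^sub>j\<close>,
  \<open>(2, f, g)\<close> codes \<open>\<not> (f \<and> g)\<close>, and \<open>(3, i, f)\<close> codes \<open>\<exists>v\<^sub>i. f\<close>.\<close>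

definition is_code :: "'a struct \<Rightarrow> nat \<Rightarrow> 'a \<Rightarrow> 'a \<Rightarrow> 'a \<Rightarrow> bool" where
  "is_code M k a b z \<longleftrightarrow>
     (\<exists>t\<in>univ M. \<exists>u\<in>univ M. is_numeral M k t \<and> is_pair M a b u \<and> is_pair M t u z)"

definition fm_closed :: "'a struct \<Rightarrow> 'a \<Rightarrow> 'a \<Rightarrow> bool" where
  "fm_closed M w F \<longleftrightarrow>
     (\<forall>i\<in>univ M. \<forall>j\<in>univ M. \<forall>z\<in>univ M. i \<in>\<^bsub>M\<^esub> w \<and> j \<in>\<^bsub>M\<^esub> w \<and>
        (is_code M 0 i j z \<or> is_code M 1 i j z) \<longrightarrow> z \<in>\<^bsub>M\<^esub> F) \<and>
     (\<forall>f\<in>univ M. \<forall>g\<in>univ M. \<forall>z\<in>univ M. f \<in>\<^bsub>M\<^esub> F \<and> g \<in>\<^bsub>M\<^esub> F \<and>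
        is_code M 2 f g z \<longrightarrow> z \<in>\<^bsub>M\<^esub> F) \<and>
     (\<forall>i\<in>univ M. \<forall>f\<in>univ M. \<forall>z\<in>univ M. i \<in>\<^bsub>M\<^esub> w \<and> f \<in>\<^bsub>M\<^esub> F \<and>
        is_code M 3 i f z \<longrightarrow> z \<in>\<^bsub>M\<^esub> F)"

definition is_formulas :: "'a struct \<Rightarrow> 'a \<Rightarrow> 'a \<Rightarrow> bool" where
  "is_formulas M w F \<longleftrightarrow> fm_closed M w F \<and>
     (\<forall>G\<in>univ M. fm_closed M w G \<longrightarrow> is_subset M F G)"

text \<open>Internal assignments in a set \<open>A\<close> are functions from \<open>w\<close> to \<open>A\<close>;
  \<open>t\<close> is \<open>s\<close> with the value at \<open>i\<close> changed to \<open>a\<close>.\<close>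

definition is_update :: "'a struct \<Rightarrow> 'a \<Rightarrow> 'a \<Rightarrow> 'a \<Rightarrow> 'a \<Rightarrow> 'a \<Rightarrow> 'a \<Rightarrow> bool" where
  "is_update M w A s i a t \<longleftrightarrow> is_function M t w A \<and> rel M t i a \<and>
     (\<forall>j\<in>univ M. j \<in>\<^bsub>M\<^esub> w \<and> j \<noteq> i \<longrightarrow> (\<forall>b\<in>univ M. rel M t j b \<longleftrightarrow> rel M s j b))"

text \<open>\<open>S\<close> is a satisfaction relation for the structure \<open>(A, \<in>)\<close> of \<open>M\<close>: the relation
  \<open>rel M S f s\<close> between formulas and assignments obeys Tarski's clauses.\<close>

definition is_satisfaction :: "'a struct \<Rightarrow> 'a \<Rightarrow> 'a \<Rightarrow> 'a \<Rightarrow> 'a \<Rightarrow> bool" where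
  "is_satisfaction M w F A S \<longleftrightarrow>
     (\<forall>s\<in>univ M. is_function M s w A \<longrightarrow>
       (\<forall>i\<in>univ M. \<forall>j\<in>univ M. \<forall>z\<in>univ M. i \<in>\<^bsub>M\<^esub> w \<and> j \<in>\<^bsub>M\<^esub> w \<and> is_code M 0 i j z \<longrightarrow>
          (rel M S z s \<longleftrightarrow>
            (\<exists>a\<in>univ M. \<exists>b\<in>univ M. rel M s i a \<and> rel M s j b \<and> a \<in>\<^bsub>M\<^esub> b))) \<and>
       (\<forall>i\<in>univ M. \<forall>j\<in>univ M. \<forall>z\<in>univ M. i \<in>\<^bsub>M\<^esub> w \<and> j \<in>\<^bsub>M\<^esub> w \<and> is_code M 1 i j z \<longrightarrow>
          (rel M S z s \<longleftrightarrow> (\<exists>a\<in>univ M. rel M s i a \<and> rel M s j a))) \<and>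
       (\<forall>f\<in>univ M. \<forall>g\<in>univ M. \<forall>z\<in>univ M. f \<in>\<^bsub>M\<^esub> F \<and> g \<in>\<^bsub>M\<^esub> F \<and> is_code M 2 f g z \<longrightarrow>
          (rel M S z s \<longleftrightarrow> \<not> (rel M S f s \<and> rel M S g s))) \<and>
       (\<forall>i\<in>univ M. \<forall>f\<in>univ M. \<forall>z\<in>univ M. i \<in>\<^bsub>M\<^esub> w \<and> f \<in>\<^bsub>M\<^esub> F \<and> is_code M 3 i f z \<longrightarrow>
          (rel M S z s \<longleftrightarrow>
            (\<exists>a\<in>univ M. \<exists>t\<in>univ M. a \<in>\<^bsub>M\<^esub> A \<and> is_update M w A s i a t \<and> rel M S f t))))"

text \<open>\<open>M\<close> believes that \<open>p \<in> V\<^sub>\<alpha>\<close> and that \<open>x\<close> is definable in the structure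
  \<open>(V\<^sub>\<alpha>, \<in>, p, \<beta>)\<^bsub>\<beta><\<alpha>\<^esub>\<close>. The defining formula \<open>f\<close> has the object variable \<open>v\<^sub>0\<close>; the
  assignment \<open>s\<close> interprets \<open>v\<^sub>1\<close> by \<open>p\<close> and all later variables by ordinals below \<open>\<alpha>\<close>. Only the
  finitely many variables occurring in \<open>f\<close> matter. Here \<open>n0\<close> and \<open>n1\<close> are the numbers 0 and 1
  of \<open>M\<close>.\<close>

definition definable_in_V :: "'a struct \<Rightarrow> 'a \<Rightarrow> 'a \<Rightarrow> 'a \<Rightarrow> bool" where
  "definable_in_V M \<alpha> p x \<longleftrightarrow>
     (\<exists>v\<in>univ M. \<exists>w\<in>univ M. \<exists>F\<in>univ M. \<exists>S\<in>univ M. \<exists>n0\<in>univ M. \<exists>n1\<in>univ M.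
        is_V M \<alpha> v \<and> is_omega M w \<and> is_formulas M w F \<and> is_satisfaction M w F v S \<and>
        is_numeral M 0 n0 \<and> is_numeral M 1 n1 \<and> p \<in>\<^bsub>M\<^esub> v \<and> x \<in>\<^bsub>M\<^esub> v \<and>
        (\<exists>f\<in>univ M. \<exists>s\<in>univ M. f \<in>\<^bsub>M\<^esub> F \<and> is_function M s w v \<and> rel M s n1 p \<and>
           (\<forall>i\<in>univ M. i \<in>\<^bsub>M\<^esub> w \<and> i \<noteq> n0 \<and> i \<noteq> n1 \<longrightarrow>
              (\<exists>\<beta>\<in>univ M. \<beta> \<in>\<^bsub>M\<^esub> \<alpha> \<and> rel M s i \<beta>)) \<and>
           (\<forall>y\<in>univ M. \<forall>t\<in>univ M. y \<in>\<^bsub>M\<^esub> v \<and> is_update M w v s n0 y t \<longrightarrow>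
              (rel M S f t \<longleftrightarrow> y = x))))"


section \<open>The theory\<close>

definition V_eq_HOD :: "'a struct \<Rightarrow> 'a \<Rightarrow> bool" where
  "V_eq_HOD M p \<longleftrightarrow>
     (\<forall>x\<in>univ M. \<exists>\<alpha>\<in>univ M. is_ordinal M \<alpha> \<and> definable_in_V M \<alpha> p x)"

definition models_ex_V_eq_HOD :: "'a struct \<Rightarrow> bool" where
  "models_ex_V_eq_HOD M \<longleftrightarrow> (\<exists>p\<in>univ M. V_eq_HOD M p)"

text \<open>In the two schemes the free variables other than 0 (and 1) are parameters.\<close>

definition separation_scheme :: "'a struct \<Rightarrow> bool" where
  "separation_scheme M \<longleftrightarrow>
     (\<forall>\<phi> s. range s \<subseteq> univ M \<longrightarrow>
        (\<forall>a\<in>univ M. \<exists>b\<in>univ M. \<forall>x\<in>univ M.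
           x \<in>\<^bsub>M\<^esub> b \<longleftrightarrow> x \<in>\<^bsub>M\<^esub> a \<and> sat M (s(0 := x)) \<phi>))"

definition replacement_scheme :: "'a struct \<Rightarrow> bool" where
  "replacement_scheme M \<longleftrightarrow>
     (\<forall>\<phi> s. range s \<subseteq> univ M \<longrightarrow>
        (\<forall>a\<in>univ M.
           (\<forall>x\<in>univ M. x \<in>\<^bsub>M\<^esub> a \<longrightarrow> (\<exists>!y. y \<in> univ M \<and> sat M (s(0 := x, 1 := y)) \<phi>)) \<longrightarrow>
           (\<exists>b\<in>univ M. \<forall>y\<in>univ M.
              y \<in>\<^bsub>M\<^esub> b \<longleftrightarrow> (\<exists>x\<in>univ M. x \<in>\<^bsub>M\<^esub> a \<and> sat M (s(0 := x, 1 := y)) \<phi>))))"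

definition models_ZF :: "'a struct \<Rightarrow> bool" where
  "models_ZF M \<longleftrightarrow>
     \<comment> \<open>extensionality\<close>
     (\<forall>x\<in>univ M. \<forall>y\<in>univ M. (\<forall>z\<in>univ M. z \<in>\<^bsub>M\<^esub> x \<longleftrightarrow> z \<in>\<^bsub>M\<^esub> y) \<longrightarrow> x = y) \<and>
     \<comment> \<open>foundation\<close>
     (\<forall>x\<in>univ M. \<not> is_empty M x \<longrightarrow>
        (\<exists>y\<in>univ M. y \<in>\<^bsub>M\<^esub> x \<and> (\<forall>z\<in>univ M. z \<in>\<^bsub>M\<^esub> x \<longrightarrow> \<not> z \<in>\<^bsub>M\<^esub> y))) \<and>
     \<comment> \<open>pairing\<close>
     (\<forall>x\<in>univ M. \<forall>y\<in>univ M. \<exists>z\<in>univ M. is_upair M x y z) \<and>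
     \<comment> \<open>union\<close>
     (\<forall>x\<in>univ M. \<exists>u\<in>univ M. \<forall>z\<in>univ M.
        z \<in>\<^bsub>M\<^esub> u \<longleftrightarrow> (\<exists>y\<in>univ M. y \<in>\<^bsub>M\<^esub> x \<and> z \<in>\<^bsub>M\<^esub> y)) \<and>
     \<comment> \<open>power set\<close>
     (\<forall>x\<in>univ M. \<exists>q\<in>univ M. \<forall>z\<in>univ M. z \<in>\<^bsub>M\<^esub> q \<longleftrightarrow> is_subset M z x) \<and>
     \<comment> \<open>infinity\<close>
     (\<exists>I\<in>univ M. is_inductive M I) \<and>
     separation_scheme M \<and> replacement_scheme M"

end

theory Submission
  imports Defs "HOL-Library.Countable"
begin

text \<open>A definable injection of the universe into the ordinals, provided by \<open>V = HOD(p)\<close>, yields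
  definable Skolem functions and a definable well-ordering of the universe with small initial
  segments. Enumerate the formulas (with one parameter) in type \<open>\<omega>\<close>. Stage \<open>n\<close> decides, by a
  definable transfinite version of the ultrafilter lemma, the \<open>n\<close>-th formula for all parameters
  simultaneously. The result is an ultrafilter on the definable classes that
  is itself definable formula by formula, so that the ultrapower \<open>N\<close> by definable functions is a
  conservative extension of \<open>M\<close>; \<open>M*\<close> is the set of elements of \<open>N\<close> that are bounded by an element
  of \<open>M\<close>.

  For minimality, the stages also produce generators \<open>c = c\<^sub>0, c\<^sub>1, \<dots>\<close> of \<open>N\<close> which
  descend to \<open>M*\<close> and satisfy \<open>c\<^sub>n = s\<^sub>n(c\<^sub>n\<^sub>+\<^sub>1)\<close>, where \<open>c\<^sub>n\<^sub>+\<^sub>1\<close> is taken from a class \<open>E\<^sub>n\<close>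
  so sparse that \<open>f(c)\<close> lies below the element of \<open>E\<^sub>n\<close> following \<open>c\<^sub>n\<^sub>+\<^sub>1\<close>, for every function \<open>f\<close> given by the
  \<open>n\<close>-th formula. If \<open>f(c)\<close> is unbounded then \<open>f(c) > c\<^sub>n\<^sub>+\<^sub>1\<close>, hence \<open>c\<^sub>n\<^sub>+\<^sub>1\<close> and with it \<open>c\<close> is definable from
  \<open>f(c)\<close>. A genuinely infinite set of requirements cannot be met by one choice of \<open>s\<^sub>n(z)\<close>, so every
  \<open>z\<close> in \<open>E\<^sub>n\<close> carries an internally finite set of requirements, and generically this set contains all
  elements of \<open>M\<close>. Such a set is internally finite but contains all natural numbers of \<open>M\<close>, so \<open>M*\<close> differs from \<open>M\<close>.\<close>

section \<open>Definable predicates and terms\<close>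

text \<open>Tarski's theorem shapes the construction: one definable class deciding all formulas
  would define truth in \<open>M\<close>. So the decisions are made stage by stage over the standard
  formula numbers, with external choice between the stages, while each stage is definable in
  \<open>M\<close> and treats all parameters at once. The transfinite induction inside a stage needs
  a notion of consistency that \<open>M\<close> can express and that survives limits. Consistency
  for internally finite sets of conditions has both properties: it is a definable notion, and a
  finite set of indices below a limit is bounded below that limit. Consistency for arbitrary sets of
  conditions could break down there. The price is that the ultrapower adds elements to old sets,
  which is why \<open>M\<close> is replaced by its convex closure \<open>M*\<close>. V = HOD enters
  through an injection of the universe into the ordinals: least witnesses become Skolem functions,
  and recursion can run through all parameters along a set-like order. The refinement to sparser
  generators is a separate matter: an ultrafilter decides truth, but does not ensure that unbounded
  elements of \<open>N\<close> compute \<open>c\<close>.\<close>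

primrec vars :: "fm \<Rightarrow> nat set" where
  "vars (Mem i j) = {i, j}"
| "vars (Eq i j) = {i, j}"
| "vars (Nand \<phi> \<psi>) = vars \<phi> \<union> vars \<psi>"
| "vars (Ex i \<phi>) = insert i (vars \<phi>)"

lemma finite_vars [simp]: "finite (vars \<phi>)"
  by (induction \<phi>) auto

lemma sat_cong: "(\<And>i. i \<in> vars \<phi> \<Longrightarrow> s i = t i) \<Longrightarrow> sat M s \<phi> \<longleftrightarrow> sat M t \<phi>"
proof (induction \<phi> arbitrary: s t)
  case (Ex i \<phi>)
  have "sat M (s(i := a)) \<phi> \<longleftrightarrow> sat M (t(i := a)) \<phi>" for a
    by (rule Ex.IH) (use Ex.prems in auto)
  then show ?case by simp
next
  case (Nand \<phi> \<psi>)
  have "sat M s \<phi> \<longleftrightarrow> sat M t \<phi>" by (rule Nand.IH) (use Nand.prems in auto)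
  moreover have "sat M s \<psi> \<longleftrightarrow> sat M t \<psi>" by (rule Nand.IH) (use Nand.prems in auto)
  ultimately show ?case by simp
qed auto

primrec ren :: "(nat \<Rightarrow> nat) \<Rightarrow> fm \<Rightarrow> fm" where
  "ren f (Mem i j) = Mem (f i) (f j)"
| "ren f (Eq i j) = Eq (f i) (f j)"
| "ren f (Nand \<phi> \<psi>) = Nand (ren f \<phi>) (ren f \<psi>)"
| "ren f (Ex i \<phi>) = Ex (f i) (ren f \<phi>)"

lemma sat_ren: "inj f \<Longrightarrow> sat M s (ren f \<phi>) \<longleftrightarrow> sat M (\<lambda>i. s (f i)) \<phi>"
proof (induction \<phi> arbitrary: s)
  case (Ex i \<phi>)
  have "(\<lambda>j. (s(f i := a)) (f j)) = (\<lambda>j. s (f j))(i := a)" for a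
    using \<open>inj f\<close> by (auto simp: fun_eq_iff inj_def)
  then show ?case using Ex by simp
qed auto

text \<open>Stands in for substitution, which \<open>fm\<close> does not offer: each
  \<open>k\<close> is replaced by \<open>m\<close> through a quantifier, as in "some
  \<open>k\<close> equal to \<open>m\<close> satisfies ...". A binder of \<open>fm\<close> binds one
  variable, whereas several variables may stand for the same entry of an environment.\<close>

lemma sat_identify:
  assumes "finite K" "m \<notin> K"
  shows "\<exists>\<psi>. \<forall>s. s m \<in> univ M \<longrightarrow> (sat M s \<psi> \<longleftrightarrow> sat M (\<lambda>k. if k \<in> K then s m else s k) \<phi>)"
  using assms
proof (induction K arbitrary: \<phi> rule: finite_induct)
  case empty
  then show ?case by auto
next
  case (insert k K)
  then obtain \<psi> where \<psi>: "\<And>s. s m \<in> univ M \<Longrightarrow>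
      sat M s \<psi> \<longleftrightarrow> sat M (\<lambda>k. if k \<in> K then s m else s k) \<phi>" by auto
  let ?c = "Nand (Eq k m) \<psi>"
  let ?\<psi> = "Ex k (Nand ?c ?c)"
  have "sat M s ?\<psi> \<longleftrightarrow> sat M (\<lambda>j. if j \<in> insert k K then s m else s j) \<phi>" if "s m \<in> univ M" for s
  proof -
    have "sat M s ?\<psi> \<longleftrightarrow> sat M (s(k := s m)) \<psi>" using insert that by auto
    also have "\<dots> \<longleftrightarrow> sat M (\<lambda>j. if j \<in> K then s m else (s(k := s m)) j) \<phi>"
    proof -
      have "(s(k := s m)) m = s m" using insert by simp
      then show ?thesis using \<psi>[of "s(k := s m)"] that by (simp only:)
    qed
    also have "(\<lambda>j. if j \<in> K then s m else (s(k := s m)) j) = (\<lambda>j. if j \<in> insert k K then s m else s j)"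
      by (auto simp: fun_eq_iff)
    finally show ?thesis .
  qed
  then show ?case by blast
qed

text \<open>Closure rules for \<open>Dfn\<close> and \<open>Tm\<close>. Definability goals are
  discharged by following the structure of the HOL term, so that formulas of \<open>fm\<close>
  rarely have to be written out.\<close>

named_theorems dfn

locale set_struct =
  fixes M :: "'a struct"
  assumes univ_nonempty: "univ M \<noteq> {}"
begin

abbreviation U :: "'a set" where "U \<equiv> univ M"

abbreviation mem_M :: "'a \<Rightarrow> 'a \<Rightarrow> bool" (infix "\<epsilon>" 50) where "x \<epsilon> y \<equiv> mem M x y"

text \<open>Under \<open>\<tau>\<close> a variable of the formula stands for an entry of the environment (\<open>Inl\<close>) or for
  a parameter (\<open>Inr\<close>). Environments are de Bruijn style: a bound object is entry 0, and the
  other entries are shifted.\<close>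

definition Dfn :: "((nat \<Rightarrow> 'a) \<Rightarrow> bool) \<Rightarrow> bool" where
  "Dfn P \<longleftrightarrow> (\<exists>\<phi> \<tau>. (\<forall>i c. \<tau> i = Inr c \<longrightarrow> c \<in> U) \<and>
     (\<forall>e. (\<forall>i. e i \<in> U) \<longrightarrow> (P e \<longleftrightarrow> sat M (\<lambda>i. case_sum e id (\<tau> i)) \<phi>)))"

definition Tm :: "((nat \<Rightarrow> 'a) \<Rightarrow> 'a) \<Rightarrow> bool" where
  "Tm t \<longleftrightarrow> (\<forall>e. (\<forall>i. e i \<in> U) \<longrightarrow> t e \<in> U) \<and> Dfn (\<lambda>e. e 0 = t (\<lambda>i. e (Suc i)))"

lemma Dfn_cong: "Dfn P \<Longrightarrow> (\<And>e. (\<And>i. e i \<in> U) \<Longrightarrow> P e \<longleftrightarrow> Q e) \<Longrightarrow> Dfn Q"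
  unfolding Dfn_def by metis

lemma Tm_closed: "Tm t \<Longrightarrow> (\<And>i. e i \<in> U) \<Longrightarrow> t e \<in> U"
  by (auto simp: Tm_def)

lemma Dfn_subst_const:
  assumes "Dfn P" "\<And>i c. \<sigma> i = Inr c \<Longrightarrow> c \<in> U"
  shows "Dfn (\<lambda>e. P (\<lambda>i. case_sum e id (\<sigma> i)))"
proof -
  obtain \<phi> \<tau> where *: "\<And>i c. \<tau> i = Inr c \<Longrightarrow> c \<in> U"
    "\<And>e. (\<And>i. e i \<in> U) \<Longrightarrow> P e \<longleftrightarrow> sat M (\<lambda>i. case_sum e id (\<tau> i)) \<phi>"
    using assms(1) unfolding Dfn_def by metis
  define \<rho> where "\<rho> i = (case \<tau> i of Inl k \<Rightarrow> \<sigma> k | Inr c \<Rightarrow> Inr c)" for i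
  show ?thesis unfolding Dfn_def
  proof (intro exI conjI allI impI)
    show "c \<in> U" if "\<rho> i = Inr c" for i c using that * assms(2) by (auto simp: \<rho>_def split: sum.splits)
    fix e :: "nat \<Rightarrow> 'a" assume e: "\<forall>i. e i \<in> U"
    have "case_sum (\<lambda>i. case_sum e id (\<sigma> i)) id (\<tau> i) = case_sum e id (\<rho> i)" for i
      by (auto simp: \<rho>_def split: sum.split)
    moreover have "case_sum e id (\<sigma> i) \<in> U" for i using e assms(2) by (auto split: sum.split)
    ultimately show "P (\<lambda>i. case_sum e id (\<sigma> i)) \<longleftrightarrow> sat M (\<lambda>i. case_sum e id (\<rho> i)) \<phi>"
      using *(2)[of "\<lambda>i. case_sum e id (\<sigma> i)"] by simp
  qed
qed

lemma Dfn_subst: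
  assumes "Dfn P" shows "Dfn (\<lambda>e. P (\<lambda>i. e (f i)))"
  using Dfn_subst_const[OF assms, of "\<lambda>i. Inl (f i)"] by simp

lemma Dfn_Nand:
  assumes "Dfn P" "Dfn Q" shows "Dfn (\<lambda>e. \<not> (P e \<and> Q e))"
proof -
  obtain \<phi> \<tau> where P: "\<And>i c. \<tau> i = Inr c \<Longrightarrow> c \<in> U"
    "\<And>e. (\<And>i. e i \<in> U) \<Longrightarrow> P e \<longleftrightarrow> sat M (\<lambda>i. case_sum e id (\<tau> i)) \<phi>"
    using assms(1) unfolding Dfn_def by metis
  obtain \<psi> \<sigma> where Q: "\<And>i c. \<sigma> i = Inr c \<Longrightarrow> c \<in> U"
    "\<And>e. (\<And>i. e i \<in> U) \<Longrightarrow> Q e \<longleftrightarrow> sat M (\<lambda>i. case_sum e id (\<sigma> i)) \<psi>"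
    using assms(2) unfolding Dfn_def by metis
  \<comment> \<open>Even and odd variables keep the two formulas and their parameters apart.\<close>
  define \<rho> where "\<rho> i = (if even i then \<tau> (i div 2) else \<sigma> (i div 2))" for i
  have inj: "inj (\<lambda>i::nat. 2 * i)" "inj (\<lambda>i::nat. 2 * i + 1)" by (auto simp: inj_def)
  show ?thesis unfolding Dfn_def
  proof (intro exI conjI allI impI)
    show "c \<in> U" if "\<rho> i = Inr c" for i c using that P(1) Q(1) by (auto simp: \<rho>_def split: if_splits)
    show "(\<not> (P e \<and> Q e)) \<longleftrightarrow>
      sat M (\<lambda>i. case_sum e id (\<rho> i)) (Nand (ren (\<lambda>i. 2 * i) \<phi>) (ren (\<lambda>i. 2 * i + 1) \<psi>))"
      if "\<forall>i. e i \<in> U" for e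
      using P(2) Q(2) that by (simp add: sat_ren[OF inj(1)] sat_ren[OF inj(2)[unfolded Suc_eq_plus1[symmetric]]] \<rho>_def)
  qed
qed

lemma Dfn_Bex_aux:
  assumes "Dfn P" shows "Dfn (\<lambda>e. \<exists>y\<in>U. P (case_nat y e))"
proof -
  obtain \<phi> \<tau> where P: "\<And>i c. \<tau> i = Inr c \<Longrightarrow> c \<in> U"
    "\<And>e. (\<And>i. e i \<in> U) \<Longrightarrow> P e \<longleftrightarrow> sat M (\<lambda>i. case_sum e id (\<tau> i)) \<phi>"
    using assms unfolding Dfn_def by metis
  \<comment> \<open>All variables that stand for the quantified entry 0. The shift by
    \<open>Suc\<close> frees variable 0, which is going to be bound in their place.\<close>
  define K where "K = {Suc i |i. i \<in> vars \<phi> \<and> \<tau> i = Inl 0}"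
  have "finite K" unfolding K_def by simp
  then obtain \<psi> where \<psi>: "\<And>s. s 0 \<in> U \<Longrightarrow>
      sat M s \<psi> \<longleftrightarrow> sat M (\<lambda>k. if k \<in> K then s 0 else s k) (ren Suc \<phi>)"
    using sat_identify[of K 0 M "ren Suc \<phi>"] unfolding K_def by auto
  \<comment> \<open>For \<open>k = 0\<close> the value \<open>Inl (k - 1)\<close> is junk; such a
    variable, if it occurs in the formula, lies in \<open>K\<close> and is overwritten.\<close>
  define \<sigma> where "\<sigma> j = (case j of 0 \<Rightarrow> Inl 0
     | Suc i \<Rightarrow> (case \<tau> i of Inl k \<Rightarrow> Inl (k - 1) | Inr c \<Rightarrow> Inr c))" for j
  show ?thesis unfolding Dfn_def
  proof (intro exI conjI allI impI)
    show "c \<in> U" if "\<sigma> i = Inr c" for i c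
      using that P(1) by (auto simp: \<sigma>_def split: nat.splits sum.splits)
    fix e :: "nat \<Rightarrow> 'a" assume e: "\<forall>i. e i \<in> U"
    have "P (case_nat y e) \<longleftrightarrow> sat M ((\<lambda>i. case_sum e id (\<sigma> i))(0 := y)) \<psi>" if y: "y \<in> U" for y
    proof -
      have "P (case_nat y e) \<longleftrightarrow> sat M (\<lambda>i. case_sum (case_nat y e) id (\<tau> i)) \<phi>"
        by (rule P(2)) (use e y in \<open>auto split: nat.split\<close>)
      also have "\<dots> \<longleftrightarrow> sat M (\<lambda>i. if Suc i \<in> K then y else case_sum e id (\<sigma> (Suc i))) \<phi>"
        by (rule sat_cong) (auto simp: K_def \<sigma>_def split: sum.split nat.split)
      also have "\<dots> \<longleftrightarrow> sat M ((\<lambda>i. case_sum e id (\<sigma> i))(0 := y)) \<psi>"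
        using y by (simp add: \<psi> sat_ren cong: if_cong)
      finally show ?thesis .
    qed
    then show "(\<exists>y\<in>U. P (case_nat y e)) \<longleftrightarrow> sat M (\<lambda>i. case_sum e id (\<sigma> i)) (Ex 0 \<psi>)"
      by auto
  qed
qed

lemma Dfn_mem_var: "Dfn (\<lambda>e. e i \<epsilon> e j)"
  unfolding Dfn_def
  by (rule exI[of _ "Mem 0 1"], rule exI[of _ "\<lambda>k. Inl (if k = 0 then i else j)"]) simp

lemma Dfn_eq_var: "Dfn (\<lambda>e. e i = e j)"
  unfolding Dfn_def
  by (rule exI[of _ "Eq 0 1"], rule exI[of _ "\<lambda>k. Inl (if k = 0 then i else j)"]) simp

lemma Dfn_eq_const: "c \<in> U \<Longrightarrow> Dfn (\<lambda>e. e i = c)"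
  unfolding Dfn_def
  by (rule exI[of _ "Eq 0 1"], rule exI[of _ "\<lambda>k. if k = 0 then Inl i else Inr c"]) auto

lemma Dfn_not [dfn]: "Dfn P \<Longrightarrow> Dfn (\<lambda>e. \<not> P e)"
  using Dfn_Nand[of P P] by simp

lemma Dfn_conj [dfn]: "Dfn P \<Longrightarrow> Dfn Q \<Longrightarrow> Dfn (\<lambda>e. P e \<and> Q e)"
  using Dfn_not[OF Dfn_Nand[of P Q]] by simp

lemma Dfn_disj [dfn]: "Dfn P \<Longrightarrow> Dfn Q \<Longrightarrow> Dfn (\<lambda>e. P e \<or> Q e)"
  using Dfn_Nand[OF Dfn_not[of P] Dfn_not[of Q]] by simp

lemma Dfn_imp [dfn]: "Dfn P \<Longrightarrow> Dfn Q \<Longrightarrow> Dfn (\<lambda>e. P e \<longrightarrow> Q e)"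
  using Dfn_disj[OF Dfn_not[of P], of Q] by simp

lemma Dfn_iff [dfn]: "Dfn P \<Longrightarrow> Dfn Q \<Longrightarrow> Dfn (\<lambda>e. P e \<longleftrightarrow> Q e)"
  using Dfn_conj[OF Dfn_imp[of P Q] Dfn_imp[of Q P]] by (simp add: iff_conv_conj_imp)

lemma Dfn_const [dfn]: "Dfn (\<lambda>e. Q)"
  using Dfn_eq_var[of 0 0] Dfn_not[OF Dfn_eq_var[of 0 0]] by (cases Q) simp_all

lemma Dfn_Bex [dfn]:
  "Dfn (\<lambda>e. Q (\<lambda>i. e (Suc i)) (e 0)) \<Longrightarrow> Dfn (\<lambda>e. \<exists>y\<in>U. Q e y)"
  using Dfn_Bex_aux[of "\<lambda>e. Q (\<lambda>i. e (Suc i)) (e 0)"] by simp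

lemma Dfn_Ball [dfn]:
  "Dfn (\<lambda>e. Q (\<lambda>i. e (Suc i)) (e 0)) \<Longrightarrow> Dfn (\<lambda>e. \<forall>y\<in>U. Q e y)"
  using Dfn_not[OF Dfn_Bex[of "\<lambda>e y. \<not> Q e y"]] Dfn_not[of "\<lambda>e. Q (\<lambda>i. e (Suc i)) (e 0)"] by simp

lemma Tm_var [dfn]: "Tm (\<lambda>e. e i)"
  by (simp add: Tm_def Dfn_eq_var)

lemma Tm_const [dfn]: "c \<in> U \<Longrightarrow> Tm (\<lambda>e. c)"
  by (simp add: Tm_def Dfn_eq_const)

lemma Tm_subst: "Tm t \<Longrightarrow> Tm (\<lambda>e. t (\<lambda>i. e (f i)))"
  using Dfn_subst[of "\<lambda>e. e 0 = t (\<lambda>i. e (Suc i))" "case_nat 0 (\<lambda>j. Suc (f j))"]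
  by (simp add: Tm_def)

lemma Dfn_comp:
  assumes "Dfn (\<lambda>e. P (\<lambda>i. e (Suc i)) (e 0))" "Tm t" shows "Dfn (\<lambda>e. P e (t e))"
proof -
  have "Dfn (\<lambda>e. e 0 = t (\<lambda>i. e (Suc i)))" using assms(2) by (simp add: Tm_def)
  from Dfn_conj[OF this assms(1)]
  have 1: "Dfn (\<lambda>e. \<exists>y\<in>U. y = t e \<and> P e y)"
    by (rule Dfn_Bex[of "\<lambda>e y. y = t e \<and> P e y"])
  show ?thesis
  proof (rule Dfn_cong[OF 1])
    fix e :: "nat \<Rightarrow> 'a" assume "\<And>i. e i \<in> U"
    then have "t e \<in> U" using assms(2) by (simp add: Tm_def)
    then show "(\<exists>y\<in>U. y = t e \<and> P e y) \<longleftrightarrow> P e (t e)" by simp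
  qed
qed

lemma Tm_comp:
  assumes "Tm (\<lambda>e. F (\<lambda>i. e (Suc i)) (e 0))" "Tm t" shows "Tm (\<lambda>e. F e (t e))"
proof -
  have "Dfn (\<lambda>e. e 0 = F (\<lambda>i. e (Suc (Suc i))) (e (Suc 0)))"
    using assms(1) by (simp add: Tm_def)
  then have "Dfn (\<lambda>e. e (Suc 0) = F (\<lambda>i. e (Suc (Suc i))) (e 0))"
    using Dfn_subst[of "\<lambda>e. e 0 = F (\<lambda>i. e (Suc (Suc i))) (e (Suc 0))"
      "case_nat (Suc 0) (case_nat 0 (\<lambda>j. Suc (Suc j)))"] by simp
  then have "Dfn (\<lambda>e. e 0 = F (\<lambda>i. e (Suc i)) (t (\<lambda>i. e (Suc i))))"
    using Dfn_comp[of "\<lambda>e y. e 0 = F (\<lambda>i. e (Suc i)) y" "\<lambda>e. t (\<lambda>i. e (Suc i))"]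
      Tm_subst[OF assms(2), of Suc] by simp
  moreover have "F e (t e) \<in> U" if "\<And>i. e i \<in> U" for e
    using Tm_closed[OF assms(1), of "case_nat (t e) e"] Tm_closed[OF assms(2), of e] that
    by (auto split: nat.split)
  ultimately show ?thesis by (simp add: Tm_def)
qed

lemma Tm_the:
  assumes "Dfn (\<lambda>e. R (\<lambda>i. e (Suc i)) (e 0))"
    and "\<And>e. (\<And>i. e i \<in> U) \<Longrightarrow> t e \<in> U"
    and "\<And>e y. (\<And>i. e i \<in> U) \<Longrightarrow> y \<in> U \<Longrightarrow> R e y \<longleftrightarrow> y = t e"
  shows "Tm t"
  unfolding Tm_def by (rule conjI) (use assms in \<open>auto elim!: Dfn_cong\<close>)

abbreviation D1 :: "('a \<Rightarrow> bool) \<Rightarrow> bool" where "D1 P \<equiv> Dfn (\<lambda>e. P (e 0))"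
abbreviation D2 :: "('a \<Rightarrow> 'a \<Rightarrow> bool) \<Rightarrow> bool" where "D2 P \<equiv> Dfn (\<lambda>e. P (e 0) (e (Suc 0)))"
abbreviation D3 :: "('a \<Rightarrow> 'a \<Rightarrow> 'a \<Rightarrow> bool) \<Rightarrow> bool" where
  "D3 P \<equiv> Dfn (\<lambda>e. P (e 0) (e (Suc 0)) (e (Suc (Suc 0))))"
abbreviation F1 :: "('a \<Rightarrow> 'a) \<Rightarrow> bool" where "F1 F \<equiv> Tm (\<lambda>e. F (e 0))"
abbreviation F2 :: "('a \<Rightarrow> 'a \<Rightarrow> 'a) \<Rightarrow> bool" where "F2 F \<equiv> Tm (\<lambda>e. F (e 0) (e (Suc 0)))"

lemma D1I: "D1 P \<Longrightarrow> Tm t \<Longrightarrow> Dfn (\<lambda>e. P (t e))"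
  using Dfn_comp[of "\<lambda>e. P" t] by simp

lemma D2I:
  assumes "D2 P" "Tm t" "Tm u" shows "Dfn (\<lambda>e. P (t e) (u e))"
proof -
  have "Dfn (\<lambda>e. P (t (\<lambda>i. e (Suc i))) (e 0))"
    using Dfn_comp[of "\<lambda>e y. P y (e 0)" "\<lambda>e. t (\<lambda>i. e (Suc i))"] assms(1) Tm_subst[OF assms(2), of Suc] by simp
  then show ?thesis using Dfn_comp[of "\<lambda>e y. P (t e) y" u] assms by simp
qed

lemma D3I:
  assumes "D3 P" "Tm t" "Tm u" "Tm v" shows "Dfn (\<lambda>e. P (t e) (u e) (v e))"
proof -
  have "Dfn (\<lambda>e. P (t (\<lambda>i. e (Suc (Suc i)))) (e 0) (e (Suc 0)))"
    using Dfn_comp[of "\<lambda>e y. P y (e 0) (e (Suc 0))" "\<lambda>e. t (\<lambda>i. e (Suc (Suc i)))"]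
      Tm_subst[OF assms(2), of "\<lambda>i. Suc (Suc i)"] assms(1) by simp
  then have "Dfn (\<lambda>e. P (t (\<lambda>i. e (Suc i))) (u (\<lambda>i. e (Suc i))) (e 0))"
    using Dfn_comp[of "\<lambda>e y. P (t (\<lambda>i. e (Suc i))) y (e 0)" "\<lambda>e. u (\<lambda>i. e (Suc i))"]
      Tm_subst[OF assms(3), of Suc] by simp
  then show ?thesis using Dfn_comp[of "\<lambda>e y. P (t e) (u e) y" v] assms by simp
qed

lemma Dfn_mem [dfn]: "Tm t \<Longrightarrow> Tm u \<Longrightarrow> Dfn (\<lambda>e. t e \<epsilon> u e)"
  by (rule D2I[of "mem M"]) (rule Dfn_mem_var)

lemma Dfn_eq [dfn]: "Tm t \<Longrightarrow> Tm u \<Longrightarrow> Dfn (\<lambda>e. t e = u e)"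
  by (rule D2I[of "(=)"]) (rule Dfn_eq_var)

lemma F1I: "F1 F \<Longrightarrow> Tm t \<Longrightarrow> Tm (\<lambda>e. F (t e))"
  using Tm_comp[of "\<lambda>e. F" t] by simp

lemma F2I:
  assumes "F2 F" "Tm t" "Tm u" shows "Tm (\<lambda>e. F (t e) (u e))"
proof -
  have 1: "Tm (\<lambda>e. F (t (\<lambda>i. e (Suc i))) (e 0))"
    using Tm_comp[of "\<lambda>e y. F y (e 0)" "\<lambda>e. t (\<lambda>i. e (Suc i))"] Tm_subst[OF assms(2), of Suc]
      assms(1) by simp
  show ?thesis using Tm_comp[of "\<lambda>e y. F (t e) y" u] 1 assms by simp
qed

lemma Tm_if [dfn]: "Dfn P \<Longrightarrow> Tm t \<Longrightarrow> Tm u \<Longrightarrow> Tm (\<lambda>e. if P e then t e else u e)"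
  by (rule Tm_the[of "\<lambda>e y. (P e \<and> y = t e) \<or> (\<not> P e \<and> y = u e)"])
    (auto intro!: dfn Dfn_subst[of P Suc] Tm_subst[of t Suc] Tm_subst[of u Suc] simp: Tm_closed)

lemma Dfn_sat:
  assumes "\<And>i. Tm (t i)" shows "Dfn (\<lambda>e. sat M (\<lambda>i. t i e) \<phi>)"
  using assms
proof (induction \<phi> arbitrary: t)
  case (Ex i \<phi>)
  have "Dfn (\<lambda>e. sat M (\<lambda>j. (if j = i then (\<lambda>e. e 0) else (\<lambda>e. t j (\<lambda>k. e (Suc k)))) e) \<phi>)"
    by (rule Ex.IH) (auto intro: dfn Tm_subst[of _ Suc] Ex.prems)
  then have "Dfn (\<lambda>e. \<exists>a\<in>U. sat M ((\<lambda>j. t j e)(i := a)) \<phi>)"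
    by (intro dfn) (simp add: fun_upd_def if_distrib[of "\<lambda>f. f _"] cong: if_cong)
  then show ?case by simp
next
  case (Nand \<phi> \<psi>)
  then show ?case by (simp only: sat.simps) (intro dfn Nand.IH Nand.prems)
qed (simp_all add: Dfn_mem Dfn_eq)

text \<open>The way back from environments to single formulas with parameters, in the shape used by
  the schemes of ZF and by \<open>definable\<close>. The formula is shifted by 2 so that variables 0
  and 1 are free for \<open>x\<close> and \<open>y\<close>; \<open>c\<close> fills the remaining
  entries of the environment.\<close>

lemma Dfn_formula:
  assumes "Dfn P" "c \<in> U"
  shows "\<exists>\<phi> s. range s \<subseteq> U \<and>
    (\<forall>x\<in>U. \<forall>y\<in>U. sat M (s(0 := x, 1 := y)) \<phi> \<longleftrightarrow> P (case_nat x (case_nat y (\<lambda>_. c))))"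
proof -
  obtain \<phi> \<tau> where P: "\<And>i c. \<tau> i = Inr c \<Longrightarrow> c \<in> U"
    "\<And>e. (\<And>i. e i \<in> U) \<Longrightarrow> P e \<longleftrightarrow> sat M (\<lambda>i. case_sum e id (\<tau> i)) \<phi>"
    using assms unfolding Dfn_def by metis
  define K where "K j = {i + 2 |i. i \<in> vars \<phi> \<and> \<tau> i = Inl j}" for j
  have K: "finite (K j)" "0 \<notin> K j" "1 \<notin> K j" for j unfolding K_def by auto
  obtain \<psi> where \<psi>: "\<And>s. s 0 \<in> U \<Longrightarrow>
      sat M s \<psi> \<longleftrightarrow> sat M (\<lambda>k. if k \<in> K 0 then s 0 else s k) (ren (\<lambda>i. i + 2) \<phi>)"
    using sat_identify[of "K 0" 0 M "ren (\<lambda>i. i + 2) \<phi>"] K by auto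
  obtain \<chi> where \<chi>: "\<And>s. s 1 \<in> U \<Longrightarrow>
      sat M s \<chi> \<longleftrightarrow> sat M (\<lambda>k. if k \<in> K 1 then s 1 else s k) \<psi>"
    using sat_identify[of "K 1" 1 M \<psi>] K by auto
  define s where "s i = (case \<tau> (i - 2) of Inl _ \<Rightarrow> c | Inr d \<Rightarrow> d)" for i
  have inj: "inj (\<lambda>i::nat. i + 2)" by (auto simp: inj_def)
  show ?thesis
  proof (intro exI conjI ballI)
    show "range s \<subseteq> U" using P(1) assms(2) by (auto simp: s_def split: sum.split)
    fix x y assume x: "x \<in> U" and y: "y \<in> U"
    let ?e = "case_nat x (case_nat y (\<lambda>_. c))"
    have "sat M (s(0 := x, 1 := y)) \<chi> \<longleftrightarrow>
      sat M (\<lambda>k. if k \<in> K 1 then y else (s(0 := x, 1 := y)) k) \<psi>" using \<chi> y by (simp cong: if_cong)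
    also have "\<dots> \<longleftrightarrow> sat M (\<lambda>k. if k \<in> K 0 then x else if k \<in> K 1 then y else (s(0 := x, 1 := y)) k)
        (ren (\<lambda>i. i + 2) \<phi>)"
      using \<psi>[of "\<lambda>k. if k \<in> K 1 then y else (s(0 := x, 1 := y)) k"] x K by (simp cong: if_cong)
    also have "\<dots> \<longleftrightarrow> sat M (\<lambda>i. case_sum ?e id (\<tau> i)) \<phi>"
      unfolding sat_ren[OF inj]
      by (rule sat_cong) (auto simp: K_def s_def split: sum.split nat.split)
    also have "\<dots> \<longleftrightarrow> P ?e"
      by (rule P(2)[symmetric]) (use x y assms in \<open>auto split: nat.split\<close>)
    finally show "sat M (s(0 := x, 1 := y)) \<chi> \<longleftrightarrow> P ?e" .
  qed
qed

end

section \<open>Sets in a model of ZF\<close>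

context set_struct
begin

lemma Ex1_iff: "(\<exists>!y. y \<in> U \<and> P y) \<longleftrightarrow> (\<exists>y\<in>U. P y \<and> (\<forall>z\<in>U. P z \<longrightarrow> z = y))"
  by blast

lemma Dfn_Ex1 [dfn]:
  assumes "Dfn (\<lambda>e. Q (\<lambda>i. e (Suc i)) (e 0))" shows "Dfn (\<lambda>e. \<exists>!y. y \<in> U \<and> Q e y)"
proof -
  have 1: "Dfn (\<lambda>e. Q (\<lambda>i. e (Suc (Suc i))) (e 0))"
    using Dfn_subst[OF assms, of "case_nat 0 (\<lambda>j. Suc (Suc j))"] by simp
  show ?thesis unfolding Ex1_iff by (intro dfn assms 1)
qed

lemma Dfn_is_empty [dfn]: "Tm x \<Longrightarrow> Dfn (\<lambda>e. is_empty M (x e))"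
  unfolding is_empty_def by (rule D1I[of "\<lambda>x. \<forall>z\<in>U. \<not> z \<epsilon> x"]) (intro dfn)

lemma Dfn_is_subset [dfn]:
  assumes "Tm x" "Tm y" shows "Dfn (\<lambda>e. is_subset M (x e) (y e))"
  unfolding is_subset_def by (intro dfn assms assms[THEN Tm_subst])

lemma Dfn_is_upair [dfn]:
  assumes "Tm a" "Tm b" "Tm z" shows "Dfn (\<lambda>e. is_upair M (a e) (b e) (z e))"
  unfolding is_upair_def by (intro dfn assms assms[THEN Tm_subst])

lemma Dfn_is_pair [dfn]:
  assumes "Tm a" "Tm b" "Tm z" shows "Dfn (\<lambda>e. is_pair M (a e) (b e) (z e))"
  unfolding is_pair_def by (intro dfn assms assms[THEN Tm_subst])

lemma Dfn_is_succ [dfn]: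
  assumes "Tm a" "Tm b" shows "Dfn (\<lambda>e. is_succ M (a e) (b e))"
  unfolding is_succ_def by (intro dfn assms assms[THEN Tm_subst])

lemma Dfn_is_transitive [dfn]:
  assumes "Tm a" shows "Dfn (\<lambda>e. is_transitive M (a e))"
  unfolding is_transitive_def by (intro dfn assms assms[THEN Tm_subst])

lemma Dfn_is_ordinal [dfn]:
  assumes "Tm a" shows "Dfn (\<lambda>e. is_ordinal M (a e))"
  unfolding is_ordinal_def by (intro dfn assms assms[THEN Tm_subst])

lemma Dfn_is_numeral [dfn]:
  assumes "Tm a" shows "Dfn (\<lambda>e. is_numeral M k (a e))"
  using assms
proof (induction k arbitrary: a)
  case (Suc k)
  show ?case unfolding is_numeral.simps by (intro dfn Suc Suc.prems[THEN Tm_subst])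
qed (simp add: Dfn_is_empty)

lemma Dfn_rel [dfn]:
  assumes "Tm r" "Tm a" "Tm b" shows "Dfn (\<lambda>e. rel M (r e) (a e) (b e))"
  unfolding rel_def by (intro dfn assms assms[THEN Tm_subst])

lemma Dfn_is_function [dfn]:
  assumes "Tm f" "Tm a" "Tm b" shows "Dfn (\<lambda>e. is_function M (f e) (a e) (b e))"
  unfolding is_function_def by (intro dfn assms assms[THEN Tm_subst])

lemma Dfn_is_V [dfn]:
  assumes "Tm a" "Tm v" shows "Dfn (\<lambda>e. is_V M (a e) (v e))"
  unfolding is_V_def by (intro dfn assms assms[THEN Tm_subst])

lemma Dfn_is_code [dfn]:
  assumes "Tm a" "Tm b" "Tm z" shows "Dfn (\<lambda>e. is_code M k (a e) (b e) (z e))"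
  unfolding is_code_def by (intro dfn assms assms[THEN Tm_subst])

lemma Dfn_is_update [dfn]:
  assumes "Tm w" "Tm A" "Tm s" "Tm i" "Tm a" "Tm t"
  shows "Dfn (\<lambda>e. is_update M (w e) (A e) (s e) (i e) (a e) (t e))"
  unfolding is_update_def by (intro dfn assms assms[THEN Tm_subst])

lemma Dfn_is_satisfaction [dfn]:
  assumes "Tm w" "Tm F" "Tm A" "Tm S"
  shows "Dfn (\<lambda>e. is_satisfaction M (w e) (F e) (A e) (S e))"
  unfolding is_satisfaction_def by (intro dfn assms assms[THEN Tm_subst])

definition small :: "('a \<Rightarrow> bool) \<Rightarrow> bool" where
  "small P \<longleftrightarrow> (\<exists>b\<in>U. \<forall>x\<in>U. x \<epsilon> b \<longleftrightarrow> P x)"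

text \<open>The value is meaningful only for \<open>small\<close> predicates. Definability of such a
  term therefore requires smallness in every environment, and some later terms contain guards whose
  sole purpose is to enforce it.\<close>

definition SetOf :: "('a \<Rightarrow> bool) \<Rightarrow> 'a" where
  "SetOf P = (THE b. b \<in> U \<and> (\<forall>x\<in>U. x \<epsilon> b \<longleftrightarrow> P x))"

end

locale zf_model =
  fixes M :: "'a struct"
  assumes ZF: "models_ZF M"

sublocale zf_model \<subseteq> set_struct M
  using ZF by unfold_locales (auto simp: models_ZF_def)

context zf_model
begin

lemma extensionality: "x \<in> U \<Longrightarrow> y \<in> U \<Longrightarrow> (\<And>z. z \<in> U \<Longrightarrow> z \<epsilon> x \<longleftrightarrow> z \<epsilon> y) \<Longrightarrow> x = y"
  using ZF unfolding models_ZF_def by blast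

lemma foundation:
  assumes "x \<in> U" "y \<in> U" "y \<epsilon> x"
  obtains m where "m \<in> U" "m \<epsilon> x" "\<And>z. z \<in> U \<Longrightarrow> z \<epsilon> x \<Longrightarrow> \<not> z \<epsilon> m"
proof -
  have "\<forall>x\<in>U. \<not> is_empty M x \<longrightarrow>
        (\<exists>y\<in>univ M. y \<epsilon> x \<and> (\<forall>z\<in>univ M. z \<epsilon> x \<longrightarrow> \<not> z \<epsilon> y))"
    using ZF unfolding models_ZF_def by blast
  then show ?thesis using assms that unfolding is_empty_def by blast
qed

lemma separation:
  assumes "D1 P" "a \<in> U" shows "\<exists>b\<in>U. \<forall>x\<in>U. x \<epsilon> b \<longleftrightarrow> x \<epsilon> a \<and> P x"
proof -
  obtain \<phi> s where *: "range s \<subseteq> U"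
    "\<forall>x\<in>U. \<forall>y\<in>U. sat M (s(0 := x, 1 := y)) \<phi> \<longleftrightarrow> P x"
    using Dfn_formula[OF assms] by auto
  have "sat M (s(0 := x)) \<phi> \<longleftrightarrow> P x" if "x \<in> U" for x
  proof -
    have "s(0 := x, 1 := s 1) = s(0 := x)" by (simp add: fun_eq_iff)
    then show ?thesis using *(2)[rule_format, OF that, of "s 1"] *(1) by (auto simp: range_subsetD)
  qed
  moreover have "separation_scheme M" using ZF unfolding models_ZF_def by blast
  ultimately show ?thesis using *(1) assms(2) unfolding separation_scheme_def
    by (metis (no_types, lifting))
qed

lemma replacement:
  assumes "F1 F" "a \<in> U" shows "\<exists>b\<in>U. \<forall>y\<in>U. y \<epsilon> b \<longleftrightarrow> (\<exists>x\<in>U. x \<epsilon> a \<and> y = F x)"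
proof -
  have "Dfn (\<lambda>e. e (Suc 0) = F (e 0))" using assms(1) by (intro dfn)
  from Dfn_formula[OF this assms(2)] obtain \<phi> s where *: "range s \<subseteq> U"
    "\<forall>x\<in>U. \<forall>y\<in>U. sat M (s(0 := x, 1 := y)) \<phi> \<longleftrightarrow> y = F x"
    by auto
  have FU: "F x \<in> U" if "x \<in> U" for x using Tm_closed[OF assms(1), of "\<lambda>_. x"] that by simp
  have "replacement_scheme M" using ZF unfolding models_ZF_def by blast
  then have "(\<forall>x\<in>univ M. x \<epsilon> a \<longrightarrow> (\<exists>!y. y \<in> univ M \<and> sat M (s(0 := x, 1 := y)) \<phi>)) \<longrightarrow>
           (\<exists>b\<in>univ M. \<forall>y\<in>univ M.
              y \<in>\<^bsub>M\<^esub> b \<longleftrightarrow> (\<exists>x\<in>univ M. x \<epsilon> a \<and> sat M (s(0 := x, 1 := y)) \<phi>))"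
    using *(1) assms(2) unfolding replacement_scheme_def by blast
  moreover have "\<exists>!y. y \<in> univ M \<and> sat M (s(0 := x, 1 := y)) \<phi>" if "x \<in> U" for x
    by (rule ex1I[of _ "F x"]) (use * FU that in auto)
  ultimately obtain b where "b \<in> U" "\<forall>y\<in>univ M.
              y \<in>\<^bsub>M\<^esub> b \<longleftrightarrow> (\<exists>x\<in>univ M. x \<epsilon> a \<and> sat M (s(0 := x, 1 := y)) \<phi>)" by blast
  then show ?thesis using *(2) by (intro bexI[of _ b]) auto
qed

lemma F1_closed: "F1 F \<Longrightarrow> x \<in> U \<Longrightarrow> F x \<in> U"
  using Tm_closed[of "\<lambda>e. F (e 0)" "\<lambda>_. x"] by simp

lemma F2_closed: "F2 F \<Longrightarrow> x \<in> U \<Longrightarrow> y \<in> U \<Longrightarrow> F x y \<in> U"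
  using Tm_closed[of "\<lambda>e. F (e 0) (e (Suc 0))" "case_nat x (\<lambda>_. y)"] by (simp split: nat.split)

lemma SetOf_unique: "b \<in> U \<Longrightarrow> (\<And>x. x \<in> U \<Longrightarrow> x \<epsilon> b \<longleftrightarrow> P x) \<Longrightarrow> SetOf P = b"
  unfolding SetOf_def by (rule the_equality) (auto intro: extensionality)

lemma SetOf_closed: "small P \<Longrightarrow> SetOf P \<in> U"
  unfolding small_def using SetOf_unique by blast

lemma mem_SetOf: "small P \<Longrightarrow> x \<in> U \<Longrightarrow> x \<epsilon> SetOf P \<longleftrightarrow> P x"
  unfolding small_def using SetOf_unique by blast

lemma Tm_SetOf:
  assumes "Dfn (\<lambda>e. P (\<lambda>i. e (Suc i)) (e 0))" "\<And>e. (\<And>i. e i \<in> U) \<Longrightarrow> small (P e)"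
  shows "Tm (\<lambda>e. SetOf (P e))"
proof (rule Tm_the[of "\<lambda>e y. \<forall>x\<in>U. x \<epsilon> y \<longleftrightarrow> P e x"])
  have 1: "Dfn (\<lambda>e. P (\<lambda>i. e (Suc (Suc i))) (e 0))"
    using Dfn_subst[OF assms(1), of "case_nat 0 (\<lambda>j. Suc (Suc j))"] by simp
  show "Dfn (\<lambda>e. \<forall>x\<in>U. x \<epsilon> e 0 \<longleftrightarrow> P (\<lambda>i. e (Suc i)) x)" by (intro dfn 1)
  fix e :: "nat \<Rightarrow> 'a" assume e: "\<And>i. e i \<in> U"
  then show "SetOf (P e) \<in> U" using assms(2) SetOf_closed by blast
  show "(\<forall>x\<in>U. x \<epsilon> y \<longleftrightarrow> P e x) \<longleftrightarrow> y = SetOf (P e)" if "y \<in> U" for y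
    using SetOf_unique[of y "P e"] mem_SetOf[of "P e"] assms(2)[OF e] that by auto
qed

lemma small_mem: "a \<in> U \<Longrightarrow> small (\<lambda>x. x \<epsilon> a)"
  unfolding small_def by blast

lemma small_iff: "small P \<Longrightarrow> (\<And>x. x \<in> U \<Longrightarrow> P x \<longleftrightarrow> Q x) \<Longrightarrow> small Q"
  unfolding small_def by auto

lemma small_subset: "small Q \<Longrightarrow> D1 P \<Longrightarrow> (\<And>x. x \<in> U \<Longrightarrow> P x \<Longrightarrow> Q x) \<Longrightarrow> small P"
  unfolding small_def using separation[of P] by metis

lemma small_Collect: "a \<in> U \<Longrightarrow> D1 P \<Longrightarrow> small (\<lambda>x. x \<epsilon> a \<and> P x)"
  unfolding small_def using separation[of P] by metis

lemma small_image: "small P \<Longrightarrow> F1 F \<Longrightarrow> small (\<lambda>y. \<exists>x\<in>U. P x \<and> y = F x)"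
proof -
  assume "small P" and F: "F1 F"
  then obtain b where b: "b \<in> U" "\<And>x. x \<in> U \<Longrightarrow> x \<epsilon> b \<longleftrightarrow> P x" unfolding small_def by blast
  show ?thesis using replacement[OF F b(1)] b unfolding small_def by auto
qed

lemma small_empty: "small (\<lambda>x. False)"
  using univ_nonempty small_subset[OF small_mem, of _ "\<lambda>_. False"] by (auto intro!: dfn)

text \<open>Russell's paradox. It is the final contradiction whenever a proper class is found below
  a bound.\<close>

lemma not_small_True: "\<not> small (\<lambda>x. True)"
proof
  assume "small (\<lambda>x. True)"
  then have "small (\<lambda>x. \<not> x \<epsilon> x)" by (rule small_subset) (auto intro!: dfn)
  then show False unfolding small_def by blast
qed

lemma small_upair: "a \<in> U \<Longrightarrow> b \<in> U \<Longrightarrow> small (\<lambda>x. x = a \<or> x = b)"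
  using ZF unfolding models_ZF_def is_upair_def small_def by blast

lemma small_Union: "a \<in> U \<Longrightarrow> small (\<lambda>z. \<exists>y\<in>U. y \<epsilon> a \<and> z \<epsilon> y)"
  using ZF unfolding models_ZF_def small_def by blast

lemma small_Pow: "a \<in> U \<Longrightarrow> small (\<lambda>z. is_subset M z a)"
  using ZF unfolding models_ZF_def small_def by blast

lemma small_UN:
  assumes "small P" "D2 Q" "\<And>x. x \<in> U \<Longrightarrow> P x \<Longrightarrow> small (Q x)"
  shows "small (\<lambda>y. \<exists>x\<in>U. P x \<and> Q x y)"
proof -
  obtain b where b: "b \<in> U" "\<And>x. x \<in> U \<Longrightarrow> x \<epsilon> b \<longleftrightarrow> P x" using assms(1) unfolding small_def by blast
  \<comment> \<open>Outside \<open>P\<close> the class \<open>Q x\<close> may be proper; the guard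
    \<open>x \<epsilon> b\<close> turns it into the empty set there, so that \<open>?F\<close> is a
    total term.\<close>
  have sm: "small (\<lambda>y. x \<epsilon> b \<and> Q x y)" if "x \<in> U" for x
    using assms(3)[OF that] b(2)[OF that] small_empty by (cases "P x") auto
  let ?F = "\<lambda>x. SetOf (\<lambda>y. x \<epsilon> b \<and> Q x y)"
  have F: "F1 ?F"
    by (rule Tm_SetOf) (auto intro!: dfn D2I[OF assms(2)] sm b)
  obtain c where c: "c \<in> U" "\<And>y. y \<in> U \<Longrightarrow> y \<epsilon> c \<longleftrightarrow> (\<exists>x\<in>U. x \<epsilon> b \<and> y = ?F x)"
    using replacement[OF F b(1)] by blast
  have *: "(\<exists>y\<in>U. y \<epsilon> c \<and> z \<epsilon> y) \<longleftrightarrow> (\<exists>x\<in>U. P x \<and> Q x z)" if "z \<in> U" for z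
  proof -
    have "(\<exists>y\<in>U. y \<epsilon> c \<and> z \<epsilon> y) \<longleftrightarrow> (\<exists>x\<in>U. x \<epsilon> b \<and> z \<epsilon> ?F x)"
      using c F1_closed[OF F] by auto
    also have "\<dots> \<longleftrightarrow> (\<exists>x\<in>U. P x \<and> Q x z)"
      using mem_SetOf[OF sm that] b by auto
    finally show ?thesis .
  qed
  show ?thesis by (rule small_iff[OF small_Union[OF c(1)] *])
qed

section \<open>Basic set operations, ordered pairs and projections as definable terms\<close>

definition emp where "emp = SetOf (\<lambda>x. False)"
definition upr where "upr a b = SetOf (\<lambda>x. x = a \<or> x = b)"
definition Unn where "Unn a = SetOf (\<lambda>z. \<exists>y\<in>U. y \<epsilon> a \<and> z \<epsilon> y)"
definition Pw where "Pw a = SetOf (\<lambda>z. is_subset M z a)"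
definition unn where "unn a b = SetOf (\<lambda>x. x \<epsilon> a \<or> x \<epsilon> b)"
definition adj where "adj a b = SetOf (\<lambda>x. x \<epsilon> a \<or> x = b)"
definition pr where "pr a b = upr (upr a a) (upr a b)"
definition suc where "suc a = adj a a"

lemma small_unn: "a \<in> U \<Longrightarrow> b \<in> U \<Longrightarrow> small (\<lambda>x. x \<epsilon> a \<or> x \<epsilon> b)"
proof -
  assume a: "a \<in> U" "b \<in> U"
  have "small (\<lambda>y. \<exists>x\<in>U. (x = a \<or> x = b) \<and> y \<epsilon> x)"
    by (rule small_UN[OF small_upair[OF a]]) (auto intro!: dfn small_mem)
  then show ?thesis by (rule small_iff) (use a in auto)
qed

lemma small_Un: "small P \<Longrightarrow> small Q \<Longrightarrow> small (\<lambda>x. P x \<or> Q x)"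
  using small_unn[of "SetOf P" "SetOf Q"]
  by (rule_tac small_iff[of "\<lambda>x. x \<epsilon> SetOf P \<or> x \<epsilon> SetOf Q"]) (auto simp: SetOf_closed mem_SetOf)

lemma small_single: "b \<in> U \<Longrightarrow> small (\<lambda>x. x = b)"
  using small_upair[of b b] by simp

lemma small_adj: "a \<in> U \<Longrightarrow> b \<in> U \<Longrightarrow> small (\<lambda>x. x \<epsilon> a \<or> x = b)"
  by (rule small_Un[OF small_mem small_single])

lemma emp [simp]: "emp \<in> U" "x \<in> U \<Longrightarrow> \<not> x \<epsilon> emp"
  unfolding emp_def using small_empty SetOf_closed mem_SetOf by auto

lemma upr [simp]: "a \<in> U \<Longrightarrow> b \<in> U \<Longrightarrow> upr a b \<in> U"
  "a \<in> U \<Longrightarrow> b \<in> U \<Longrightarrow> x \<in> U \<Longrightarrow> x \<epsilon> upr a b \<longleftrightarrow> x = a \<or> x = b"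
  unfolding upr_def using small_upair SetOf_closed mem_SetOf by auto

lemma Unn [simp]: "a \<in> U \<Longrightarrow> Unn a \<in> U"
  "a \<in> U \<Longrightarrow> x \<in> U \<Longrightarrow> x \<epsilon> Unn a \<longleftrightarrow> (\<exists>y\<in>U. y \<epsilon> a \<and> x \<epsilon> y)"
  unfolding Unn_def using small_Union SetOf_closed mem_SetOf by auto

lemma Pw [simp]: "a \<in> U \<Longrightarrow> Pw a \<in> U"
  "a \<in> U \<Longrightarrow> x \<in> U \<Longrightarrow> x \<epsilon> Pw a \<longleftrightarrow> is_subset M x a"
  unfolding Pw_def using small_Pow SetOf_closed mem_SetOf by auto

lemma unn [simp]: "a \<in> U \<Longrightarrow> b \<in> U \<Longrightarrow> unn a b \<in> U"
  "a \<in> U \<Longrightarrow> b \<in> U \<Longrightarrow> x \<in> U \<Longrightarrow> x \<epsilon> unn a b \<longleftrightarrow> x \<epsilon> a \<or> x \<epsilon> b"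
  unfolding unn_def using small_unn SetOf_closed mem_SetOf by auto

lemma adj [simp]: "a \<in> U \<Longrightarrow> b \<in> U \<Longrightarrow> adj a b \<in> U"
  "a \<in> U \<Longrightarrow> b \<in> U \<Longrightarrow> x \<in> U \<Longrightarrow> x \<epsilon> adj a b \<longleftrightarrow> x \<epsilon> a \<or> x = b"
  unfolding adj_def using small_adj SetOf_closed mem_SetOf by auto

lemma suc [simp]: "a \<in> U \<Longrightarrow> suc a \<in> U"
  "a \<in> U \<Longrightarrow> x \<in> U \<Longrightarrow> x \<epsilon> suc a \<longleftrightarrow> x \<epsilon> a \<or> x = a"
  unfolding suc_def by auto

lemma pr_closed [simp]: "a \<in> U \<Longrightarrow> b \<in> U \<Longrightarrow> pr a b \<in> U"
  unfolding pr_def by simp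

lemma Tm_upr [dfn]: "Tm a \<Longrightarrow> Tm b \<Longrightarrow> Tm (\<lambda>e. upr (a e) (b e))"
  by (rule F2I[of upr]) (auto simp: upr_def intro!: dfn Tm_SetOf small_upair)

lemma Tm_unn [dfn]: "Tm a \<Longrightarrow> Tm b \<Longrightarrow> Tm (\<lambda>e. unn (a e) (b e))"
  by (rule F2I[of unn]) (auto simp: unn_def intro!: dfn Tm_SetOf small_unn)

lemma Tm_adj [dfn]: "Tm a \<Longrightarrow> Tm b \<Longrightarrow> Tm (\<lambda>e. adj (a e) (b e))"
  by (rule F2I[of adj]) (auto simp: adj_def intro!: dfn Tm_SetOf small_adj)

lemma Tm_suc [dfn]: "Tm a \<Longrightarrow> Tm (\<lambda>e. suc (a e))"
  unfolding suc_def by (intro dfn)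

lemma Tm_pr [dfn]: "Tm a \<Longrightarrow> Tm b \<Longrightarrow> Tm (\<lambda>e. pr (a e) (b e))"
  unfolding pr_def by (intro dfn)

lemma is_upair_iff: "a \<in> U \<Longrightarrow> b \<in> U \<Longrightarrow> z \<in> U \<Longrightarrow> is_upair M a b z \<longleftrightarrow> z = upr a b"
  unfolding is_upair_def by (auto intro: extensionality)

lemma is_pair_iff [simp]: "a \<in> U \<Longrightarrow> b \<in> U \<Longrightarrow> z \<in> U \<Longrightarrow> is_pair M a b z \<longleftrightarrow> z = pr a b"
  unfolding is_pair_def pr_def by (auto simp: is_upair_iff)

lemma is_succ_iff [simp]: "a \<in> U \<Longrightarrow> b \<in> U \<Longrightarrow> is_succ M a b \<longleftrightarrow> b = suc a"
  unfolding is_succ_def by (auto intro: extensionality)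

lemma is_empty_iff [simp]: "a \<in> U \<Longrightarrow> is_empty M a \<longleftrightarrow> a = emp"
  unfolding is_empty_def by (auto intro: extensionality)

lemma rel_iff [simp]: "a \<in> U \<Longrightarrow> b \<in> U \<Longrightarrow> r \<in> U \<Longrightarrow> rel M r a b \<longleftrightarrow> pr a b \<epsilon> r"
  unfolding rel_def by auto

lemma upr_eq_iff:
  assumes "a \<in> U" "b \<in> U" "c \<in> U" "d \<in> U"
  shows "upr a b = upr c d \<longleftrightarrow> (a = c \<and> b = d) \<or> (a = d \<and> b = c)"
proof
  assume "upr a b = upr c d"
  then have "\<forall>x\<in>U. (x = a \<or> x = b) \<longleftrightarrow> (x = c \<or> x = d)" using upr(2) assms by metis
  then show "(a = c \<and> b = d) \<or> (a = d \<and> b = c)" using assms by metis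
qed (use assms in \<open>auto intro: extensionality\<close>)

lemma pr_eq_iff [simp]:
  assumes "a \<in> U" "b \<in> U" "c \<in> U" "d \<in> U"
  shows "pr a b = pr c d \<longleftrightarrow> a = c \<and> b = d"
  unfolding pr_def using assms by (auto simp: upr_eq_iff)

definition pfst where
  "pfst z = (if \<exists>a\<in>U. \<exists>b\<in>U. z = pr a b then (THE a. a \<in> U \<and> (\<exists>b\<in>U. z = pr a b)) else emp)"
definition psnd where
  "psnd z = (if \<exists>a\<in>U. \<exists>b\<in>U. z = pr a b then (THE b. b \<in> U \<and> (\<exists>a\<in>U. z = pr a b)) else emp)"

lemma pfst_pr [simp]: "a \<in> U \<Longrightarrow> b \<in> U \<Longrightarrow> pfst (pr a b) = a"
  unfolding pfst_def by auto

lemma psnd_pr [simp]: "a \<in> U \<Longrightarrow> b \<in> U \<Longrightarrow> psnd (pr a b) = b"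
  unfolding psnd_def by auto

lemma pfst_closed [simp]: "pfst z \<in> U"
  using pfst_pr by (cases "\<exists>a\<in>U. \<exists>b\<in>U. z = pr a b") (auto simp: pfst_def)

lemma psnd_closed [simp]: "psnd z \<in> U"
  using psnd_pr by (cases "\<exists>a\<in>U. \<exists>b\<in>U. z = pr a b") (auto simp: psnd_def)

lemma pfst_nonpair: "\<not> (\<exists>a\<in>U. \<exists>b\<in>U. z = pr a b) \<Longrightarrow> pfst z = emp"
  unfolding pfst_def by auto

lemma psnd_nonpair: "\<not> (\<exists>a\<in>U. \<exists>b\<in>U. z = pr a b) \<Longrightarrow> psnd z = emp"
  unfolding psnd_def by auto

lemma Tm_pfst [dfn]: "Tm a \<Longrightarrow> Tm (\<lambda>e. pfst (a e))"
proof (rule F1I[of pfst], rule Tm_the[of "\<lambda>e y. (\<exists>b\<in>U. e 0 = pr y b) \<or> y = emp \<and> \<not> (\<exists>a\<in>U. \<exists>b\<in>U. e 0 = pr a b)"])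
  fix e :: "nat \<Rightarrow> 'a" and y assume "\<And>i. e i \<in> U" "y \<in> U"
  then show "(\<exists>b\<in>U. e 0 = pr y b) \<or> y = emp \<and> \<not> (\<exists>a\<in>U. \<exists>b\<in>U. e 0 = pr a b) \<longleftrightarrow> y = pfst (e 0)"
    by (cases "\<exists>a\<in>U. \<exists>b\<in>U. e 0 = pr a b") (auto simp: pfst_nonpair)
qed (auto intro!: dfn)

lemma Tm_psnd [dfn]: "Tm a \<Longrightarrow> Tm (\<lambda>e. psnd (a e))"
proof (rule F1I[of psnd], rule Tm_the[of "\<lambda>e y. (\<exists>b\<in>U. e 0 = pr b y) \<or> y = emp \<and> \<not> (\<exists>a\<in>U. \<exists>b\<in>U. e 0 = pr a b)"])
  fix e :: "nat \<Rightarrow> 'a" and y assume "\<And>i. e i \<in> U" "y \<in> U"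
  then show "(\<exists>b\<in>U. e 0 = pr b y) \<or> y = emp \<and> \<not> (\<exists>a\<in>U. \<exists>b\<in>U. e 0 = pr a b) \<longleftrightarrow> y = psnd (e 0)"
    by (cases "\<exists>a\<in>U. \<exists>b\<in>U. e 0 = pr a b") (auto simp: psnd_nonpair)
qed (auto intro!: dfn)

end

section \<open>Ordinals and recursion\<close>

context set_struct
begin

abbreviation Od :: "'a \<Rightarrow> bool" where "Od x \<equiv> is_ordinal M x"

end

context zf_model
begin

text \<open>Description with a default value: it is definable for every definable \<open>R\<close>,
  and uniqueness has to be proved only where the value matters.\<close>

definition The0 :: "('a \<Rightarrow> bool) \<Rightarrow> 'a" where
  "The0 R = (if \<exists>!y. y \<in> U \<and> R y then THE y. y \<in> U \<and> R y else emp)"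

lemma The0_eq:
  assumes "y \<in> U" "R y" "\<And>z. z \<in> U \<Longrightarrow> R z \<Longrightarrow> z = y" shows "The0 R = y"
proof -
  have "(THE y. y \<in> U \<and> R y) = y" by (rule the_equality) (use assms in blast)+
  moreover have "\<exists>!y. y \<in> U \<and> R y" using assms by blast
  ultimately show ?thesis unfolding The0_def by simp
qed

lemma The0_none: "\<not> (\<exists>!y. y \<in> U \<and> R y) \<Longrightarrow> The0 R = emp"
  unfolding The0_def by auto

lemma The0_closed [simp]: "The0 R \<in> U"
proof (cases "\<exists>!y. y \<in> U \<and> R y")
  case True
  then obtain y where y: "y \<in> U" "R y" "\<And>z. z \<in> U \<Longrightarrow> R z \<Longrightarrow> z = y" by blast
  have "The0 R = y" by (rule The0_eq[of y R]) (use y in blast)+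
  with y(1) show ?thesis by (simp only:)
qed (simp add: The0_none)

lemma Tm_The0:
  assumes "Dfn (\<lambda>e. R (\<lambda>i. e (Suc i)) (e 0))"
  shows "Tm (\<lambda>e. The0 (R e))"
proof (rule Tm_the[of "\<lambda>e y. (R e y \<and> (\<forall>z\<in>U. R e z \<longrightarrow> z = y)) \<or> (y = emp \<and> \<not> (\<exists>!z. z \<in> U \<and> R e z))"])
  have 1: "Dfn (\<lambda>e. R (\<lambda>i. e (Suc (Suc i))) (e 0))"
    using Dfn_subst[OF assms, of "case_nat 0 (\<lambda>j. Suc (Suc j))"] by simp
  show "Dfn (\<lambda>e. (R (\<lambda>i. e (Suc i)) (e 0) \<and> (\<forall>z\<in>U. R (\<lambda>i. e (Suc i)) z \<longrightarrow> z = e 0)) \<or>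
     (e 0 = emp \<and> \<not> (\<exists>!z. z \<in> U \<and> R (\<lambda>i. e (Suc i)) z)))"
    by (intro dfn 1 assms) simp
  fix e y assume y: "y \<in> U"
  show "(R e y \<and> (\<forall>z\<in>U. R e z \<longrightarrow> z = y)) \<or> (y = emp \<and> \<not> (\<exists>!z. z \<in> U \<and> R e z)) \<longleftrightarrow> y = The0 (R e)"
  proof (cases "\<exists>!z. z \<in> U \<and> R e z")
    case True
    then obtain z where "z \<in> U" "R e z" "\<And>z'. z' \<in> U \<Longrightarrow> R e z' \<Longrightarrow> z' = z" by blast
    moreover from this have "The0 (R e) = z" by (rule The0_eq)
    ultimately show ?thesis using y by blast
  next
    case False
    then show ?thesis using y by (auto simp: The0_none)
  qed
qed auto

lemma not_mem_self: "x \<in> U \<Longrightarrow> \<not> x \<epsilon> x"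
  by (rule foundation[of "upr x x" x]) auto

lemma not_mem_cycle: "x \<in> U \<Longrightarrow> y \<in> U \<Longrightarrow> x \<epsilon> y \<Longrightarrow> \<not> y \<epsilon> x"
  by (rule foundation[of "upr x y" x]) auto

lemma Od_trans: "Od a \<Longrightarrow> a \<in> U \<Longrightarrow> x \<in> U \<Longrightarrow> y \<in> U \<Longrightarrow> y \<epsilon> x \<Longrightarrow> x \<epsilon> a \<Longrightarrow> y \<epsilon> a"
  unfolding is_ordinal_def is_transitive_def is_subset_def by blast

lemma Od_mem: "Od a \<Longrightarrow> a \<in> U \<Longrightarrow> x \<in> U \<Longrightarrow> x \<epsilon> a \<Longrightarrow> Od x"
  unfolding is_ordinal_def is_transitive_def is_subset_def by blast

lemma OdI: "(\<And>y z. y \<in> U \<Longrightarrow> z \<in> U \<Longrightarrow> y \<epsilon> a \<Longrightarrow> z \<epsilon> y \<Longrightarrow> z \<epsilon> a) \<Longrightarrow>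
    (\<And>y. y \<in> U \<Longrightarrow> y \<epsilon> a \<Longrightarrow> Od y) \<Longrightarrow> Od a"
  unfolding is_ordinal_def is_transitive_def is_subset_def by blast

lemma Od_least:
  assumes "D1 P" "x \<in> U" "Od x" "P x"
  obtains m where "m \<in> U" "Od m" "P m" "\<And>y. y \<in> U \<Longrightarrow> y \<epsilon> m \<Longrightarrow> \<not> P y"
proof (cases "\<exists>y\<in>U. y \<epsilon> x \<and> P y")
  case True
  obtain b where b: "b \<in> U" "\<forall>y\<in>U. y \<epsilon> b \<longleftrightarrow> y \<epsilon> x \<and> P y"
    using separation[OF assms(1,2)] by blast
  obtain y where y: "y \<in> U" "y \<epsilon> b" using b True by blast
  obtain m where m: "m \<in> U" "m \<epsilon> b" "\<And>z. z \<in> U \<Longrightarrow> z \<epsilon> b \<Longrightarrow> \<not> z \<epsilon> m"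
    using foundation[OF b(1) y] by blast
  have mx: "m \<epsilon> x" "P m" using m b(2) by auto
  show ?thesis
  proof (rule that[OF m(1) Od_mem[OF assms(3,2) m(1) mx(1)] mx(2)])
    fix y assume y: "y \<in> U" "y \<epsilon> m"
    have "y \<epsilon> x" by (rule Od_trans[OF assms(3,2) m(1) y mx(1)])
    then show "\<not> P y" using m(3)[OF y(1)] y b(2) by blast
  qed
next
  case False
  then show ?thesis using that assms(2-4) by blast
qed

text \<open>Take the least \<open>a\<close> that is incomparable with some ordinal, then the least
  \<open>b\<close> incomparable with \<open>a\<close>. Minimality makes every element of one an
  element of the other, so \<open>a = b\<close>.\<close>

lemma Od_linear:
  assumes "x \<in> U" "y \<in> U" "Od x" "Od y" shows "x = y \<or> x \<epsilon> y \<or> y \<epsilon> x"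
proof (rule ccontr)
  let ?C = "\<lambda>a b. a \<noteq> b \<and> \<not> a \<epsilon> b \<and> \<not> b \<epsilon> a"
  assume "\<not> ?thesis"
  then have "\<exists>b\<in>U. Od b \<and> ?C x b" using assms by blast
  moreover have "D1 (\<lambda>a. \<exists>b\<in>U. Od b \<and> ?C a b)" by (intro dfn)
  ultimately obtain a where a: "a \<in> U" "Od a" "\<exists>b\<in>U. Od b \<and> ?C a b"
    "\<And>a'. a' \<in> U \<Longrightarrow> a' \<epsilon> a \<Longrightarrow> \<not> (\<exists>b\<in>U. Od b \<and> ?C a' b)"
    using Od_least[of "\<lambda>a. \<exists>b\<in>U. Od b \<and> ?C a b" x] assms by blast
  then obtain b0 where b0: "b0 \<in> U" "Od b0" "?C a b0" by blast
  have "D1 (\<lambda>b. ?C a b)" by (intro dfn a)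
  then obtain b where b: "b \<in> U" "Od b" "?C a b" "\<And>b'. b' \<in> U \<Longrightarrow> b' \<epsilon> b \<Longrightarrow> \<not> ?C a b'"
    using Od_least[of "\<lambda>b. ?C a b" b0] b0 by blast
  have "z \<epsilon> a \<longleftrightarrow> z \<epsilon> b" if "z \<in> U" for z
  proof
    assume "z \<epsilon> a"
    then have "\<not> ?C z b" using a(4)[OF that] b by blast
    then show "z \<epsilon> b" using \<open>z \<epsilon> a\<close> a(1,2) b that Od_trans by blast
  next
    assume "z \<epsilon> b"
    then have "\<not> ?C a z" using b(4)[OF that] by blast
    then show "z \<epsilon> a" using \<open>z \<epsilon> b\<close> a(1,2) b that Od_trans by blast
  qed
  then have "a = b" by (rule extensionality[OF a(1) b(1)])
  then show False using b by blast
qed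

lemma Od_emp [simp]: "Od emp"
  by (rule OdI) auto

lemma Od_suc: "Od x \<Longrightarrow> x \<in> U \<Longrightarrow> Od (suc x)"
  by (rule OdI) (auto intro: Od_trans Od_mem)

end

section \<open>Induction and recursion along definable set-like well-orders\<close>

locale wo_class = zf_model +
  fixes X :: "'a \<Rightarrow> bool" and L :: "'a \<Rightarrow> 'a \<Rightarrow> bool"
  assumes DX: "D1 X" and DL: "D2 L"
    and trans: "x \<in> U \<Longrightarrow> y \<in> U \<Longrightarrow> z \<in> U \<Longrightarrow> X x \<Longrightarrow> X y \<Longrightarrow> X z \<Longrightarrow> L x y \<Longrightarrow> L y z \<Longrightarrow> L x z"
    and linear: "x \<in> U \<Longrightarrow> y \<in> U \<Longrightarrow> X x \<Longrightarrow> X y \<Longrightarrow> x = y \<or> L x y \<or> L y x"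
    and least_ex: "D1 P \<Longrightarrow> x \<in> U \<Longrightarrow> X x \<Longrightarrow> P x \<Longrightarrow>
      \<exists>m\<in>U. X m \<and> P m \<and> (\<forall>y\<in>U. X y \<longrightarrow> P y \<longrightarrow> \<not> L y m)"
    and small_below: "x \<in> U \<Longrightarrow> X x \<Longrightarrow> small (\<lambda>y. X y \<and> L y x)"
begin

lemma wo_induct:
  assumes "D1 P" "x \<in> U" "X x"
    and "\<And>x. x \<in> U \<Longrightarrow> X x \<Longrightarrow> (\<And>y. y \<in> U \<Longrightarrow> X y \<Longrightarrow> L y x \<Longrightarrow> P y) \<Longrightarrow> P x"
  shows "P x"
proof (rule ccontr)
  assume "\<not> P x"
  moreover have "D1 (\<lambda>x. \<not> P x)" by (intro dfn assms)
  ultimately show False using least_ex[of "\<lambda>x. \<not> P x" x] assms by blast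
qed

definition rst :: "'a \<Rightarrow> 'a \<Rightarrow> 'a" where
  "rst g x = SetOf (\<lambda>z. z \<epsilon> g \<and> (\<exists>y\<in>U. X y \<and> L y x \<and> (\<exists>v\<in>U. z = pr y v)))"

lemma small_rst: "g \<in> U \<Longrightarrow> x \<in> U \<Longrightarrow> small (\<lambda>z. z \<epsilon> g \<and> (\<exists>y\<in>U. X y \<and> L y x \<and> (\<exists>v\<in>U. z = pr y v)))"
  by (rule small_Collect) (auto intro!: dfn D1I[OF DX] D2I[OF DL])

lemma Tm_rst: "Tm g \<Longrightarrow> Tm x \<Longrightarrow> Tm (\<lambda>e. rst (g e) (x e))"
  by (rule F2I[of rst]) (auto simp: rst_def intro!: dfn D1I[OF DX] D2I[OF DL] Tm_SetOf small_rst)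

lemma rst_closed [simp]: "g \<in> U \<Longrightarrow> x \<in> U \<Longrightarrow> rst g x \<in> U"
  unfolding rst_def by (rule SetOf_closed[OF small_rst])

lemma mem_rst: "g \<in> U \<Longrightarrow> x \<in> U \<Longrightarrow> z \<in> U \<Longrightarrow>
    z \<epsilon> rst g x \<longleftrightarrow> z \<epsilon> g \<and> (\<exists>y\<in>U. X y \<and> L y x \<and> (\<exists>v\<in>U. z = pr y v))"
  unfolding rst_def by (rule mem_SetOf[OF small_rst])

context
  fixes H :: "'a \<Rightarrow> 'a \<Rightarrow> 'a"
  assumes FH: "F2 H"
begin

text \<open>A set-sized partial solution: the graph of the recursively defined function on the
  predecessors of \<open>x\<close>. Quantification over sets is all that \<open>M\<close> can
  express, so the class function has to be assembled from such pieces.\<close>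

definition approx :: "'a \<Rightarrow> 'a \<Rightarrow> bool" where
  "approx g x \<longleftrightarrow> (\<forall>z\<in>U. z \<epsilon> g \<longrightarrow> (\<exists>y\<in>U. X y \<and> L y x \<and> (\<exists>v\<in>U. z = pr y v))) \<and>
     (\<forall>y\<in>U. X y \<longrightarrow> L y x \<longrightarrow> (\<exists>v\<in>U. pr y v \<epsilon> g)) \<and>
     (\<forall>y\<in>U. \<forall>v\<in>U. pr y v \<epsilon> g \<longrightarrow> v = H y (rst g y))"

lemma Dfn_approx: "Tm g \<Longrightarrow> Tm x \<Longrightarrow> Dfn (\<lambda>e. approx (g e) (x e))"
  by (rule D2I[of approx]) (auto simp: approx_def intro!: dfn D1I[OF DX] D2I[OF DL] F2I[OF FH] Tm_rst)

lemma approx_agree: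
  assumes g: "g \<in> U" "approx g x" "x \<in> U" "X x" and g': "g' \<in> U" "approx g' x'" "x' \<in> U" "X x'"
    and y: "y \<in> U" "X y"
  shows "L y x \<Longrightarrow> L y x' \<Longrightarrow> \<forall>v\<in>U. pr y v \<epsilon> g \<longleftrightarrow> pr y v \<epsilon> g'"
proof -
  let ?P = "\<lambda>y. L y x \<longrightarrow> L y x' \<longrightarrow> (\<forall>v\<in>U. pr y v \<epsilon> g \<longleftrightarrow> pr y v \<epsilon> g')"
  have "?P y"
  proof (rule wo_induct[of ?P])
    show "D1 ?P" by (intro dfn D2I[OF DL] g g')
    fix y assume y: "y \<in> U" "X y" and IH: "\<And>z. z \<in> U \<Longrightarrow> X z \<Longrightarrow> L z y \<Longrightarrow> ?P z"
    show "?P y"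
    proof (intro impI)
      assume L: "L y x" "L y x'"
      have "rst g y = rst g' y"
      proof (rule extensionality)
        fix z assume z: "z \<in> U"
        have "pr u v \<epsilon> g \<longleftrightarrow> pr u v \<epsilon> g'" if "u \<in> U" "X u" "L u y" "v \<in> U" for u v
          using IH[of u] that L trans[of u y x] trans[of u y x'] y g g' by blast
        then show "z \<epsilon> rst g y \<longleftrightarrow> z \<epsilon> rst g' y" using z g g' y by (auto simp: mem_rst)
      qed (use g g' y in auto)
      moreover have "pr y v \<epsilon> g \<longleftrightarrow> v = H y (rst g y)" if "v \<in> U" for v
        using g y L that unfolding approx_def by blast
      moreover have "pr y v \<epsilon> g' \<longleftrightarrow> v = H y (rst g' y)" if "v \<in> U" for v
        using g' y L that unfolding approx_def by blast
      ultimately show "\<forall>v\<in>U. pr y v \<epsilon> g \<longleftrightarrow> pr y v \<epsilon> g'" by simp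
    qed
  qed (use y in auto)
  then show "L y x \<Longrightarrow> L y x' \<Longrightarrow> \<forall>v\<in>U. pr y v \<epsilon> g \<longleftrightarrow> pr y v \<epsilon> g'" by blast
qed

lemma approx_unique:
  assumes "g \<in> U" "approx g x" "g' \<in> U" "approx g' x" "x \<in> U" "X x" shows "g = g'"
proof (rule extensionality)
  fix z assume z: "z \<in> U"
  have "pr y v \<epsilon> g \<longleftrightarrow> pr y v \<epsilon> g'" if "y \<in> U" "X y" "L y x" "v \<in> U" for y v
    using approx_agree[of g x g' x y] assms that by blast
  moreover have "z \<epsilon> g \<Longrightarrow> \<exists>y\<in>U. X y \<and> L y x \<and> (\<exists>v\<in>U. z = pr y v)"
    "z \<epsilon> g' \<Longrightarrow> \<exists>y\<in>U. X y \<and> L y x \<and> (\<exists>v\<in>U. z = pr y v)"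
    using assms z unfolding approx_def by blast+
  ultimately show "z \<epsilon> g \<longleftrightarrow> z \<epsilon> g'" by blast
qed (use assms in auto)

definition apx :: "'a \<Rightarrow> 'a" where "apx x = The0 (\<lambda>g. approx g x)"
definition recf :: "'a \<Rightarrow> 'a" where "recf x = H x (apx x)"

lemma F1_apx: "F1 apx"
  unfolding apx_def by (rule Tm_The0) (intro dfn Dfn_approx)

lemma F1_recf: "F1 recf"
  unfolding recf_def by (intro dfn F2I[OF FH] F1_apx)

lemma recf_closed [simp]: "x \<in> U \<Longrightarrow> recf x \<in> U"
  using F1_closed[OF F1_recf] .

lemma small_recf: "x \<in> U \<Longrightarrow> X x \<Longrightarrow> small (\<lambda>z. \<exists>y\<in>U. (X y \<and> L y x) \<and> z = pr y (recf y))"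
  by (rule small_image[OF small_below]) (auto intro!: dfn F1_recf)

text \<open>The graph of \<open>recf\<close> below \<open>x\<close> is a set by replacement. If all
  earlier approximations are such graphs, then this one satisfies the recursion equation, and
  uniqueness of approximations identifies it with \<open>apx x\<close>.\<close>

lemma apx_eq:
  assumes "x \<in> U" "X x"
  shows "apx x = SetOf (\<lambda>z. \<exists>y\<in>U. (X y \<and> L y x) \<and> z = pr y (recf y))"
proof -
  let ?S = "\<lambda>x. SetOf (\<lambda>z. \<exists>y\<in>U. (X y \<and> L y x) \<and> z = pr y (recf y))"
  let ?P = "\<lambda>x. \<forall>y\<in>U. X y \<longrightarrow> L y x \<longrightarrow> approx (apx y) y"
  have S: "?S x \<in> U" "\<And>z. z \<in> U \<Longrightarrow> z \<epsilon> ?S x \<longleftrightarrow> (\<exists>y\<in>U. (X y \<and> L y x) \<and> z = pr y (recf y))"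
    if "x \<in> U" "X x" for x
    using SetOf_closed[OF small_recf[OF that]] mem_SetOf[OF small_recf[OF that]] by auto
  have main: "approx (?S x) x \<and> apx x = ?S x" if x: "x \<in> U" "X x"
    and IH: "\<And>y. y \<in> U \<Longrightarrow> X y \<Longrightarrow> L y x \<Longrightarrow> apx y = ?S y" for x
  proof -
    have rst: "rst (?S x) y = apx y" if y: "y \<in> U" "X y" "L y x" for y
    proof -
      have "rst (?S x) y = ?S y"
      proof (rule extensionality)
        fix z assume z: "z \<in> U"
        have "z \<epsilon> rst (?S x) y \<longleftrightarrow> (\<exists>u\<in>U. (X u \<and> L u x) \<and> z = pr u (recf u)) \<and>
            (\<exists>u\<in>U. X u \<and> L u y \<and> (\<exists>v\<in>U. z = pr u v))"
          by (simp only: mem_rst[OF S(1)[OF x] y(1) z] S(2)[OF x z])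
        also have "\<dots> \<longleftrightarrow> (\<exists>u\<in>U. (X u \<and> L u y) \<and> z = pr u (recf u))"
        proof (intro iffI conjI)
          assume "(\<exists>u\<in>U. (X u \<and> L u x) \<and> z = pr u (recf u)) \<and>
            (\<exists>u\<in>U. X u \<and> L u y \<and> (\<exists>v\<in>U. z = pr u v))"
          then obtain u u' v where "u \<in> U" "z = pr u (recf u)" "u' \<in> U" "X u'" "L u' y" "v \<in> U" "z = pr u' v"
            by blast
          then show "\<exists>u\<in>U. (X u \<and> L u y) \<and> z = pr u (recf u)" by (intro bexI[of _ u]) auto
        next
          assume "\<exists>u\<in>U. (X u \<and> L u y) \<and> z = pr u (recf u)"
          then obtain u where u: "u \<in> U" "X u" "L u y" "z = pr u (recf u)" by blast
          then show "\<exists>u\<in>U. (X u \<and> L u x) \<and> z = pr u (recf u)"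
            using trans[of u y x] x y by blast
          show "\<exists>u\<in>U. X u \<and> L u y \<and> (\<exists>v\<in>U. z = pr u v)" using u recf_closed by blast
        qed
        also have "\<dots> \<longleftrightarrow> z \<epsilon> ?S y" by (simp only: S(2)[OF y(1,2) z])
        finally show "z \<epsilon> rst (?S x) y \<longleftrightarrow> z \<epsilon> ?S y" .
      qed (use S x y in auto)
      then show ?thesis using IH[OF y] by simp
    qed
    have ap: "approx (?S x) x" unfolding approx_def
    proof (intro conjI ballI impI)
      show "\<exists>y\<in>U. X y \<and> L y x \<and> (\<exists>v\<in>U. z = pr y v)" if "z \<in> U" "z \<epsilon> ?S x" for z
        using S(2)[OF x that(1)] that(2) recf_closed by blast
      show "\<exists>v\<in>U. pr y v \<epsilon> ?S x" if "y \<in> U" "X y" "L y x" for y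
        using S(2)[OF x, of "pr y (recf y)"] that by (intro bexI[of _ "recf y"]) auto
      show "v = H y (rst (?S x) y)" if "y \<in> U" "v \<in> U" "pr y v \<epsilon> ?S x" for y v
      proof -
        have "X y \<and> L y x \<and> v = recf y" using S(2)[OF x, of "pr y v"] that by auto
        then show ?thesis using rst[OF that(1)] by (simp add: recf_def)
      qed
    qed
    have "apx x = ?S x" unfolding apx_def
      by (rule The0_eq) (use ap S x approx_unique in auto)
    with ap show ?thesis by blast
  qed
  \<comment> \<open>\<open>?S x\<close> is known to be a set only under \<open>X x\<close>, so it is
    no term on the whole universe; the equation is made definable by comparing elements.\<close>
  have "Dfn (\<lambda>e. apx (e 0) = ?S (e 0) \<or> \<not> X (e 0))"
  proof -
    have "Dfn (\<lambda>e. (\<forall>z\<in>U. z \<epsilon> apx (e 0) \<longleftrightarrow> (\<exists>y\<in>U. (X y \<and> L y (e 0)) \<and> z = pr y (recf y))) \<or> \<not> X (e 0))"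
      by (intro dfn D1I[OF DX] D2I[OF DL] F1I[OF F1_recf] F1I[OF F1_apx])
    then show ?thesis
    proof (rule Dfn_cong)
      fix e :: "nat \<Rightarrow> 'a" assume e: "\<And>i. e i \<in> U"
      have "X (e 0) \<Longrightarrow> (\<forall>z\<in>U. z \<epsilon> apx (e 0) \<longleftrightarrow> (\<exists>y\<in>U. (X y \<and> L y (e 0)) \<and> z = pr y (recf y))) \<Longrightarrow>
         apx (e 0) = ?S (e 0)"
        by (rule extensionality) (use e S[of "e 0"] in \<open>auto simp: F1_closed[OF F1_apx]\<close>)
      then show "((\<forall>z\<in>U. z \<epsilon> apx (e 0) \<longleftrightarrow> (\<exists>y\<in>U. (X y \<and> L y (e 0)) \<and> z = pr y (recf y))) \<or> \<not> X (e 0))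
        \<longleftrightarrow> (apx (e 0) = ?S (e 0) \<or> \<not> X (e 0))"
        using S[of "e 0"] e by auto
    qed
  qed
  then have "apx x = ?S x \<or> \<not> X x"
    by (rule wo_induct[of "\<lambda>x. apx x = ?S x \<or> \<not> X x"]) (use main assms in auto)
  then show ?thesis using assms by blast
qed

end

theorem recursion:
  assumes "F2 H"
  shows "\<exists>G. F1 G \<and> (\<forall>x\<in>U. X x \<longrightarrow> small (\<lambda>z. \<exists>y\<in>U. (X y \<and> L y x) \<and> z = pr y (G y)) \<and>
    G x = H x (SetOf (\<lambda>z. \<exists>y\<in>U. (X y \<and> L y x) \<and> z = pr y (G y))))"
  using F1_recf[OF assms] small_recf[OF assms] apx_eq[OF assms] recf_def[OF assms]
  by (intro exI[of _ "recf H"]) auto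

text \<open>Recursion for the characteristic function, with values \<open>suc emp\<close> and
  \<open>emp\<close>. In this form membership of \<open>x\<close> may be decided by looking at the
  set of all earlier members.\<close>

theorem set_recursion:
  assumes D: "D2 \<Psi>"
  shows "\<exists>A. D1 A \<and> (\<forall>x\<in>U. X x \<longrightarrow> small (\<lambda>y. (X y \<and> L y x) \<and> A y) \<and>
    (A x \<longleftrightarrow> \<Psi> (SetOf (\<lambda>y. (X y \<and> L y x) \<and> A y)) x))"
proof -
  let ?one = "suc emp"
  have one: "?one \<in> U" "?one \<noteq> emp" using suc(2)[of emp emp] emp(2)[of emp] by (auto simp del: suc(2))
  \<comment> \<open>The conjunct \<open>X x\<close> makes the class empty, hence small, at the
    arguments where initial segments are not under control.\<close>
  let ?S = "\<lambda>x r. SetOf (\<lambda>y. X x \<and> (X y \<and> L y x) \<and> pr y ?one \<epsilon> r)"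
  let ?H = "\<lambda>x r. if \<Psi> (?S x r) x then ?one else emp"
  have smH: "small (\<lambda>y. X x \<and> (X y \<and> L y x) \<and> pr y ?one \<epsilon> r)" if "x \<in> U" "r \<in> U" for x r
  proof (cases "X x")
    case True
    then show ?thesis using that one
      by (intro small_subset[OF small_below[of x]]) (auto intro!: dfn D1I[OF DX] D2I[OF DL])
  qed (simp add: small_empty)
  have "F2 ?H"
    by (intro dfn D2I[OF D] Tm_SetOf smH D1I[OF DX] D2I[OF DL]) (auto simp: one)
  from recursion[OF this] obtain G where G: "F1 G"
    "\<And>x. x\<in>U \<Longrightarrow> X x \<Longrightarrow> small (\<lambda>z. \<exists>y\<in>U. (X y \<and> L y x) \<and> z = pr y (G y))"
    "\<And>x. x\<in>U \<Longrightarrow> X x \<Longrightarrow> G x = ?H x (SetOf (\<lambda>z. \<exists>y\<in>U. (X y \<and> L y x) \<and> z = pr y (G y)))"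
    by blast
  define A where "A x \<longleftrightarrow> G x = ?one" for x
  have DA: "D1 A" unfolding A_def using one by (intro dfn G)
  have "small (\<lambda>y. (X y \<and> L y x) \<and> A y)" if "x \<in> U" "X x" for x
    by (rule small_subset[OF small_below[of x]]) (use that in \<open>auto intro!: dfn D1I[OF DX] D2I[OF DL] DA\<close>)
  moreover have "A x \<longleftrightarrow> \<Psi> (SetOf (\<lambda>y. (X y \<and> L y x) \<and> A y)) x" if x: "x \<in> U" "X x" for x
  proof -
    let ?g = "SetOf (\<lambda>z. \<exists>y\<in>U. (X y \<and> L y x) \<and> z = pr y (G y))"
    have "?S x ?g = SetOf (\<lambda>y. (X y \<and> L y x) \<and> A y)"
    proof (rule SetOf_unique)
      show 1: "SetOf (\<lambda>y. (X y \<and> L y x) \<and> A y) \<in> U" by (rule SetOf_closed) (rule calculation[OF x])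
      fix y assume y: "y \<in> U"
      have "y \<epsilon> SetOf (\<lambda>y. (X y \<and> L y x) \<and> A y) \<longleftrightarrow> (X y \<and> L y x) \<and> A y"
        by (rule mem_SetOf[OF calculation[OF x] y])
      moreover have "pr y ?one \<epsilon> ?g \<longleftrightarrow> (\<exists>y'\<in>U. (X y' \<and> L y' x) \<and> pr y ?one = pr y' (G y'))"
        by (rule mem_SetOf[OF G(2)[OF x]]) (use y one in auto)
      moreover have "(\<exists>y'\<in>U. (X y' \<and> L y' x) \<and> pr y ?one = pr y' (G y')) \<longleftrightarrow> (X y \<and> L y x) \<and> A y"
      proof
        assume "\<exists>y'\<in>U. (X y' \<and> L y' x) \<and> pr y ?one = pr y' (G y')"
        then obtain y' where y': "y' \<in> U" "X y'" "L y' x" "pr y ?one = pr y' (G y')" by blast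
        have "y = y' \<and> ?one = G y'"
          using y'(4) pr_eq_iff[OF y one(1) y'(1) F1_closed[OF G(1) y'(1)]] by blast
        then show "(X y \<and> L y x) \<and> A y" using y' unfolding A_def by metis
      next
        assume "(X y \<and> L y x) \<and> A y"
        then show "\<exists>y'\<in>U. (X y' \<and> L y' x) \<and> pr y ?one = pr y' (G y')"
          using y unfolding A_def by (intro bexI[of _ y]) simp_all
      qed
      ultimately show "y \<epsilon> SetOf (\<lambda>y. (X y \<and> L y x) \<and> A y) \<longleftrightarrow> X x \<and> (X y \<and> L y x) \<and> pr y ?one \<epsilon> ?g"
        using x(2) by blast
    qed
    then show ?thesis using G(3)[OF x] one by (simp add: A_def)
  qed
  ultimately show ?thesis using DA by blast
qed

text \<open>The Mostowski collapse of the order: \<open>x\<close> is sent to the set of the values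
  of its predecessors. Transitivity of \<open>L\<close> makes these sets transitive, and by
  induction they are ordinals.\<close>

theorem collapse:
  "\<exists>\<gamma>. F1 \<gamma> \<and> (\<forall>x\<in>U. X x \<longrightarrow> Od (\<gamma> x)) \<and> (\<forall>x\<in>U. \<forall>y\<in>U. X x \<longrightarrow> X y \<longrightarrow> L y x \<longrightarrow> \<gamma> y \<epsilon> \<gamma> x)"
proof -
  let ?H = "\<lambda>x r. SetOf (\<lambda>v. \<exists>y\<in>U. X y \<and> L y x \<and> pr y v \<epsilon> r)"
  have sm: "small (\<lambda>v. \<exists>y\<in>U. X y \<and> L y x \<and> pr y v \<epsilon> r)" if "x \<in> U" "r \<in> U" for x r
  proof (rule small_subset[OF small_mem[of "Unn (Unn r)"]])
    fix v assume v: "v \<in> U" and "\<exists>y\<in>U. X y \<and> L y x \<and> pr y v \<epsilon> r"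
    then obtain y where y: "y \<in> U" "pr y v \<epsilon> r" by blast
    have "upr y v \<epsilon> pr y v" using y v by (simp add: pr_def)
    then have "upr y v \<epsilon> Unn r" using that v y by (simp del: pr_eq_iff) (blast intro: pr_closed)
    moreover have "v \<epsilon> upr y v" using y v by simp
    ultimately show "v \<epsilon> Unn (Unn r)" using that v y Unn(2)[of "Unn r" v] by (blast intro: Unn(1) upr(1))
  qed (use that in \<open>auto intro!: dfn D1I[OF DX] D2I[OF DL]\<close>)
  have "F2 ?H"
    by (intro dfn Tm_SetOf sm D1I[OF DX] D2I[OF DL]) auto
  from recursion[OF this] obtain G where G: "F1 G"
    "\<And>x. x\<in>U \<Longrightarrow> X x \<Longrightarrow> small (\<lambda>z. \<exists>y\<in>U. (X y \<and> L y x) \<and> z = pr y (G y))"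
    "\<And>x. x\<in>U \<Longrightarrow> X x \<Longrightarrow> G x = ?H x (SetOf (\<lambda>z. \<exists>y\<in>U. (X y \<and> L y x) \<and> z = pr y (G y)))"
    by blast
  have GU [simp]: "G x \<in> U" if "x \<in> U" for x using F1_closed[OF G(1) that] .
  have mem: "v \<epsilon> G x \<longleftrightarrow> (\<exists>y\<in>U. X y \<and> L y x \<and> v = G y)" if "x \<in> U" "X x" "v \<in> U" for x v
    using mem_SetOf[OF sm[OF that(1) SetOf_closed[OF G(2)[OF that(1,2)]]] that(3)] mem_SetOf[OF G(2)[OF that(1,2)]]
      G(3)[OF that(1,2)] that by auto
  have "Od (G x)" if "x \<in> U" "X x" for x
  proof (rule wo_induct[of "\<lambda>x. Od (G x)"])
    show "D1 (\<lambda>x. Od (G x))" by (intro dfn G)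
    fix x assume x: "x \<in> U" "X x" and IH: "\<And>y. y \<in> U \<Longrightarrow> X y \<Longrightarrow> L y x \<Longrightarrow> Od (G y)"
    show "Od (G x)"
    proof (rule OdI)
      show "z \<epsilon> G x" if "y \<in> U" "z \<in> U" "y \<epsilon> G x" "z \<epsilon> y" for y z
        using that mem x trans by metis
      show "Od y" if "y \<in> U" "y \<epsilon> G x" for y using that mem x IH by auto
    qed
  qed (use that in auto)
  moreover have "G y \<epsilon> G x" if "x \<in> U" "y \<in> U" "X x" "X y" "L y x" for x y
    using mem[of x "G y"] that by auto
  ultimately show ?thesis using G(1) by blast
qed

end

section \<open>An injection of the universe into the ordinals\<close>

context zf_model
begin

lemma Od_wo: "wo_class M Od (mem M)"
proof
  show "D1 Od" by (intro dfn)
  show "D2 (mem M)" by (intro dfn)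
  show "x \<in> U \<Longrightarrow> y \<in> U \<Longrightarrow> z \<in> U \<Longrightarrow> Od x \<Longrightarrow> Od y \<Longrightarrow> Od z \<Longrightarrow> x \<epsilon> y \<Longrightarrow> y \<epsilon> z \<Longrightarrow> x \<epsilon> z" for x y z
    by (rule Od_trans)
  show "x \<in> U \<Longrightarrow> y \<in> U \<Longrightarrow> Od x \<Longrightarrow> Od y \<Longrightarrow> x = y \<or> x \<epsilon> y \<or> y \<epsilon> x" for x y by (rule Od_linear)
  show "\<exists>m\<in>U. Od m \<and> P m \<and> (\<forall>y\<in>U. Od y \<longrightarrow> P y \<longrightarrow> \<not> y \<epsilon> m)"
    if "D1 P" "x \<in> U" "Od x" "P x" for P x
    by (rule Od_least[OF that]) blast
  show "small (\<lambda>y. Od y \<and> y \<epsilon> x)" if "x \<in> U" "Od x" for x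
    by (rule small_subset[OF small_mem[OF that(1)]]) (use that in \<open>auto intro!: dfn\<close>)
qed

lemma Od_induct:
  assumes "D1 P" "x \<in> U" "Od x"
    and "\<And>x. x \<in> U \<Longrightarrow> Od x \<Longrightarrow> (\<And>y. y \<in> U \<Longrightarrow> y \<epsilon> x \<Longrightarrow> P y) \<Longrightarrow> P x"
  shows "P x"
  by (rule wo_class.wo_induct[OF Od_wo assms(1-3)]) (use assms(4) Od_mem in blast)

lemma small_times:
  assumes "a \<in> U" "b \<in> U"
  shows "small (\<lambda>z. \<exists>c\<in>U. c \<epsilon> a \<and> (\<exists>d\<in>U. d \<epsilon> b \<and> z = pr c d))"
proof (rule small_UN[OF small_mem[OF assms(1)]])
  fix c assume "c \<in> U"
  then show "small (\<lambda>z. \<exists>d\<in>U. d \<epsilon> b \<and> z = pr c d)"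
    by (intro small_image[OF small_mem[OF assms(2)]] dfn)
qed (auto intro!: dfn assms)

section \<open>Goedel's well-ordering of pairs of ordinals\<close>

definition omax :: "'a \<Rightarrow> 'a" where
  "omax z = (if pfst z \<epsilon> psnd z then psnd z else pfst z)"

lemma Tm_omax [dfn]: "Tm t \<Longrightarrow> Tm (\<lambda>e. omax (t e))"
  by (rule F1I[of omax]) (auto simp: omax_def intro!: dfn)

lemma omax_closed [simp]: "omax z \<in> U"
  unfolding omax_def by simp

definition opair :: "'a \<Rightarrow> bool" where
  "opair z \<longleftrightarrow> (\<exists>a\<in>U. \<exists>b\<in>U. Od a \<and> Od b \<and> z = pr a b)"

text \<open>Maximum first, then lexicographic. The maximum in front bounds both components of all
  predecessors, which makes initial segments small; the plain lexicographic order is not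
  set-like.\<close>

definition oless :: "'a \<Rightarrow> 'a \<Rightarrow> bool" where
  "oless y x \<longleftrightarrow> omax y \<epsilon> omax x \<or> (omax y = omax x \<and>
     (pfst y \<epsilon> pfst x \<or> (pfst y = pfst x \<and> psnd y \<epsilon> psnd x)))"

lemma opairD:
  assumes "opair z" shows "Od (pfst z)" "Od (psnd z)" "Od (omax z)" "z = pr (pfst z) (psnd z)"
    "pfst z \<epsilon> suc (omax z)" "psnd z \<epsilon> suc (omax z)"
proof -
  obtain a b where ab: "a \<in> U" "b \<in> U" "Od a" "Od b" "z = pr a b" using assms unfolding opair_def by blast
  then show "Od (pfst z)" "Od (psnd z)" "Od (omax z)" "z = pr (pfst z) (psnd z)" by (auto simp: omax_def)
  show "pfst z \<epsilon> suc (omax z)" "psnd z \<epsilon> suc (omax z)"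
    using ab Od_linear[of a b] by (auto simp: omax_def)
qed

lemma opair_wo: "wo_class M opair oless"
proof
  show Do: "D1 opair" unfolding opair_def by (intro dfn)
  show "D2 oless" unfolding oless_def by (intro dfn)
  show "oless x z" if "x \<in> U" "y \<in> U" "z \<in> U" "opair x" "opair y" "opair z" "oless x y" "oless y z" for x y z
    using that(7,8) opairD[OF that(4)] opairD[OF that(5)] opairD[OF that(6)] unfolding oless_def
    by (metis Od_trans omax_closed pfst_closed psnd_closed)
  show "x = y \<or> oless x y \<or> oless y x" if "x \<in> U" "y \<in> U" "opair x" "opair y" for x y
    using opairD[OF that(3)] opairD[OF that(4)] unfolding oless_def
    by (metis Od_linear omax_closed pfst_closed psnd_closed)
  show "\<exists>m\<in>U. opair m \<and> P m \<and> (\<forall>y\<in>U. opair y \<longrightarrow> P y \<longrightarrow> \<not> oless y m)"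
    if DP: "D1 P" and x: "x \<in> U" "opair x" "P x" for P x
  proof -
    have "D1 (\<lambda>m. \<exists>z\<in>U. opair z \<and> P z \<and> omax z = m)" by (intro dfn D1I[OF Do] D1I[OF DP])
    then obtain m where m: "m \<in> U" "\<exists>z\<in>U. opair z \<and> P z \<and> omax z = m"
      "\<And>y. y \<in> U \<Longrightarrow> y \<epsilon> m \<Longrightarrow> \<not> (\<exists>z\<in>U. opair z \<and> P z \<and> omax z = y)"
      by (rule Od_least[where x = "omax x"]) (use x opairD in auto)
    then obtain x1 where x1: "x1 \<in> U" "opair x1" "P x1" "omax x1 = m" by blast
    have "D1 (\<lambda>a. \<exists>z\<in>U. opair z \<and> P z \<and> omax z = m \<and> pfst z = a)"
      by (intro dfn D1I[OF Do] D1I[OF DP] m)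
    then obtain a where a: "a \<in> U" "\<exists>z\<in>U. opair z \<and> P z \<and> omax z = m \<and> pfst z = a"
      "\<And>y. y \<in> U \<Longrightarrow> y \<epsilon> a \<Longrightarrow> \<not> (\<exists>z\<in>U. opair z \<and> P z \<and> omax z = m \<and> pfst z = y)"
      by (rule Od_least[where x = "pfst x1"]) (use x1 opairD in auto)
    then obtain x2 where x2: "x2 \<in> U" "opair x2" "P x2" "omax x2 = m" "pfst x2 = a" by blast
    have "D1 (\<lambda>b. \<exists>z\<in>U. opair z \<and> P z \<and> omax z = m \<and> pfst z = a \<and> psnd z = b)"
      by (intro dfn D1I[OF Do] D1I[OF DP] m a)
    then obtain b where b: "b \<in> U" "\<exists>z\<in>U. opair z \<and> P z \<and> omax z = m \<and> pfst z = a \<and> psnd z = b"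
      "\<And>y. y \<in> U \<Longrightarrow> y \<epsilon> b \<Longrightarrow> \<not> (\<exists>z\<in>U. opair z \<and> P z \<and> omax z = m \<and> pfst z = a \<and> psnd z = y)"
      by (rule Od_least[where x = "psnd x2"]) (use x2 opairD in auto)
    then obtain x3 where x3: "x3 \<in> U" "opair x3" "P x3" "omax x3 = m" "pfst x3 = a" "psnd x3 = b" by blast
    have "\<not> oless y x3" if "y \<in> U" "opair y" "P y" for y
      using m(3)[of "omax y"] a(3)[of "pfst y"] b(3)[of "psnd y"] that unfolding oless_def x3 by auto
    then show ?thesis using x3 by blast
  qed
  show "small (\<lambda>y. opair y \<and> oless y x)" if x: "x \<in> U" "opair x" for x
  proof (rule small_subset[OF small_times[of "suc (omax x)" "suc (omax x)"]])
    show "D1 (\<lambda>y. opair y \<and> oless y x)" unfolding oless_def by (intro dfn D1I[OF Do] x)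
    fix y assume y: "y \<in> U" "opair y \<and> oless y x"
    then have le: "omax y \<epsilon> suc (omax x)" by (auto simp: oless_def)
    have "Od (suc (omax x))" using opairD[OF x(2)] by (intro Od_suc) auto
    then have "z \<epsilon> suc (omax x)" if "z \<in> U" "z \<epsilon> suc (omax y)" for z
      using that le Od_trans[of "suc (omax x)" "omax y" z] suc(2)[of "omax y" z] by auto
    then show "\<exists>c\<in>U. c \<epsilon> suc (omax x) \<and> (\<exists>d\<in>U. d \<epsilon> suc (omax x) \<and> y = pr c d)"
      using opairD[of y] y pfst_closed psnd_closed by blast
  qed auto
qed

text \<open>Goedel's pairing function, obtained from the collapse of \<open>oless\<close>. It is
  fixed by choice from three properties: definability, ordinal values and injectivity on
  ordinals.\<close>

definition J :: "'a \<Rightarrow> 'a \<Rightarrow> 'a" where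
  "J = (SOME J. F2 J \<and> (\<forall>a\<in>U. \<forall>b\<in>U. Od a \<longrightarrow> Od b \<longrightarrow> Od (J a b)) \<and>
     (\<forall>a\<in>U. \<forall>b\<in>U. \<forall>c\<in>U. \<forall>d\<in>U. Od a \<longrightarrow> Od b \<longrightarrow> Od c \<longrightarrow> Od d \<longrightarrow> J a b = J c d \<longrightarrow> a = c \<and> b = d))"

lemma J_spec: "F2 J \<and> (\<forall>a\<in>U. \<forall>b\<in>U. Od a \<longrightarrow> Od b \<longrightarrow> Od (J a b)) \<and>
     (\<forall>a\<in>U. \<forall>b\<in>U. \<forall>c\<in>U. \<forall>d\<in>U. Od a \<longrightarrow> Od b \<longrightarrow> Od c \<longrightarrow> Od d \<longrightarrow> J a b = J c d \<longrightarrow> a = c \<and> b = d)"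
proof -
  obtain \<gamma> where \<gamma>: "F1 \<gamma>" "\<And>x. x \<in> U \<Longrightarrow> opair x \<Longrightarrow> Od (\<gamma> x)"
    "\<And>x y. x \<in> U \<Longrightarrow> y \<in> U \<Longrightarrow> opair x \<Longrightarrow> opair y \<Longrightarrow> oless y x \<Longrightarrow> \<gamma> y \<epsilon> \<gamma> x"
    using wo_class.collapse[OF opair_wo] by blast
  have inj: "x = y" if "x \<in> U" "y \<in> U" "opair x" "opair y" "\<gamma> x = \<gamma> y" for x y
    using wo_class.linear[OF opair_wo that(1-4)] \<gamma>(3)[of x y] \<gamma>(3)[of y x]
      not_mem_self[OF F1_closed[OF \<gamma>(1) that(1)]] that by metis
  have op: "opair (pr a b)" if "a \<in> U" "b \<in> U" "Od a" "Od b" for a b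
    using that unfolding opair_def by blast
  show ?thesis unfolding J_def
  proof (rule someI[of _ "\<lambda>a b. \<gamma> (pr a b)"], intro conjI ballI impI)
    show "F2 (\<lambda>a b. \<gamma> (pr a b))" by (intro F1I[OF \<gamma>(1)] dfn)
    show "Od (\<gamma> (pr a b))" if "a \<in> U" "b \<in> U" "Od a" "Od b" for a b
      using \<gamma>(2)[OF pr_closed op] that by blast
    fix a b c d assume *: "a \<in> U" "b \<in> U" "c \<in> U" "d \<in> U" "Od a" "Od b" "Od c" "Od d"
      "\<gamma> (pr a b) = \<gamma> (pr c d)"
    have "pr a b = pr c d" by (rule inj) (use * op in auto)
    then show "a = c" "b = d" using * by auto
  qed
qed

lemma Tm_J [dfn]: "Tm a \<Longrightarrow> Tm b \<Longrightarrow> Tm (\<lambda>e. J (a e) (b e))"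
  by (rule F2I[OF conjunct1[OF J_spec]])

lemma J_closed [simp]: "a \<in> U \<Longrightarrow> b \<in> U \<Longrightarrow> J a b \<in> U"
  by (rule F2_closed[OF conjunct1[OF J_spec]])

lemma J_Od: "a \<in> U \<Longrightarrow> b \<in> U \<Longrightarrow> Od a \<Longrightarrow> Od b \<Longrightarrow> Od (J a b)"
  using J_spec by blast

lemma J_inj: "J a b = J c d \<Longrightarrow> a \<in> U \<Longrightarrow> b \<in> U \<Longrightarrow> c \<in> U \<Longrightarrow> d \<in> U \<Longrightarrow> Od a \<Longrightarrow> Od b \<Longrightarrow> Od c \<Longrightarrow> Od d \<Longrightarrow>
    a = c \<and> b = d"
  using J_spec by blast

section \<open>Numerals, internal natural numbers and internal formulas\<close>

primrec num :: "nat \<Rightarrow> 'a" where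
  "num 0 = emp"
| "num (Suc k) = suc (num k)"

lemma num_closed [simp]: "num k \<in> U"
  by (induction k) auto

lemma Od_num [simp]: "Od (num k)"
  by (induction k) (auto intro: Od_suc)

lemma num_less: "i < j \<Longrightarrow> num i \<epsilon> num j"
  by (induction j) (auto simp: less_Suc_eq)

lemma num_eq_iff [simp]: "num i = num j \<longleftrightarrow> i = j"
  using num_less[of i j] num_less[of j i] not_mem_self[of "num i"] not_mem_self[of "num j"]
  by (cases i j rule: linorder_cases) auto

lemma is_numeral_iff [simp]: "z \<in> U \<Longrightarrow> is_numeral M k z \<longleftrightarrow> z = num k"
  by (induction k arbitrary: z) auto

lemma is_code_iff [simp]: "a \<in> U \<Longrightarrow> b \<in> U \<Longrightarrow> z \<in> U \<Longrightarrow> is_code M k a b z \<longleftrightarrow> z = pr (num k) (pr a b)"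
  unfolding is_code_def by auto

lemma suc_inj: "a \<in> U \<Longrightarrow> b \<in> U \<Longrightarrow> suc a = suc b \<Longrightarrow> a = b"
  using suc(2)[of a a] suc(2)[of b a] suc(2)[of a b] suc(2)[of b b] not_mem_cycle[of a b] by metis

lemma suc_neq_emp: "a \<in> U \<Longrightarrow> suc a \<noteq> emp"
  using suc(2)[of a a] emp(2)[of a] by metis

context
  fixes w assumes w: "w \<in> U" "is_omega M w"
begin

lemma omega_emp: "emp \<epsilon> w"
  using w unfolding is_omega_def is_inductive_def by auto

lemma omega_suc: "n \<in> U \<Longrightarrow> n \<epsilon> w \<Longrightarrow> suc n \<epsilon> w"
  using w unfolding is_omega_def is_inductive_def by auto

lemma omega_num: "num k \<epsilon> w"
  by (induction k) (auto intro: omega_emp omega_suc)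

lemma omega_induct:
  assumes "D1 P" "n \<in> U" "n \<epsilon> w" "P emp" "\<And>n. n \<in> U \<Longrightarrow> n \<epsilon> w \<Longrightarrow> P n \<Longrightarrow> P (suc n)"
  shows "P n"
proof -
  obtain I where I: "I \<in> U" "\<And>x. x \<in> U \<Longrightarrow> x \<epsilon> I \<longleftrightarrow> x \<epsilon> w \<and> P x"
    using separation[OF assms(1) w(1)] by blast
  have "is_inductive M I" unfolding is_inductive_def
    using I omega_emp omega_suc assms by (auto intro!: bexI[of _ emp])
  then have "is_subset M w I" using w I unfolding is_omega_def by blast
  then show ?thesis using I assms unfolding is_subset_def by blast
qed

lemma omega_Od: "n \<in> U \<Longrightarrow> n \<epsilon> w \<Longrightarrow> Od n"
  by (rule omega_induct[of Od]) (auto intro!: dfn Od_suc)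

lemma omega_trans: "n \<in> U \<Longrightarrow> n \<epsilon> w \<Longrightarrow> i \<in> U \<Longrightarrow> i \<epsilon> n \<Longrightarrow> i \<epsilon> w"
proof -
  assume n: "n \<in> U" "n \<epsilon> w" and i: "i \<in> U" "i \<epsilon> n"
  have "\<forall>i\<in>U. i \<epsilon> n \<longrightarrow> i \<epsilon> w"
    by (rule omega_induct[of "\<lambda>n. \<forall>i\<in>U. i \<epsilon> n \<longrightarrow> i \<epsilon> w"]) (use n w in \<open>auto intro!: dfn\<close>)
  then show ?thesis using i by blast
qed

lemma omega_max:
  assumes "m \<in> U" "n \<in> U" "m \<epsilon> w" "n \<epsilon> w"
  obtains k where "k \<in> U" "k \<epsilon> w" "\<And>i. i \<in> U \<Longrightarrow> i \<epsilon> m \<Longrightarrow> i \<epsilon> k" "\<And>i. i \<in> U \<Longrightarrow> i \<epsilon> n \<Longrightarrow> i \<epsilon> k"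
proof -
  have "m = n \<or> m \<epsilon> n \<or> n \<epsilon> m" using Od_linear omega_Od assms by blast
  then show ?thesis
    using that[of m] that[of n] assms Od_trans[of m n] Od_trans[of n m] omega_Od by blast
qed

context
  fixes F assumes F: "F \<in> U" "is_formulas M w F"
begin

lemma F_closed:
  "i \<in> U \<Longrightarrow> j \<in> U \<Longrightarrow> i \<epsilon> w \<Longrightarrow> j \<epsilon> w \<Longrightarrow> pr (num 0) (pr i j) \<epsilon> F"
  "i \<in> U \<Longrightarrow> j \<in> U \<Longrightarrow> i \<epsilon> w \<Longrightarrow> j \<epsilon> w \<Longrightarrow> pr (num 1) (pr i j) \<epsilon> F"
  "f \<in> U \<Longrightarrow> g \<in> U \<Longrightarrow> f \<epsilon> F \<Longrightarrow> g \<epsilon> F \<Longrightarrow> pr (num 2) (pr f g) \<epsilon> F"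
  "i \<in> U \<Longrightarrow> f \<in> U \<Longrightarrow> i \<epsilon> w \<Longrightarrow> f \<epsilon> F \<Longrightarrow> pr (num 3) (pr i f) \<epsilon> F"
proof -
  have F': "fm_closed M w F" using F unfolding is_formulas_def by blast
  show "i \<in> U \<Longrightarrow> j \<in> U \<Longrightarrow> i \<epsilon> w \<Longrightarrow> j \<epsilon> w \<Longrightarrow> pr (num 0) (pr i j) \<epsilon> F"
    using F'[unfolded fm_closed_def, THEN conjunct1, rule_format, of i j "pr (num 0) (pr i j)"] by simp
  show "i \<in> U \<Longrightarrow> j \<in> U \<Longrightarrow> i \<epsilon> w \<Longrightarrow> j \<epsilon> w \<Longrightarrow> pr (num 1) (pr i j) \<epsilon> F"
    using F'[unfolded fm_closed_def, THEN conjunct1, rule_format, of i j "pr (num 1) (pr i j)"] by simp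
  show "f \<in> U \<Longrightarrow> g \<in> U \<Longrightarrow> f \<epsilon> F \<Longrightarrow> g \<epsilon> F \<Longrightarrow> pr (num 2) (pr f g) \<epsilon> F"
    using F'[unfolded fm_closed_def, THEN conjunct2, THEN conjunct1, rule_format, of f g "pr (num 2) (pr f g)"] by simp
  show "i \<in> U \<Longrightarrow> f \<in> U \<Longrightarrow> i \<epsilon> w \<Longrightarrow> f \<epsilon> F \<Longrightarrow> pr (num 3) (pr i f) \<epsilon> F"
    using F'[unfolded fm_closed_def, THEN conjunct2, THEN conjunct2, rule_format, of i f "pr (num 3) (pr i f)"] by simp
qed

text \<open>The elements of \<open>F\<close> with property \<open>P\<close> form a set closed under
  the formula constructors, and \<open>F\<close> is the least such set. This covers nonstandard
  formulas of \<open>M\<close> as well, at the cost of requiring \<open>P\<close> to be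
  definable.\<close>

lemma F_induct:
  assumes DP: "D1 P" and f: "f \<in> U" "f \<epsilon> F"
    and 0: "\<And>i j. i \<in> U \<Longrightarrow> j \<in> U \<Longrightarrow> i \<epsilon> w \<Longrightarrow> j \<epsilon> w \<Longrightarrow> P (pr (num 0) (pr i j))"
    and 1: "\<And>i j. i \<in> U \<Longrightarrow> j \<in> U \<Longrightarrow> i \<epsilon> w \<Longrightarrow> j \<epsilon> w \<Longrightarrow> P (pr (num 1) (pr i j))"
    and 2: "\<And>f g. f \<in> U \<Longrightarrow> g \<in> U \<Longrightarrow> f \<epsilon> F \<Longrightarrow> g \<epsilon> F \<Longrightarrow> P f \<Longrightarrow> P g \<Longrightarrow> P (pr (num 2) (pr f g))"
    and 3: "\<And>i f. i \<in> U \<Longrightarrow> f \<in> U \<Longrightarrow> i \<epsilon> w \<Longrightarrow> f \<epsilon> F \<Longrightarrow> P f \<Longrightarrow> P (pr (num 3) (pr i f))"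
  shows "P f"
proof -
  obtain G where G: "G \<in> U" "\<And>x. x \<in> U \<Longrightarrow> x \<epsilon> G \<longleftrightarrow> x \<epsilon> F \<and> P x"
    using separation[OF DP F(1)] by blast
  have "fm_closed M w G" unfolding fm_closed_def
  proof (intro conjI ballI impI)
    fix i j z assume *: "i \<in> U" "j \<in> U" "z \<in> U" "i \<epsilon> w \<and> j \<epsilon> w \<and> (is_code M 0 i j z \<or> is_code M 1 i j z)"
    then show "z \<epsilon> G" using G(2)[OF *(3)] 0[of i j] 1[of i j] F_closed(1,2)[of i j] by auto
  next
    fix f g z assume *: "f \<in> U" "g \<in> U" "z \<in> U" "f \<epsilon> G \<and> g \<epsilon> G \<and> is_code M 2 f g z"
    then show "z \<epsilon> G" using G(2) 2[of f g] F_closed(3)[of f g] by auto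
  next
    fix i f z assume *: "i \<in> U" "f \<in> U" "z \<in> U" "i \<epsilon> w \<and> f \<epsilon> G \<and> is_code M 3 i f z"
    then show "z \<epsilon> G" using G(2) 3[of i f] F_closed(4)[of i f] by auto
  qed
  then have "is_subset M F G" using F G(1) unfolding is_formulas_def by blast
  then show ?thesis using G f unfolding is_subset_def by blast
qed

end

end

end

locale hod_model = zf_model +
  fixes p w F
  assumes pU [simp]: "p \<in> U" and wU [simp]: "w \<in> U" and w: "is_omega M w"
    and FU [simp]: "F \<in> U" and F: "is_formulas M w F"
    and HOD: "V_eq_HOD M p"
begin

declare num.simps [simp del]

lemmas w_num = omega_num[OF wU w]
  and w_emp = omega_emp[OF wU w]
  and w_suc = omega_suc[OF wU w]
  and w_induct = omega_induct[OF wU w]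
  and w_Od = omega_Od[OF wU w]
  and w_trans = omega_trans[OF wU w]
  and w_max = omega_max[OF wU w]
  and fm_induct = F_induct[OF wU w FU F]
  and fm_closedI = F_closed[OF wU w FU F]

subsection \<open>Ordinal codes of formulas\<close>

text \<open>No recursion on internal formulas is needed: a code is any entry of a table, that is, of a set
  in which each entry is justified by other entries. Codes need not be unique, but they determine
  the formula.\<close>

definition fm_step :: "'a \<Rightarrow> 'a \<Rightarrow> 'a \<Rightarrow> bool" where
  "fm_step t g o' \<longleftrightarrow>
     (\<exists>i\<in>U. \<exists>j\<in>U. i \<epsilon> w \<and> j \<epsilon> w \<and> g = pr (num 0) (pr i j) \<and> o' = J (num 0) (J i j)) \<or>
     (\<exists>i\<in>U. \<exists>j\<in>U. i \<epsilon> w \<and> j \<epsilon> w \<and> g = pr (num 1) (pr i j) \<and> o' = J (num 1) (J i j)) \<or>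
     (\<exists>a\<in>U. \<exists>b\<in>U. \<exists>oa\<in>U. \<exists>ob\<in>U. Od oa \<and> Od ob \<and> pr a oa \<epsilon> t \<and> pr b ob \<epsilon> t \<and>
        g = pr (num 2) (pr a b) \<and> o' = J (num 2) (J oa ob)) \<or>
     (\<exists>i\<in>U. \<exists>b\<in>U. \<exists>ob\<in>U. i \<epsilon> w \<and> Od ob \<and> pr b ob \<epsilon> t \<and>
        g = pr (num 3) (pr i b) \<and> o' = J (num 3) (J i ob))"

definition fm_table :: "'a \<Rightarrow> bool" where
  "fm_table t \<longleftrightarrow> (\<forall>g\<in>U. \<forall>o'\<in>U. pr g o' \<epsilon> t \<longrightarrow> fm_step t g o')"

definition fm_code :: "'a \<Rightarrow> 'a \<Rightarrow> bool" where
  "fm_code f o' \<longleftrightarrow> (\<exists>t\<in>U. fm_table t \<and> pr f o' \<epsilon> t)"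

lemma Dfn_fm_code [dfn]: "Tm f \<Longrightarrow> Tm o' \<Longrightarrow> Dfn (\<lambda>e. fm_code (f e) (o' e))"
  by (rule D2I[of fm_code]) (auto simp: fm_code_def fm_table_def fm_step_def intro!: dfn)

lemma fm_step_mono: "fm_step t g o' \<Longrightarrow> (\<And>z. z \<in> U \<Longrightarrow> z \<epsilon> t \<Longrightarrow> z \<epsilon> t') \<Longrightarrow> fm_step t' g o'"
  unfolding fm_step_def using pr_closed by meson

lemma fm_step_Od: "fm_step t g o' \<Longrightarrow> Od o'"
  unfolding fm_step_def by (auto intro!: J_Od simp: w_Od)

lemma fm_code_step:
  assumes "fm_code f o'" "f \<in> U" "o' \<in> U"
  shows "(\<exists>i\<in>U. \<exists>j\<in>U. i \<epsilon> w \<and> j \<epsilon> w \<and> f = pr (num 0) (pr i j) \<and> o' = J (num 0) (J i j)) \<or>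
     (\<exists>i\<in>U. \<exists>j\<in>U. i \<epsilon> w \<and> j \<epsilon> w \<and> f = pr (num 1) (pr i j) \<and> o' = J (num 1) (J i j)) \<or>
     (\<exists>a\<in>U. \<exists>b\<in>U. \<exists>oa\<in>U. \<exists>ob\<in>U. Od oa \<and> Od ob \<and> fm_code a oa \<and> fm_code b ob \<and>
        f = pr (num 2) (pr a b) \<and> o' = J (num 2) (J oa ob)) \<or>
     (\<exists>i\<in>U. \<exists>b\<in>U. \<exists>ob\<in>U. i \<epsilon> w \<and> Od ob \<and> fm_code b ob \<and>
        f = pr (num 3) (pr i b) \<and> o' = J (num 3) (J i ob))"
proof -
  obtain t where t: "t \<in> U" "fm_table t" "pr f o' \<epsilon> t" using assms unfolding fm_code_def by blast
  then have "fm_step t f o'" using assms unfolding fm_table_def by blast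
  moreover have "pr a b \<epsilon> t \<Longrightarrow> fm_code a b" for a b using t unfolding fm_code_def by blast
  ultimately show ?thesis unfolding fm_step_def by meson
qed

lemma fm_code_Od: "fm_code f o' \<Longrightarrow> f \<in> U \<Longrightarrow> o' \<in> U \<Longrightarrow> Od o'"
  using fm_step_Od unfolding fm_code_def fm_table_def by blast

lemma fm_code_extend:
  assumes t: "t \<in> U" "fm_table t" and step: "fm_step t g o'" and g: "g \<in> U" "o' \<in> U"
  shows "fm_code g o'"
proof -
  let ?t = "adj t (pr g o')"
  have "fm_table ?t" unfolding fm_table_def
  proof (intro ballI impI)
    fix h q assume h: "h \<in> U" "q \<in> U" "pr h q \<epsilon> ?t"
    then have "pr h q \<epsilon> t \<or> (h = g \<and> q = o')" using t g by auto
    then have "fm_step t h q" using t(2) step h unfolding fm_table_def by blast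
    then show "fm_step ?t h q" by (rule fm_step_mono) (use t g in auto)
  qed
  then show ?thesis unfolding fm_code_def using t g by (intro bexI[of _ ?t]) auto
qed

lemma fm_table_unn:
  assumes t: "t \<in> U" "t' \<in> U" "fm_table t" "fm_table t'" shows "fm_table (unn t t')"
  unfolding fm_table_def
proof (intro ballI impI)
  fix g q assume g: "g \<in> U" "q \<in> U" "pr g q \<epsilon> unn t t'"
  then have "fm_step t g q \<or> fm_step t' g q" using t unfolding fm_table_def by auto
  then show "fm_step (unn t t') g q"
    using fm_step_mono[of t g q "unn t t'"] fm_step_mono[of t' g q "unn t t'"] t by auto
qed

lemma fm_code_exists: "f \<in> U \<Longrightarrow> f \<epsilon> F \<Longrightarrow> \<exists>o'\<in>U. fm_code f o'"
proof (rule fm_induct[of "\<lambda>f. \<exists>o'\<in>U. fm_code f o'" f])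
  have emp: "fm_table emp" unfolding fm_table_def by auto
  show "\<exists>o'\<in>U. fm_code (pr (num 0) (pr i j)) o'" if "i \<in> U" "j \<in> U" "i \<epsilon> w" "j \<epsilon> w" for i j
    by (rule bexI[of _ "J (num 0) (J i j)"], rule fm_code_extend[OF _ emp])
      (use that in \<open>unfold fm_step_def, auto\<close>)
  show "\<exists>o'\<in>U. fm_code (pr (num 1) (pr i j)) o'" if "i \<in> U" "j \<in> U" "i \<epsilon> w" "j \<epsilon> w" for i j
    by (rule bexI[of _ "J (num 1) (J i j)"], rule fm_code_extend[OF _ emp])
      (use that in \<open>unfold fm_step_def, auto\<close>)
  show "\<exists>o'\<in>U. fm_code (pr (num 2) (pr f g)) o'" if H: "f \<in> U" "g \<in> U"
    "\<exists>o'\<in>U. fm_code f o'" "\<exists>o'\<in>U. fm_code g o'" for f g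
  proof -
    obtain oa ta where a: "oa \<in> U" "ta \<in> U" "fm_table ta" "pr f oa \<epsilon> ta" using H(3) unfolding fm_code_def by blast
    obtain ob tb where b: "ob \<in> U" "tb \<in> U" "fm_table tb" "pr g ob \<epsilon> tb" using H(4) unfolding fm_code_def by blast
    have Od: "Od oa" "Od ob" using fm_code_Od H a b unfolding fm_code_def by blast+
    have "fm_step (unn ta tb) (pr (num 2) (pr f g)) (J (num 2) (J oa ob))"
      unfolding fm_step_def
      by (rule disjI2, rule disjI2, rule disjI1, rule bexI[of _ f], rule bexI[of _ g], rule bexI[of _ oa], rule bexI[of _ ob])
        (use a b H Od in auto)
    then show ?thesis
      by (intro bexI[of _ "J (num 2) (J oa ob)"] fm_code_extend[of "unn ta tb"] fm_table_unn) (use a b H in auto)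
  qed
  show "\<exists>o'\<in>U. fm_code (pr (num 3) (pr i f)) o'" if H: "i \<in> U" "f \<in> U" "i \<epsilon> w"
    "\<exists>o'\<in>U. fm_code f o'" for i f
  proof -
    obtain oa ta where a: "oa \<in> U" "ta \<in> U" "fm_table ta" "pr f oa \<epsilon> ta" using H(4) unfolding fm_code_def by blast
    have Od: "Od oa" using fm_code_Od H a unfolding fm_code_def by blast+
    have "fm_step ta (pr (num 3) (pr i f)) (J (num 3) (J i oa))"
      unfolding fm_step_def
      by (intro disjI2, rule bexI[of _ i], rule bexI[of _ f], rule bexI[of _ oa])
        (use a H Od in auto)
    then show ?thesis
      by (intro bexI[of _ "J (num 3) (J i oa)"] fm_code_extend[of "ta"]) (use a H in auto)
  qed
qed (auto intro!: dfn)

lemma J_num_inj: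
  assumes "J (num k) (J a b) = J (num l) (J c d)" "a \<in> U" "b \<in> U" "c \<in> U" "d \<in> U" "Od a" "Od b" "Od c" "Od d"
  shows "k = l \<and> a = c \<and> b = d"
  using J_inj[OF assms(1)] J_inj[of a b c d] assms by (simp add: J_Od)

lemma fm_code_inv:
  assumes c: "fm_code g (J (num k) (J a b))" and g: "g \<in> U" and ab: "a \<in> U" "b \<in> U" "Od a" "Od b"
  shows "k = 0 \<and> g = pr (num 0) (pr a b) \<or> k = 1 \<and> g = pr (num 1) (pr a b) \<or>
    k = 2 \<and> (\<exists>x\<in>U. \<exists>y\<in>U. fm_code x a \<and> fm_code y b \<and> g = pr (num 2) (pr x y)) \<or>
    k = 3 \<and> (\<exists>y\<in>U. fm_code y b \<and> g = pr (num 3) (pr a y))"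
proof -
  have "J (num k) (J a b) \<in> U" using ab by simp
  from fm_code_step[OF c g this] show ?thesis
  proof (elim disjE bexE conjE)
    fix i j assume *: "i \<in> U" "j \<in> U" "i \<epsilon> w" "j \<epsilon> w" "g = pr (num 0) (pr i j)"
      "J (num k) (J a b) = J (num 0) (J i j)"
    have "k = 0 \<and> a = i \<and> b = j" by (rule J_num_inj) (fact * ab | rule w_Od)+
    then show ?thesis using * by blast
  next
    fix i j assume *: "i \<in> U" "j \<in> U" "i \<epsilon> w" "j \<epsilon> w" "g = pr (num 1) (pr i j)"
      "J (num k) (J a b) = J (num 1) (J i j)"
    have "k = 1 \<and> a = i \<and> b = j" by (rule J_num_inj) (fact * ab | rule w_Od)+
    then show ?thesis using * by blast
  next
    fix x y oa ob assume *: "x \<in> U" "y \<in> U" "oa \<in> U" "ob \<in> U" "Od oa" "Od ob" "fm_code x oa" "fm_code y ob"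
      "g = pr (num 2) (pr x y)" "J (num k) (J a b) = J (num 2) (J oa ob)"
    have "k = 2 \<and> a = oa \<and> b = ob" by (rule J_num_inj) (fact * ab)+
    then show ?thesis using * by blast
  next
    fix i y ob assume *: "i \<in> U" "y \<in> U" "ob \<in> U" "i \<epsilon> w" "Od ob" "fm_code y ob"
      "g = pr (num 3) (pr i y)" "J (num k) (J a b) = J (num 3) (J i ob)"
    have "k = 3 \<and> a = i \<and> b = ob" by (rule J_num_inj) (fact * ab | rule w_Od)+
    then show ?thesis using * by blast
  qed
qed

text \<open>By induction on \<open>f\<close>: the numeral in front of a code reveals the outermost
  constructor, injectivity of \<open>J\<close> gives the codes of the parts, and the parts agree by
  the induction hypothesis. The formula \<open>g\<close> ranges over everything that has a
  code.\<close>

lemma fm_code_inj: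
  assumes "f \<in> U" "f \<epsilon> F"
  shows "\<forall>g\<in>U. \<forall>q\<in>U. fm_code f q \<longrightarrow> fm_code g q \<longrightarrow> g = f"
proof (rule fm_induct[of "\<lambda>f. \<forall>g\<in>U. \<forall>q\<in>U. fm_code f q \<longrightarrow> fm_code g q \<longrightarrow> g = f" f])
  have inv: "(k = 0 \<longrightarrow> i \<epsilon> w \<and> j \<epsilon> w \<and> q = J (num 0) (J i j)) \<and> (k = 1 \<longrightarrow> i \<epsilon> w \<and> j \<epsilon> w \<and> q = J (num 1) (J i j)) \<and>
      (k = 2 \<longrightarrow> (\<exists>oa\<in>U. \<exists>ob\<in>U. Od oa \<and> Od ob \<and> fm_code i oa \<and> fm_code j ob \<and> q = J (num 2) (J oa ob))) \<and>
      (k = 3 \<longrightarrow> i \<epsilon> w \<and> (\<exists>ob\<in>U. Od ob \<and> fm_code j ob \<and> q = J (num 3) (J i ob)))"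
    if "fm_code (pr (num k) (pr i j)) q" "q \<in> U" "i \<in> U" "j \<in> U" for k i j q
  proof -
    have "pr (num k) (pr i j) \<in> U" using that by simp
    from fm_code_step[OF that(1) this that(2)] show ?thesis
      by (elim disjE bexE conjE) (use that(3,4) in auto)
  qed
  show "\<forall>g\<in>U. \<forall>q\<in>U. fm_code (pr (num 0) (pr i j)) q \<longrightarrow> fm_code g q \<longrightarrow> g = pr (num 0) (pr i j)"
    if "i \<in> U" "j \<in> U" "i \<epsilon> w" "j \<epsilon> w" for i j
    using inv[of 0 i j] fm_code_inv[of _ 0 i j] w_Od that by auto
  show "\<forall>g\<in>U. \<forall>q\<in>U. fm_code (pr (num 1) (pr i j)) q \<longrightarrow> fm_code g q \<longrightarrow> g = pr (num 1) (pr i j)"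
    if "i \<in> U" "j \<in> U" "i \<epsilon> w" "j \<epsilon> w" for i j
    using inv[of 1 i j] fm_code_inv[of _ 1 i j] w_Od that by auto
  show "\<forall>h\<in>U. \<forall>q\<in>U. fm_code (pr (num 2) (pr f g)) q \<longrightarrow> fm_code h q \<longrightarrow> h = pr (num 2) (pr f g)"
    if fg: "f \<in> U" "g \<in> U" and IH: "\<forall>h\<in>U. \<forall>q\<in>U. fm_code f q \<longrightarrow> fm_code h q \<longrightarrow> h = f"
      "\<forall>h\<in>U. \<forall>q\<in>U. fm_code g q \<longrightarrow> fm_code h q \<longrightarrow> h = g" for f g
  proof (intro ballI impI)
    fix h q assume *: "h \<in> U" "q \<in> U" "fm_code (pr (num 2) (pr f g)) q" "fm_code h q"
    obtain oa ob where q: "q = J (num 2) (J oa ob)" "oa \<in> U" "ob \<in> U" "Od oa" "Od ob" "fm_code f oa" "fm_code g ob"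
      using inv[OF *(3,2) fg] by auto
    obtain x y where "x \<in> U" "y \<in> U" "fm_code x oa" "fm_code y ob" "h = pr (num 2) (pr x y)"
      using fm_code_inv[of h 2 oa ob] * q by auto
    then show "h = pr (num 2) (pr f g)" using IH q by blast
  qed
  show "\<forall>h\<in>U. \<forall>q\<in>U. fm_code (pr (num 3) (pr i f)) q \<longrightarrow> fm_code h q \<longrightarrow> h = pr (num 3) (pr i f)"
    if fg: "i \<in> U" "f \<in> U" "i \<epsilon> w" and IH: "\<forall>h\<in>U. \<forall>q\<in>U. fm_code f q \<longrightarrow> fm_code h q \<longrightarrow> h = f" for i f
  proof (intro ballI impI)
    fix h q assume *: "h \<in> U" "q \<in> U" "fm_code (pr (num 3) (pr i f)) q" "fm_code h q"
    obtain oa where q: "q = J (num 3) (J i oa)" "oa \<in> U" "Od oa" "fm_code f oa"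
      using inv[OF *(3,2) fg(1,2)] by auto
    obtain y where "y \<in> U" "fm_code y oa" "h = pr (num 3) (pr i y)"
      using fm_code_inv[of h 3 i oa] * q fg w_Od by auto
    then show "h = pr (num 3) (pr i f)" using IH q by blast
  qed
qed (use assms in \<open>auto intro!: dfn\<close>)

subsection \<open>Ordinal codes of initial segments of assignments\<close>

text \<open>Only the variables from \<open>v\<^sub>2\<close> on carry ordinals; the entries 0 and 1 are replaced by 0.\<close>

definition entry :: "'a \<Rightarrow> 'a \<Rightarrow> 'a \<Rightarrow> bool" where
  "entry s m b \<longleftrightarrow> (if m = num 0 \<or> m = num 1 then b = emp else Od b \<and> rel M s m b)"

definition seq_table :: "'a \<Rightarrow> 'a \<Rightarrow> bool" where
  "seq_table s t \<longleftrightarrow> (\<forall>n\<in>U. \<forall>o'\<in>U. pr n o' \<epsilon> t \<longrightarrow> (n = emp \<and> o' = emp) \<or>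
     (\<exists>m\<in>U. \<exists>q\<in>U. \<exists>b\<in>U. m \<epsilon> w \<and> Od q \<and> pr m q \<epsilon> t \<and> entry s m b \<and> n = suc m \<and> o' = J q b))"

definition seq_code :: "'a \<Rightarrow> 'a \<Rightarrow> 'a \<Rightarrow> bool" where
  "seq_code s n o' \<longleftrightarrow> (\<exists>t\<in>U. seq_table s t \<and> pr n o' \<epsilon> t)"

lemma Dfn_entry: "Tm s \<Longrightarrow> Tm m \<Longrightarrow> Tm b \<Longrightarrow> Dfn (\<lambda>e. entry (s e) (m e) (b e))"
  unfolding entry_def if_bool_eq_conj by (intro dfn num_closed emp)

lemma Dfn_seq_code [dfn]: "Tm s \<Longrightarrow> Tm n \<Longrightarrow> Tm o' \<Longrightarrow> Dfn (\<lambda>e. seq_code (s e) (n e) (o' e))"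
  by (rule D3I[of seq_code]) (auto simp: seq_code_def seq_table_def intro!: dfn Dfn_entry)

lemma entry_Od: "entry s m b \<Longrightarrow> Od b"
  by (auto simp: entry_def split: if_splits)

lemma seq_code_step:
  assumes "seq_code s n o'" "n \<in> U" "o' \<in> U"
  shows "(n = emp \<and> o' = emp) \<or>
     (\<exists>m\<in>U. \<exists>q\<in>U. \<exists>b\<in>U. m \<epsilon> w \<and> Od q \<and> seq_code s m q \<and> entry s m b \<and> n = suc m \<and> o' = J q b)"
proof -
  obtain t where t: "t \<in> U" "seq_table s t" "pr n o' \<epsilon> t" using assms(1) unfolding seq_code_def by blast
  have "(n = emp \<and> o' = emp) \<or>
     (\<exists>m\<in>U. \<exists>q\<in>U. \<exists>b\<in>U. m \<epsilon> w \<and> Od q \<and> pr m q \<epsilon> t \<and> entry s m b \<and> n = suc m \<and> o' = J q b)"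
    using t(2)[unfolded seq_table_def, rule_format, OF assms(2,3) t(3)] .
  moreover have "pr m q \<epsilon> t \<Longrightarrow> seq_code s m q" for m q using t unfolding seq_code_def by blast
  ultimately show ?thesis by blast
qed

lemma seq_code_Od: "seq_code s n o' \<Longrightarrow> n \<in> U \<Longrightarrow> o' \<in> U \<Longrightarrow> Od o'"
  using seq_code_step[of s n o'] entry_Od[of s] J_Od by auto

lemma seq_code_exists:
  assumes "s \<in> U" "\<And>m. m \<in> U \<Longrightarrow> m \<epsilon> w \<Longrightarrow> \<exists>b\<in>U. entry s m b" "n \<in> U" "n \<epsilon> w"
  shows "\<exists>o'\<in>U. seq_code s n o'"
proof (rule w_induct[of "\<lambda>n. \<exists>o'\<in>U. seq_code s n o'" n])
  have "seq_table s (upr (pr emp emp) (pr emp emp))" unfolding seq_table_def by auto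
  then show "\<exists>o'\<in>U. seq_code s emp o'" unfolding seq_code_def
    by (intro bexI[of _ emp] bexI[of _ "upr (pr emp emp) (pr emp emp)"]) auto
  fix m assume m: "m \<in> U" "m \<epsilon> w" "\<exists>o'\<in>U. seq_code s m o'"
  then obtain q t where q: "q \<in> U" "t \<in> U" "seq_table s t" "pr m q \<epsilon> t" unfolding seq_code_def by blast
  obtain b where b: "b \<in> U" "entry s m b" using assms(2) m by blast
  have "Od q" using seq_code_Od m q unfolding seq_code_def by blast
  have "seq_table s (adj t (pr (suc m) (J q b)))" unfolding seq_table_def
  proof (intro ballI impI)
    fix n o' assume n: "n \<in> U" "o' \<in> U" "pr n o' \<epsilon> adj t (pr (suc m) (J q b))"
    then consider "pr n o' \<epsilon> t" | "n = suc m" "o' = J q b" using q b m by auto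
    then show "(n = emp \<and> o' = emp) \<or> (\<exists>m'\<in>U. \<exists>q'\<in>U. \<exists>b'\<in>U. m' \<epsilon> w \<and> Od q' \<and>
      pr m' q' \<epsilon> adj t (pr (suc m) (J q b)) \<and> entry s m' b' \<and> n = suc m' \<and> o' = J q' b')"
    proof cases
      case 1
      have "pr m' q' \<epsilon> adj t (pr (suc m) (J q b))" if "m' \<in> U" "q' \<in> U" "pr m' q' \<epsilon> t" for m' q'
        using that q b m by auto
      with q(3)[unfolded seq_table_def, rule_format, OF n(1,2) 1] show ?thesis by blast
    next
      case 2
      have "pr m q \<epsilon> adj t (pr (suc m) (J q b))" using q b m by auto
      with 2 show ?thesis using m b q \<open>Od q\<close> by blast
    qed
  qed
  then show "\<exists>o'\<in>U. seq_code s (suc m) o'" unfolding seq_code_def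
    by (intro bexI[of _ "J q b"] bexI[of _ "adj t (pr (suc m) (J q b))"]) (use m q b in auto)
qed (use assms in \<open>auto intro!: dfn\<close>)

text \<open>Peeling \<open>J q b\<close> off the code for \<open>suc n\<close> compares the last
  entries and leaves a common code for \<open>n\<close>. So one code fixes all recorded entries
  below \<open>n\<close>, although the assignments themselves are infinite objects.\<close>

lemma seq_code_inj:
  assumes s: "s \<in> U" "s' \<in> U" and n: "n \<in> U" "n \<epsilon> w"
  shows "\<forall>q\<in>U. seq_code s n q \<longrightarrow> seq_code s' n q \<longrightarrow>
    (\<forall>m\<in>U. m \<epsilon> n \<longrightarrow> (\<exists>b\<in>U. entry s m b \<and> entry s' m b))"
proof (rule w_induct[of "\<lambda>n. \<forall>q\<in>U. seq_code s n q \<longrightarrow> seq_code s' n q \<longrightarrow>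
    (\<forall>m\<in>U. m \<epsilon> n \<longrightarrow> (\<exists>b\<in>U. entry s m b \<and> entry s' m b))" n])
  fix n assume n: "n \<in> U" "n \<epsilon> w" and IH: "\<forall>q\<in>U. seq_code s n q \<longrightarrow> seq_code s' n q \<longrightarrow>
    (\<forall>m\<in>U. m \<epsilon> n \<longrightarrow> (\<exists>b\<in>U. entry s m b \<and> entry s' m b))"
  show "\<forall>q\<in>U. seq_code s (suc n) q \<longrightarrow> seq_code s' (suc n) q \<longrightarrow>
    (\<forall>m\<in>U. m \<epsilon> suc n \<longrightarrow> (\<exists>b\<in>U. entry s m b \<and> entry s' m b))"
  proof (intro ballI impI)
    fix q m assume q: "q \<in> U" "seq_code s (suc n) q" "seq_code s' (suc n) q" and m: "m \<in> U" "m \<epsilon> suc n"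
    obtain q1 b1 where 1: "q1 \<in> U" "b1 \<in> U" "Od q1" "seq_code s n q1" "entry s n b1" "q = J q1 b1"
      using seq_code_step[OF q(2) _ q(1)] n suc_neq_emp[of n] suc_inj[of n] by auto
    obtain q2 b2 where 2: "q2 \<in> U" "b2 \<in> U" "Od q2" "seq_code s' n q2" "entry s' n b2" "q = J q2 b2"
      using seq_code_step[OF q(3) _ q(1)] n suc_neq_emp[of n] suc_inj[of n] by auto
    have eq: "q1 = q2 \<and> b1 = b2"
      by (rule J_inj) (use 1 2 entry_Od in auto)
    show "\<exists>b\<in>U. entry s m b \<and> entry s' m b"
    proof (cases "m = n")
      case True
      then show ?thesis using 1 2 eq by blast
    next
      case False
      then have "m \<epsilon> n" using m n by simp
      then show ?thesis using IH 1 2 eq m by blast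
    qed
  qed
qed (use assms in \<open>auto intro!: dfn Dfn_entry\<close>)

subsection \<open>Satisfaction depends on finitely many variables\<close>

definition agree :: "'a \<Rightarrow> 'a \<Rightarrow> 'a \<Rightarrow> bool" where
  "agree n s t \<longleftrightarrow> (\<forall>i\<in>U. i \<epsilon> n \<longrightarrow> (\<forall>b\<in>U. rel M s i b \<longleftrightarrow> rel M t i b))"

text \<open>Two satisfaction relations are compared at once: truth depends neither on the values
  from \<open>n\<close> on nor on the choice of \<open>S\<close>. Hence the code of a set can omit
  both.\<close>

definition local :: "'a \<Rightarrow> 'a \<Rightarrow> 'a \<Rightarrow> bool" where
  "local v f n \<longleftrightarrow> (\<forall>S\<in>U. \<forall>S'\<in>U. \<forall>s\<in>U. \<forall>t\<in>U.
     is_satisfaction M w F v S \<longrightarrow> is_satisfaction M w F v S' \<longrightarrow>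
     is_function M s w v \<longrightarrow> is_function M t w v \<longrightarrow> agree n s t \<longrightarrow> rel M S f s \<longrightarrow> rel M S' f t)"

lemma Dfn_agree [dfn]:
  assumes "Tm n" "Tm s" "Tm t" shows "Dfn (\<lambda>e. agree (n e) (s e) (t e))"
  unfolding agree_def by (intro dfn assms assms[THEN Tm_subst])

lemma Dfn_local [dfn]:
  assumes "Tm v" "Tm f" "Tm n" shows "Dfn (\<lambda>e. local (v e) (f e) (n e))"
  unfolding local_def by (intro dfn assms assms[THEN Tm_subst] wU FU)

lemma agree_sym: "agree n s t \<Longrightarrow> agree n t s"
  unfolding agree_def by blast

lemma agree_mono: "agree k s t \<Longrightarrow> (\<And>i. i \<in> U \<Longrightarrow> i \<epsilon> n \<Longrightarrow> i \<epsilon> k) \<Longrightarrow> agree n s t"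
  unfolding agree_def by blast

lemma fun_unique: "is_function M s w v \<Longrightarrow> i \<in> U \<Longrightarrow> i \<epsilon> w \<Longrightarrow> b \<in> U \<Longrightarrow> c \<in> U \<Longrightarrow>
   rel M s i b \<Longrightarrow> rel M s i c \<Longrightarrow> b = c"
  unfolding is_function_def by blast

lemma update_exists:
  assumes s: "s \<in> U" "is_function M s w v" and i: "i \<in> U" "i \<epsilon> w" and a: "a \<in> U" "a \<epsilon> v" and v: "v \<in> U"
  shows "\<exists>t\<in>U. is_update M w v s i a t"
proof -
  obtain s' where s': "s' \<in> U" "\<And>z. z \<in> U \<Longrightarrow> z \<epsilon> s' \<longleftrightarrow> z \<epsilon> s \<and> pfst z \<noteq> i"
  proof -
    have "D1 (\<lambda>z. pfst z \<noteq> i)" by (intro dfn i)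
    from separation[OF this s(1)] show ?thesis using that by blast
  qed
  define t where "t = adj s' (pr i a)"
  have t: "t \<in> U" "\<And>z. z \<in> U \<Longrightarrow> z \<epsilon> t \<longleftrightarrow> (z \<epsilon> s \<and> pfst z \<noteq> i) \<or> z = pr i a"
    unfolding t_def using s' i a by auto
  have relt: "rel M t j b \<longleftrightarrow> (if j = i then b = a else rel M s j b)" if "j \<in> U" "b \<in> U" for j b
    using that t(1) s i a t(2)[of "pr j b"] by auto
  have "is_function M t w v" unfolding is_function_def
  proof (intro conjI ballI impI)
    fix z assume z: "z \<in> U" "z \<epsilon> t"
    then have "z \<epsilon> s \<or> z = pr i a" using t by blast
    then show "\<exists>x\<in>U. \<exists>y\<in>U. x \<epsilon> w \<and> y \<epsilon> v \<and> is_pair M x y z"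
      using s(2) z i a unfolding is_function_def by auto
  next
    fix x assume x: "x \<in> U" "x \<epsilon> w"
    show "\<exists>!y. y \<in> U \<and> rel M t x y"
    proof (cases "x = i")
      case True
      then show ?thesis using relt i a by auto
    next
      case False
      have "\<exists>!y. y \<in> U \<and> rel M s x y" using s(2) x unfolding is_function_def by blast
      moreover have "(y \<in> U \<and> rel M t x y) \<longleftrightarrow> (y \<in> U \<and> rel M s x y)" for y
        using relt[OF x(1)] False by auto
      ultimately show ?thesis by presburger
    qed
  qed
  then have "is_update M w v s i a t"
    unfolding is_update_def using relt i a by auto
  then show ?thesis using t by blast
qed

lemma update_agree:
  assumes "is_update M w v s i a t" "is_update M w v s' i a t'"
    and "\<And>j. j \<in> U \<Longrightarrow> j \<epsilon> n \<Longrightarrow> j \<noteq> i \<Longrightarrow> \<forall>b\<in>U. rel M s j b \<longleftrightarrow> rel M s' j b"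
    and "i \<in> U" "i \<epsilon> w" "a \<in> U" "n \<in> U" "n \<epsilon> w"
  shows "agree n t t'"
  unfolding agree_def
proof (intro ballI impI)
  fix j b assume j: "j \<in> U" "j \<epsilon> n" "b \<in> U"
  have jw: "j \<epsilon> w" using w_trans assms j by blast
  show "rel M t j b \<longleftrightarrow> rel M t' j b"
  proof (cases "j = i")
    case True
    have "rel M t i b \<longleftrightarrow> b = a" "rel M t' i b \<longleftrightarrow> b = a"
      using assms(1,2) fun_unique[of _ v i b a] assms(4-6) j(3) unfolding is_update_def by blast+
    then show ?thesis using True by simp
  next
    case False
    then show ?thesis using assms(1,2,3) j jw unfolding is_update_def by blast
  qed
qed

lemma satD:
  assumes "is_satisfaction M w F v S" "s \<in> U" "is_function M s w v" "S \<in> U" "v \<in> U"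
  shows "\<And>i j. i \<in> U \<Longrightarrow> j \<in> U \<Longrightarrow> i \<epsilon> w \<Longrightarrow> j \<epsilon> w \<Longrightarrow> rel M S (pr (num 0) (pr i j)) s \<longleftrightarrow>
            (\<exists>a\<in>univ M. \<exists>b\<in>univ M. rel M s i a \<and> rel M s j b \<and> a \<epsilon> b)"
    "\<And>i j. i \<in> U \<Longrightarrow> j \<in> U \<Longrightarrow> i \<epsilon> w \<Longrightarrow> j \<epsilon> w \<Longrightarrow> rel M S (pr (num 1) (pr i j)) s \<longleftrightarrow>
            (\<exists>a\<in>univ M. rel M s i a \<and> rel M s j a)"
    "\<And>f g. f \<in> U \<Longrightarrow> g \<in> U \<Longrightarrow> f \<epsilon> F \<Longrightarrow> g \<epsilon> F \<Longrightarrow> rel M S (pr (num 2) (pr f g)) s \<longleftrightarrow>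
            \<not> (rel M S f s \<and> rel M S g s)"
    "\<And>i f. i \<in> U \<Longrightarrow> f \<in> U \<Longrightarrow> i \<epsilon> w \<Longrightarrow> f \<epsilon> F \<Longrightarrow> rel M S (pr (num 3) (pr i f)) s \<longleftrightarrow>
            (\<exists>a\<in>univ M. \<exists>t\<in>univ M. a \<epsilon> v \<and> is_update M w v s i a t \<and> rel M S f t)"
proof -
  note * = assms(1)[unfolded is_satisfaction_def, rule_format, OF assms(2,3)]
  fix i j f g assume U: "i \<in> U" "j \<in> U"
  show "i \<epsilon> w \<Longrightarrow> j \<epsilon> w \<Longrightarrow> rel M S (pr (num 0) (pr i j)) s \<longleftrightarrow>
            (\<exists>a\<in>univ M. \<exists>b\<in>univ M. rel M s i a \<and> rel M s j b \<and> a \<epsilon> b)"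
    using *[THEN conjunct1, rule_format, of i j "pr (num 0) (pr i j)"] U by simp
  show "i \<epsilon> w \<Longrightarrow> j \<epsilon> w \<Longrightarrow> rel M S (pr (num 1) (pr i j)) s \<longleftrightarrow>
            (\<exists>a\<in>univ M. rel M s i a \<and> rel M s j a)"
    using *[THEN conjunct2, THEN conjunct1, rule_format, of i j "pr (num 1) (pr i j)"] U by simp
next
  note * = assms(1)[unfolded is_satisfaction_def, rule_format, OF assms(2,3)]
  fix f g assume U: "f \<in> U" "g \<in> U"
  show "f \<epsilon> F \<Longrightarrow> g \<epsilon> F \<Longrightarrow> rel M S (pr (num 2) (pr f g)) s \<longleftrightarrow>
            \<not> (rel M S f s \<and> rel M S g s)"
    using *[THEN conjunct2, THEN conjunct2, THEN conjunct1, rule_format, of f g "pr (num 2) (pr f g)"] U by simp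
next
  note * = assms(1)[unfolded is_satisfaction_def, rule_format, OF assms(2,3)]
  fix i f assume U: "i \<in> U" "f \<in> U"
  show "i \<epsilon> w \<Longrightarrow> f \<epsilon> F \<Longrightarrow> rel M S (pr (num 3) (pr i f)) s \<longleftrightarrow>
            (\<exists>a\<in>univ M. \<exists>t\<in>univ M. a \<epsilon> v \<and> is_update M w v s i a t \<and> rel M S f t)"
    using *[THEN conjunct2, THEN conjunct2, THEN conjunct2, rule_format, of i f "pr (num 3) (pr i f)"] U by simp
qed

text \<open>\<open>n\<close> bounds the variables met in \<open>f\<close>. In the quantifier case
  the bound is kept: both assignments are updated at \<open>i\<close> by the same witness, and the
  results still agree below \<open>n\<close>.\<close>

lemma local_exists:
  assumes v: "v \<in> U" and f: "f \<in> U" "f \<epsilon> F"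
  shows "\<exists>n\<in>U. n \<epsilon> w \<and> local v f n"
proof (rule fm_induct[of "\<lambda>f. \<exists>n\<in>U. n \<epsilon> w \<and> local v f n" f])
  have atom: "\<exists>n\<in>U. n \<epsilon> w \<and> i \<epsilon> n \<and> j \<epsilon> n" if ij: "i \<in> U" "j \<in> U" "i \<epsilon> w" "j \<epsilon> w" for i j
  proof -
    obtain k where "k \<in> U" "k \<epsilon> w" "\<And>x. x \<in> U \<Longrightarrow> x \<epsilon> suc i \<Longrightarrow> x \<epsilon> k" "\<And>x. x \<in> U \<Longrightarrow> x \<epsilon> suc j \<Longrightarrow> x \<epsilon> k"
      by (rule w_max[OF suc(1)[OF ij(1)] suc(1)[OF ij(2)] w_suc[OF ij(1,3)] w_suc[OF ij(2,4)]], rule that)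
    then show ?thesis using ij by auto
  qed
  show "\<exists>n\<in>U. n \<epsilon> w \<and> local v (pr (num 0) (pr i j)) n" if ij: "i \<in> U" "j \<in> U" "i \<epsilon> w" "j \<epsilon> w" for i j
  proof -
    obtain n where n: "n \<in> U" "n \<epsilon> w" "i \<epsilon> n" "j \<epsilon> n" using atom[OF ij] by blast
    have "local v (pr (num 0) (pr i j)) n"
      unfolding local_def
      by (intro ballI impI) (simp only: satD(1) v ij agree_def; use n ij in blast)
    then show ?thesis using n by blast
  qed
  show "\<exists>n\<in>U. n \<epsilon> w \<and> local v (pr (num 1) (pr i j)) n" if ij: "i \<in> U" "j \<in> U" "i \<epsilon> w" "j \<epsilon> w" for i j
  proof -
    obtain n where n: "n \<in> U" "n \<epsilon> w" "i \<epsilon> n" "j \<epsilon> n" using atom[OF ij] by blast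
    have "local v (pr (num 1) (pr i j)) n"
      unfolding local_def
      by (intro ballI impI) (simp only: satD(2) v ij agree_def; use n ij in blast)
    then show ?thesis using n by blast
  qed
  show "\<exists>n\<in>U. n \<epsilon> w \<and> local v (pr (num 2) (pr f g)) n" if fg: "f \<in> U" "g \<in> U" "f \<epsilon> F" "g \<epsilon> F"
    and IH: "\<exists>n\<in>U. n \<epsilon> w \<and> local v f n" "\<exists>n\<in>U. n \<epsilon> w \<and> local v g n" for f g
  proof -
    obtain m n where m: "m \<in> U" "m \<epsilon> w" "local v f m" and n: "n \<in> U" "n \<epsilon> w" "local v g n"
      using IH by blast
    obtain k where k: "k \<in> U" "k \<epsilon> w" "\<And>x. x \<in> U \<Longrightarrow> x \<epsilon> m \<Longrightarrow> x \<epsilon> k" "\<And>x. x \<in> U \<Longrightarrow> x \<epsilon> n \<Longrightarrow> x \<epsilon> k"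
      by (rule w_max[OF m(1) n(1) m(2) n(2)], rule that)
    have "local v (pr (num 2) (pr f g)) k"
      unfolding local_def
    proof (intro ballI impI)
      fix S S' s t assume *: "S \<in> U" "S' \<in> U" "s \<in> U" "t \<in> U" "is_satisfaction M w F v S"
        "is_satisfaction M w F v S'" "is_function M s w v" "is_function M t w v" "agree k s t"
        "rel M S (pr (num 2) (pr f g)) s"
      have "agree m t s" "agree n t s" using agree_mono[of k t s] agree_sym[OF *(9)] k by blast+
      then have "rel M S' f t \<Longrightarrow> rel M S f s" "rel M S' g t \<Longrightarrow> rel M S g s"
        using m(3) n(3) * unfolding local_def by blast+
      then show "rel M S' (pr (num 2) (pr f g)) t"
        using *(10) satD(3)[OF *(5,3,7,1) v fg] satD(3)[OF *(6,4,8,2) v fg] by blast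
    qed
    then show ?thesis using k by blast
  qed
  show "\<exists>n\<in>U. n \<epsilon> w \<and> local v (pr (num 3) (pr i f)) n" if fg: "i \<in> U" "f \<in> U" "i \<epsilon> w" "f \<epsilon> F"
    and IH: "\<exists>n\<in>U. n \<epsilon> w \<and> local v f n" for i f
  proof -
    obtain n where n: "n \<in> U" "n \<epsilon> w" "local v f n" using IH by blast
    have "local v (pr (num 3) (pr i f)) n"
      unfolding local_def
    proof (intro ballI impI)
      fix S S' s s' assume *: "S \<in> U" "S' \<in> U" "s \<in> U" "s' \<in> U" "is_satisfaction M w F v S"
        "is_satisfaction M w F v S'" "is_function M s w v" "is_function M s' w v" "agree n s s'"
        "rel M S (pr (num 3) (pr i f)) s"
      obtain a t where t: "a \<in> U" "t \<in> U" "a \<epsilon> v" "is_update M w v s i a t" "rel M S f t"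
        using *(10) satD(4)[OF *(5,3,7,1) v fg] by blast
      obtain t' where t': "t' \<in> U" "is_update M w v s' i a t'"
        using update_exists[OF *(4,8) fg(1,3) t(1,3) v] by blast
      have "agree n t t'"
        by (rule update_agree[OF t(4) t'(2)]) (use *(9) fg t n in \<open>auto simp: agree_def\<close>)
      moreover have "is_function M t w v" "is_function M t' w v" using t t' unfolding is_update_def by blast+
      ultimately have "rel M S' f t'" using n(3) * t t' unfolding local_def by blast
      then show "rel M S' (pr (num 3) (pr i f)) s'"
        using satD(4)[OF *(6,4,8,2) v fg] t t' by blast
    qed
    then show ?thesis using n by blast
  qed
qed (use assms in \<open>auto intro!: dfn\<close>)

section \<open>Ordinals that name the sets definable in levels of the hierarchy\<close>

lemma is_V_unique:
  assumes "is_V M \<alpha> v" "is_V M \<alpha> v'" and U: "\<alpha> \<in> U" "v \<in> U" "v' \<in> U"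
  shows "v = v'"
proof -
  have Od: "Od \<alpha>" using assms unfolding is_V_def by blast
  let ?d = "suc \<alpha>"
  obtain d r f where 01: "d \<in> U" "r \<in> U" "f \<in> U" "is_succ M \<alpha> d" "is_function M f d r"
    "\<forall>\<beta>\<in>U. \<forall>y\<in>U. \<beta> \<epsilon> d \<and> rel M f \<beta> y \<longrightarrow> (\<forall>x\<in>U. x \<epsilon> y \<longleftrightarrow>
       (\<exists>\<gamma>\<in>U. \<exists>z\<in>U. \<gamma> \<epsilon> \<beta> \<and> rel M f \<gamma> z \<and> is_subset M x z))" "rel M f \<alpha> v"
    using assms(1) unfolding is_V_def by blast
  have "d = ?d" using 01(1,4) U(1) by simp
  note f = 01(2,3) 01(5)[unfolded this] 01(7) 01(6)[unfolded this, rule_format, OF _ _ conjI]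
  obtain d r' f' where 02: "d \<in> U" "r' \<in> U" "f' \<in> U" "is_succ M \<alpha> d" "is_function M f' d r'"
    "\<forall>\<beta>\<in>U. \<forall>y\<in>U. \<beta> \<epsilon> d \<and> rel M f' \<beta> y \<longrightarrow> (\<forall>x\<in>U. x \<epsilon> y \<longleftrightarrow>
       (\<exists>\<gamma>\<in>U. \<exists>z\<in>U. \<gamma> \<epsilon> \<beta> \<and> rel M f' \<gamma> z \<and> is_subset M x z))" "rel M f' \<alpha> v'"
    using assms(2) unfolding is_V_def by blast
  have "d = ?d" using 02(1,4) U(1) by simp
  note f' = 02(2,3) 02(5)[unfolded this] 02(7) 02(6)[unfolded this, rule_format, OF _ _ conjI]
  let ?P = "\<lambda>\<beta>. \<beta> \<epsilon> ?d \<longrightarrow> (\<forall>y\<in>U. \<forall>y'\<in>U. rel M f \<beta> y \<longrightarrow> rel M f' \<beta> y' \<longrightarrow> y = y')"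
  have "?P \<alpha>"
  proof (rule Od_induct[of ?P])
    show "D1 ?P" by (intro dfn U(1) f(2) f'(2))
    fix \<beta> assume \<beta>: "\<beta> \<in> U" and IH: "\<And>\<gamma>. \<gamma> \<in> U \<Longrightarrow> \<gamma> \<epsilon> \<beta> \<Longrightarrow> ?P \<gamma>"
    show "?P \<beta>"
    proof (intro impI ballI)
      fix y y' assume y: "\<beta> \<epsilon> ?d" "y \<in> U" "y' \<in> U" "rel M f \<beta> y" "rel M f' \<beta> y'"
      have below: "\<gamma> \<epsilon> ?d" if "\<gamma> \<in> U" "\<gamma> \<epsilon> \<beta>" for \<gamma>
        using Od_trans[OF Od_suc[OF Od U(1)] _ \<beta> that(1,2) y(1)] U by simp
      have eq: "rel M f \<gamma> z \<longleftrightarrow> rel M f' \<gamma> z" if "\<gamma> \<in> U" "\<gamma> \<epsilon> \<beta>" "z \<in> U" for \<gamma> z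
      proof -
        have "\<exists>!z. z \<in> U \<and> rel M f \<gamma> z" "\<exists>!z. z \<in> U \<and> rel M f' \<gamma> z"
          using f(3) f'(3) below[OF that(1,2)] that(1) unfolding is_function_def by blast+
        moreover have "\<forall>y\<in>U. \<forall>y'\<in>U. rel M f \<gamma> y \<longrightarrow> rel M f' \<gamma> y' \<longrightarrow> y = y'"
          using IH[OF that(1,2)] below[OF that(1,2)] by blast
        ultimately show ?thesis using that(3) by metis
      qed
      show "y = y'"
      proof (rule extensionality[OF y(2,3)])
        fix x assume x: "x \<in> U"
        show "x \<epsilon> y \<longleftrightarrow> x \<epsilon> y'"
          unfolding f(5)[OF \<beta> y(2,1,4) x] f'(5)[OF \<beta> y(3,1,5) x] using eq by blast
      qed
    qed
  qed (use U Od in auto)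
  then show ?thesis using U f(4) f'(4) by auto
qed

text \<open>\<open>\<theta>\<close> packs the index of the level, a code of the formula, a bound for
  its variables and a code of the assignment below this bound. Variable 0 is the object variable and
  variable 1 always carries \<open>p\<close>, so neither is recorded.\<close>

definition vcode :: "'a \<Rightarrow> 'a \<Rightarrow> bool" where
  "vcode x \<theta> \<longleftrightarrow> (\<exists>\<alpha>\<in>U. \<exists>f\<in>U. \<exists>n\<in>U. \<exists>q\<in>U. \<exists>r\<in>U. \<exists>v\<in>U. \<exists>S\<in>U. \<exists>s\<in>U.
     \<theta> = J \<alpha> (J q (J n r)) \<and> is_V M \<alpha> v \<and> is_satisfaction M w F v S \<and> p \<epsilon> v \<and> x \<epsilon> v \<and>
     f \<epsilon> F \<and> fm_code f q \<and> n \<epsilon> w \<and> local v f n \<and> is_function M s w v \<and> rel M s (num 1) p \<and>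
     seq_code s n r \<and> (\<forall>y\<in>U. \<forall>t\<in>U. y \<epsilon> v \<and> is_update M w v s (num 0) y t \<longrightarrow> (rel M S f t \<longleftrightarrow> y = x)))"

lemma Dfn_vcode [dfn]: "Tm x \<Longrightarrow> Tm \<theta> \<Longrightarrow> Dfn (\<lambda>e. vcode (x e) (\<theta> e))"
  by (rule D2I[of vcode]) (auto simp: vcode_def intro!: dfn)

lemma vcodeE:
  assumes "vcode x \<theta>"
  obtains \<alpha> f n q r v S s where "\<alpha> \<in> U" "f \<in> U" "n \<in> U" "q \<in> U" "r \<in> U" "v \<in> U" "S \<in> U" "s \<in> U"
     "\<theta> = J \<alpha> (J q (J n r))" "is_V M \<alpha> v" "is_satisfaction M w F v S" "p \<epsilon> v" "x \<epsilon> v"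
     "f \<epsilon> F" "fm_code f q" "n \<epsilon> w" "local v f n" "is_function M s w v" "rel M s (num 1) p"
     "seq_code s n r" "\<forall>y\<in>U. \<forall>t\<in>U. y \<epsilon> v \<and> is_update M w v s (num 0) y t \<longrightarrow> (rel M S f t \<longleftrightarrow> y = x)"
  using assms unfolding vcode_def
  apply (elim bexE conjE)
  subgoal for \<alpha> f n q r v S s by (rule that[of \<alpha> f n q r v S s])
  done

lemma J4_Od:
  assumes "is_V M \<alpha> v" "fm_code f q" "n \<epsilon> w" "seq_code s n r" "\<alpha> \<in> U" "f \<in> U" "n \<in> U" "q \<in> U" "r \<in> U"
  shows "Od \<alpha>" "Od q" "Od n" "Od r" "Od (J n r)" "Od (J q (J n r))" "Od (J \<alpha> (J q (J n r)))"
proof -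
  show *: "Od \<alpha>" "Od q" "Od n" "Od r"
    using conjunct1[OF assms(1)[unfolded is_V_def]] fm_code_Od[OF assms(2,6,8)] w_Od[OF assms(7,3)]
      seq_code_Od[OF assms(4,7,9)] by this
  show "Od (J n r)" "Od (J q (J n r))" "Od (J \<alpha> (J q (J n r)))"
    using * assms by (simp_all add: J_Od)
qed

lemma vcode_Od: assumes "vcode x \<theta>" shows "Od \<theta>"
  apply (rule vcodeE[OF assms])
  subgoal for \<alpha> f n q r v S s
    using J4_Od(7)[of \<alpha> v f q n s r] by (simp only:)
  done

lemma subset_antisym: "x \<in> U \<Longrightarrow> y \<in> U \<Longrightarrow> is_subset M x y \<Longrightarrow> is_subset M y x \<Longrightarrow> x = y"
  by (rule extensionality) (simp_all add: is_subset_def, blast)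

lemma omega_unique: "w' \<in> U \<Longrightarrow> is_omega M w' \<Longrightarrow> w' = w"
  by (rule subset_antisym) (use w in \<open>simp_all add: is_omega_def\<close>)

lemma formulas_unique: "F' \<in> U \<Longrightarrow> is_formulas M w F' \<Longrightarrow> F' = F"
  by (rule subset_antisym) (use F in \<open>simp_all add: is_formulas_def\<close>)

lemma vcode_exists:
  assumes x: "x \<in> U" shows "\<exists>\<theta>\<in>U. vcode x \<theta>"
proof -
  obtain \<alpha> where \<alpha>: "\<alpha> \<in> U" "Od \<alpha>" "definable_in_V M \<alpha> p x"
    using HOD x unfolding V_eq_HOD_def by blast
  from \<alpha>(3) obtain v w' F' S n0 n1 f s where d: "v \<in> U" "w' \<in> U" "F' \<in> U" "S \<in> U" "n0 \<in> U" "n1 \<in> U"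
    "is_V M \<alpha> v" "is_omega M w'" "is_formulas M w' F'" "is_satisfaction M w' F' v S"
    "is_numeral M 0 n0" "is_numeral M 1 n1" "p \<epsilon> v" "x \<epsilon> v" "f \<in> U" "s \<in> U" "f \<epsilon> F'"
    "is_function M s w' v" "rel M s n1 p"
    "\<forall>i\<in>univ M. i \<epsilon> w' \<and> i \<noteq> n0 \<and> i \<noteq> n1 \<longrightarrow>
              (\<exists>\<beta>\<in>univ M. \<beta> \<epsilon> \<alpha> \<and> rel M s i \<beta>)"
    "\<forall>y\<in>univ M. \<forall>t\<in>univ M. y \<epsilon> v \<and> is_update M w' v s n0 y t \<longrightarrow>
              (rel M S f t \<longleftrightarrow> y = x)"
    unfolding definable_in_V_def
    apply (elim bexE conjE)
    subgoal for v w' F' S n0 n1 f s by (rule that[of v w' F' S n0 n1 f s])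
    done
  have w': "w' = w" by (rule omega_unique[OF d(2,8)])
  have F': "F' = F" by (rule formulas_unique) (use d w' in auto)
  have n: "n0 = num 0" "n1 = num 1"
    using is_numeral_iff[OF d(5), of 0] is_numeral_iff[OF d(6), of 1] d(11,12) by blast+
  note d = d[unfolded w' F' n]
  obtain q where q: "q \<in> U" "fm_code f q" using fm_code_exists d by blast
  obtain n where n: "n \<in> U" "n \<epsilon> w" "local v f n" using local_exists d by blast
  have "\<exists>b\<in>U. entry s m b" if m: "m \<in> U" "m \<epsilon> w" for m
  proof (cases "m = num 0 \<or> m = num 1")
    case True
    then show ?thesis by (intro bexI[of _ emp]) (auto simp: entry_def)
  next
    case False
    then obtain \<beta> where "\<beta> \<in> U" "\<beta> \<epsilon> \<alpha>" "rel M s m \<beta>" using d(20) m by blast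
    then show ?thesis using False Od_mem[OF \<alpha>(2,1)] by (intro bexI[of _ \<beta>]) (auto simp: entry_def)
  qed
  then obtain r where r: "r \<in> U" "seq_code s n r" using seq_code_exists[of s n] d n by blast
  have "vcode x (J \<alpha> (J q (J n r)))" unfolding vcode_def
    by (rule bexI[OF _ \<alpha>(1)], rule bexI[OF _ d(15)], rule bexI[OF _ n(1)], rule bexI[OF _ q(1)],
      rule bexI[OF _ r(1)], rule bexI[OF _ d(1)], rule bexI[OF _ d(4)], rule bexI[OF _ d(16)])
      (use d q n r in blast)
  then show ?thesis using \<alpha> q n r by (intro bexI[of _ "J \<alpha> (J q (J n r))"]) auto
qed

text \<open>A common code yields the same level, formula and bound. If \<open>x\<close> is placed at
  variable 0 in both assignments, they agree below the bound: both carry \<open>p\<close> at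
  variable 1, and the remaining entries are in the code. By \<open>local\<close> the element
  \<open>x\<close> then satisfies the definition of \<open>x'\<close>.\<close>

lemma vcode_inj:
  assumes "vcode x \<theta>" "vcode x' \<theta>" and U: "x \<in> U" "x' \<in> U"
  shows "x = x'"
proof -
  obtain \<alpha> f n q r v S s where a: "\<alpha> \<in> U" "f \<in> U" "n \<in> U" "q \<in> U" "r \<in> U" "v \<in> U" "S \<in> U" "s \<in> U"
     "\<theta> = J \<alpha> (J q (J n r))" "is_V M \<alpha> v" "is_satisfaction M w F v S" "p \<epsilon> v" "x \<epsilon> v"
     "f \<epsilon> F" "fm_code f q" "n \<epsilon> w" "local v f n" "is_function M s w v" "rel M s (num 1) p"
     "seq_code s n r" "\<forall>y\<in>U. \<forall>t\<in>U. y \<epsilon> v \<and> is_update M w v s (num 0) y t \<longrightarrow> (rel M S f t \<longleftrightarrow> y = x)"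
    apply (rule vcodeE[OF assms(1)])
    subgoal for \<alpha> f n q r v S s by (rule that[of \<alpha> f n q r v S s])
    done
  obtain \<alpha>' f' n' q' r' v' S' s' where b: "\<alpha>' \<in> U" "f' \<in> U" "n' \<in> U" "q' \<in> U" "r' \<in> U" "v' \<in> U" "S' \<in> U" "s' \<in> U"
     "\<theta> = J \<alpha>' (J q' (J n' r'))" "is_V M \<alpha>' v'" "is_satisfaction M w F v' S'" "p \<epsilon> v'" "x' \<epsilon> v'"
     "f' \<epsilon> F" "fm_code f' q'" "n' \<epsilon> w" "local v' f' n'" "is_function M s' w v'" "rel M s' (num 1) p"
     "seq_code s' n' r'" "\<forall>y\<in>U. \<forall>t\<in>U. y \<epsilon> v' \<and> is_update M w v' s' (num 0) y t \<longrightarrow> (rel M S' f' t \<longleftrightarrow> y = x')"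
    apply (rule vcodeE[OF assms(2)])
    subgoal for \<alpha> f n q r v S s by (rule that[of \<alpha> f n q r v S s])
    done
  note Od = J4_Od[OF a(10,15,16,20) a(1,2,3,4,5)] J4_Od[OF b(10,15,16,20) b(1,2,3,4,5)]
  have "J \<alpha> (J q (J n r)) = J \<alpha>' (J q' (J n' r'))" using a(9) b(9) by simp
  then have 1: "\<alpha> = \<alpha>' \<and> J q (J n r) = J q' (J n' r')"
    by (rule J_inj) (use a(1-5) b(1-5) Od in simp_all)
  then have 2: "q = q' \<and> J n r = J n' r'"
    by (intro J_inj[of q "J n r" q' "J n' r'"]) (use a(1-5) b(1-5) Od in simp_all)
  then have 3: "n = n' \<and> r = r'"
    by (intro J_inj[of n r n' r']) (use a(1-5) b(1-5) Od in simp_all)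
  have v: "v' = v" using is_V_unique[of \<alpha> v' v] a(1,6,10) b(6,10) 1 by blast
  have f: "f' = f" using fm_code_inj[OF a(2,14)] a(4,15) b(2,15) 2 by blast
  have eqs: "\<alpha>' = \<alpha>" "q' = q" "n' = n" "r' = r" "v' = v" "f' = f" using 1 2 3 v f by auto
  note b = b[unfolded eqs]
  obtain t where t: "t \<in> U" "is_update M w v s (num 0) x t"
    using update_exists[OF a(8,18) num_closed w_num U(1) a(13,6)] by blast
  obtain t' where t': "t' \<in> U" "is_update M w v s' (num 0) x t'"
    using update_exists[OF b(8,18) num_closed w_num U(1) a(13,6)] by blast
  have "agree n t t'"
  proof (rule update_agree[OF t(2) t'(2)])
    fix j assume j: "j \<in> U" "j \<epsilon> n" "j \<noteq> num 0"
    have jw: "j \<epsilon> w" using w_trans a(3,16) j by blast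
    show "\<forall>b\<in>U. rel M s j b \<longleftrightarrow> rel M s' j b"
    proof (cases "j = num 1")
      case True
      then show ?thesis using fun_unique[OF a(18) j(1) jw] fun_unique[OF b(18) j(1) jw] a(19) b(19) pU by metis
    next
      case False
      obtain c where "c \<in> U" "entry s j c" "entry s' j c"
        using seq_code_inj[OF a(8) b(8) a(3,16)] a(20,5) b(20) j by blast
      then have "c \<in> U" "rel M s j c" "rel M s' j c" using False j by (auto simp: entry_def)
      then show ?thesis using fun_unique[OF a(18) j(1) jw] fun_unique[OF b(18) j(1) jw] by metis
    qed
  qed (use U a w_num in auto)
  moreover have "is_function M t w v" "is_function M t' w v" using t t' unfolding is_update_def by blast+
  moreover have "rel M S f t" using a(21) t a(13) U by blast
  ultimately have "rel M S' f t'" using a(17) a(7,11) b(7,11) t t' unfolding local_def by blast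
  then show ?thesis using b(21) t' a(13) U by blast
qed

theorem ordinal_injection: "\<exists>h. F1 h \<and> (\<forall>x\<in>U. Od (h x)) \<and> inj_on h U"
proof -
  define R where "R x \<theta> \<longleftrightarrow> vcode x \<theta> \<and> (\<forall>\<theta>'\<in>U. \<theta>' \<epsilon> \<theta> \<longrightarrow> \<not> vcode x \<theta>')" for x \<theta>
  define h where "h x = The0 (R x)" for x
  have "F1 h" unfolding h_def R_def by (rule Tm_The0) (intro dfn)
  moreover have hx: "vcode x (h x)" if x: "x \<in> U" for x
  proof -
    obtain \<theta>0 where 0: "\<theta>0 \<in> U" "vcode x \<theta>0" using vcode_exists[OF x] by blast
    have "D1 (vcode x)" by (intro dfn x)
    then obtain \<theta> where \<theta>: "\<theta> \<in> U" "Od \<theta>" "vcode x \<theta>" "\<And>y. y \<in> U \<Longrightarrow> y \<epsilon> \<theta> \<Longrightarrow> \<not> vcode x y"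
      using Od_least[of "vcode x" \<theta>0] 0 vcode_Od by blast
    have "h x = \<theta>" unfolding h_def
    proof (rule The0_eq)
      show "R x \<theta>" using \<theta> unfolding R_def by blast
      show "z = \<theta>" if "z \<in> U" "R x z" for z
        using Od_linear[of z \<theta>] that \<theta> vcode_Od[of x z] unfolding R_def by blast
    qed (rule \<theta>)
    then show ?thesis using \<theta> by simp
  qed
  moreover have "inj_on h U"
    using hx vcode_inj by (metis inj_onI)
  ultimately show ?thesis using vcode_Od by blast
qed

end

theorem (in zf_model) ordinal_injection_if_HOD:
  assumes "models_ex_V_eq_HOD M"
  shows "(\<exists>h. F1 h \<and> (\<forall>x\<in>U. Od (h x)) \<and> inj_on h U) \<and> (\<exists>w\<in>U. is_omega M w)"
proof -
  obtain p where p: "p \<in> U" "V_eq_HOD M p" using assms unfolding models_ex_V_eq_HOD_def by blast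
  obtain \<alpha> where "definable_in_V M \<alpha> p p" using p unfolding V_eq_HOD_def by blast
  then obtain w F where wF: "w \<in> U" "F \<in> U" "is_omega M w" "is_formulas M w F"
    unfolding definable_in_V_def by blast
  interpret hod_model M p w F
    by unfold_locales (use p wF in auto)
  show ?thesis using ordinal_injection wF by blast
qed

section \<open>Definable filters\<close>

locale ordered_model = zf_model +
  fixes h :: "'a \<Rightarrow> 'a"
  assumes F1_h: "F1 h" and Od_h: "x \<in> U \<Longrightarrow> Od (h x)" and inj_h: "inj_on h U"
begin

definition lt :: "'a \<Rightarrow> 'a \<Rightarrow> bool" (infix "\<sqsubset>" 50) where "x \<sqsubset> y \<longleftrightarrow> h x \<epsilon> h y"
definition le :: "'a \<Rightarrow> 'a \<Rightarrow> bool" (infix "\<sqsubseteq>" 50) where "x \<sqsubseteq> y \<longleftrightarrow> x \<sqsubset> y \<or> x = y"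

lemma h_closed [simp]: "x \<in> U \<Longrightarrow> h x \<in> U"
  by (rule F1_closed[OF F1_h])

lemma Dfn_lt [dfn]: "Tm t \<Longrightarrow> Tm u \<Longrightarrow> Dfn (\<lambda>e. t e \<sqsubset> u e)"
  by (rule D2I[of lt]) (auto simp: lt_def intro!: dfn F1I[OF F1_h])

lemma Dfn_le [dfn]: "Tm t \<Longrightarrow> Tm u \<Longrightarrow> Dfn (\<lambda>e. t e \<sqsubseteq> u e)"
  unfolding le_def by (intro dfn)

lemma lt_irrefl: "x \<in> U \<Longrightarrow> \<not> x \<sqsubset> x"
  by (simp add: lt_def not_mem_self)

lemma lt_trans: "x \<in> U \<Longrightarrow> y \<in> U \<Longrightarrow> z \<in> U \<Longrightarrow> x \<sqsubset> y \<Longrightarrow> y \<sqsubset> z \<Longrightarrow> x \<sqsubset> z"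
  using Od_trans[of "h z" "h y" "h x"] Od_h[of z] by (simp add: lt_def)

lemma lt_linear: "x \<in> U \<Longrightarrow> y \<in> U \<Longrightarrow> x = y \<or> x \<sqsubset> y \<or> y \<sqsubset> x"
  using Od_linear[of "h x" "h y"] Od_h[of x] Od_h[of y] inj_onD[OF inj_h, of x y] by (auto simp: lt_def)

lemma not_lt: "x \<in> U \<Longrightarrow> y \<in> U \<Longrightarrow> \<not> x \<sqsubset> y \<longleftrightarrow> y \<sqsubseteq> x"
  using lt_linear[of x y] lt_irrefl[of x] lt_trans[of x y x] by (auto simp: le_def)

lemma not_le: "x \<in> U \<Longrightarrow> y \<in> U \<Longrightarrow> \<not> x \<sqsubseteq> y \<longleftrightarrow> y \<sqsubset> x"
  using not_lt[of y x] by blast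

lemma le_lt_trans: "x \<in> U \<Longrightarrow> y \<in> U \<Longrightarrow> z \<in> U \<Longrightarrow> x \<sqsubseteq> y \<Longrightarrow> y \<sqsubset> z \<Longrightarrow> x \<sqsubset> z"
  unfolding le_def using lt_trans by blast

lemma lt_le_trans: "x \<in> U \<Longrightarrow> y \<in> U \<Longrightarrow> z \<in> U \<Longrightarrow> x \<sqsubset> y \<Longrightarrow> y \<sqsubseteq> z \<Longrightarrow> x \<sqsubset> z"
  unfolding le_def using lt_trans by blast

lemma le_trans: "x \<in> U \<Longrightarrow> y \<in> U \<Longrightarrow> z \<in> U \<Longrightarrow> x \<sqsubseteq> y \<Longrightarrow> y \<sqsubseteq> z \<Longrightarrow> x \<sqsubseteq> z"
  unfolding le_def using lt_trans by blast

lemma lt_least: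
  assumes "D1 P" "x \<in> U" "P x"
  shows "\<exists>m\<in>U. P m \<and> (\<forall>y\<in>U. P y \<longrightarrow> \<not> y \<sqsubset> m)"
proof -
  have "D1 (\<lambda>\<theta>. \<exists>x\<in>U. h x = \<theta> \<and> P x)"
    by (intro dfn F1I[OF F1_h] D1I[OF assms(1)])
  then obtain \<theta> where \<theta>: "\<theta> \<in> U" "\<exists>x\<in>U. h x = \<theta> \<and> P x"
    "\<And>y. y \<in> U \<Longrightarrow> y \<epsilon> \<theta> \<Longrightarrow> \<not> (\<exists>x\<in>U. h x = y \<and> P x)"
    by (rule Od_least[where x = "h x"]) (use assms Od_h in auto)
  then obtain m where m: "m \<in> U" "h m = \<theta>" "P m" by blast
  have "\<not> y \<sqsubset> m" if "y \<in> U" "P y" for y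
    using \<theta>(3)[of "h y"] m that unfolding lt_def by auto
  then show ?thesis using m by blast
qed

text \<open>Replacement along the inverse of \<open>h\<close>, made total by the default of
  \<open>The0\<close>, since \<open>h\<close> need not be onto the ordinals.\<close>

lemma small_lt:
  assumes "x \<in> U" shows "small (\<lambda>y. y \<sqsubset> x)"
proof -
  let ?g = "\<lambda>\<theta>. The0 (\<lambda>y. h y = \<theta>)"
  have g: "F1 ?g" by (rule Tm_The0) (intro dfn F1I[OF F1_h])
  have gh: "?g (h y) = y" if "y \<in> U" for y
    by (rule The0_eq) (use that inj_onD[OF inj_h] in auto)
  show ?thesis
  proof (rule small_subset[OF small_image[OF small_mem[of "h x"] g]])
    show "\<exists>\<theta>\<in>U. \<theta> \<epsilon> h x \<and> y = ?g \<theta>" if "y \<in> U" "y \<sqsubset> x" for y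
      using that gh by (intro bexI[of _ "h y"]) (auto simp: lt_def)
  qed (use assms in \<open>auto intro!: dfn\<close>)
qed

lemma small_le: "x \<in> U \<Longrightarrow> small (\<lambda>y. y \<sqsubseteq> x)"
  unfolding le_def by (rule small_Un[OF small_lt small_single])

lemma lt_wo: "wo_class M (\<lambda>_. True) lt"
proof
  show "D1 (\<lambda>_. True)" by (intro dfn)
  show "D2 lt" by (intro dfn)
  show "\<exists>m\<in>U. True \<and> P m \<and> (\<forall>y\<in>U. True \<longrightarrow> P y \<longrightarrow> \<not> y \<sqsubset> m)" if "D1 P" "x \<in> U" "P x" for P x
    using lt_least[OF that] by simp
  show "small (\<lambda>y. True \<and> y \<sqsubset> x)" if "x \<in> U" for x using small_lt[OF that] by simp
qed (rule lt_trans lt_linear; assumption)+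

lemma lt_induct:
  assumes "D1 P" "x \<in> U" "\<And>x. x \<in> U \<Longrightarrow> (\<And>y. y \<in> U \<Longrightarrow> y \<sqsubset> x \<Longrightarrow> P y) \<Longrightarrow> P x"
  shows "P x"
  by (rule wo_class.wo_induct[OF lt_wo assms(1,2) TrueI]) (rule assms(3), blast+)

text \<open>Otherwise the initial segments up to the elements of \<open>P\<close> would cover the
  universe, and their union is a set. Together with \<open>small_le\<close> this makes sets and
  bounded definable classes the same thing.\<close>

lemma small_bounded:
  assumes "small P" shows "\<exists>b\<in>U. \<forall>x\<in>U. P x \<longrightarrow> x \<sqsubset> b"
proof (rule ccontr)
  assume *: "\<not> ?thesis"
  have 1: "small (\<lambda>y. \<exists>x\<in>U. P x \<and> y \<sqsubseteq> x)"
    by (rule small_UN[OF assms]) (auto intro!: dfn small_le)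
  have "\<exists>x\<in>U. P x \<and> y \<sqsubseteq> x" if "y \<in> U" for y
    using * that not_lt[of _ y] by blast
  then have "small (\<lambda>_. True)" by (intro small_iff[OF 1]) blast
  then show False using not_small_True by blast
qed

text \<open>The source of all definable Skolem functions; the value is \<open>emp\<close> if
  \<open>P\<close> has no element.\<close>

definition Lst :: "('a \<Rightarrow> bool) \<Rightarrow> 'a" where
  "Lst P = The0 (\<lambda>m. P m \<and> (\<forall>y\<in>U. P y \<longrightarrow> \<not> y \<sqsubset> m))"

lemma Lst_closed [simp]: "Lst P \<in> U"
  unfolding Lst_def by simp

lemma Tm_Lst:
  assumes "Dfn (\<lambda>e. R (\<lambda>i. e (Suc i)) (e 0))" shows "Tm (\<lambda>e. Lst (R e))"
proof -
  have 1: "Dfn (\<lambda>e. R (\<lambda>i. e (Suc (Suc i))) (e 0))"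
    using Dfn_subst[OF assms, of "case_nat 0 (\<lambda>j. Suc (Suc j))"] by simp
  show ?thesis unfolding Lst_def by (rule Tm_The0) (intro dfn assms 1)
qed

lemma Lst:
  assumes "D1 P" "x \<in> U" "P x" shows "P (Lst P)" "Lst P \<sqsubseteq> x"
proof -
  obtain m where m: "m \<in> U" "P m" "\<forall>y\<in>U. P y \<longrightarrow> \<not> y \<sqsubset> m" using lt_least[OF assms] by blast
  have "Lst P = m" unfolding Lst_def
  proof (rule The0_eq)
    show "z = m" if "z \<in> U" "P z \<and> (\<forall>y\<in>U. P y \<longrightarrow> \<not> y \<sqsubset> z)" for z
      using lt_linear[of z m] m that by blast
  qed (use m in auto)
  then show "P (Lst P)" "Lst P \<sqsubseteq> x" using m not_lt[of x m] assms by auto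
qed

text \<open>Kuratowski finiteness, so that no recursion on the natural numbers of \<open>M\<close> is needed.\<close>

definition Fin :: "'a \<Rightarrow> bool" where
  "Fin e \<longleftrightarrow> (\<forall>Q\<in>U. emp \<epsilon> Q \<longrightarrow> (\<forall>x\<in>U. \<forall>i\<in>U. x \<epsilon> Q \<longrightarrow> i \<epsilon> e \<longrightarrow> adj x i \<epsilon> Q) \<longrightarrow> e \<epsilon> Q)"

lemma Dfn_Fin [dfn]: "Tm t \<Longrightarrow> Dfn (\<lambda>e. Fin (t e))"
  by (rule D1I[of Fin]) (auto simp: Fin_def intro!: dfn)

lemma Fin_induct:
  assumes "D1 P" "Fin e" "e \<in> U" "P emp" "\<And>x i. x \<in> U \<Longrightarrow> i \<in> U \<Longrightarrow> i \<epsilon> e \<Longrightarrow> P x \<Longrightarrow> P (adj x i)"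
  shows "P e"
proof -
  obtain Q where Q: "Q \<in> U" "\<And>x. x \<in> U \<Longrightarrow> x \<epsilon> Q \<longleftrightarrow> x \<epsilon> Pw e \<and> P x"
    using separation[OF assms(1) Pw(1)[OF assms(3)]] by blast
  have "emp \<epsilon> Q" using Q assms by (simp add: is_subset_def)
  moreover have "adj x i \<epsilon> Q" if "x \<in> U" "i \<in> U" "x \<epsilon> Q" "i \<epsilon> e" for x i
    using Q that assms(3,5) by (auto simp: is_subset_def)
  ultimately have "e \<epsilon> Q" using assms(2) Q(1) unfolding Fin_def by blast
  then show ?thesis using Q assms by blast
qed

lemma Fin_emp: "Fin emp"
  unfolding Fin_def by blast

lemma Fin_adj: "Fin e \<Longrightarrow> e \<in> U \<Longrightarrow> i \<in> U \<Longrightarrow> Fin (adj e i)"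
  unfolding Fin_def by auto

lemma unn_adj: "a \<in> U \<Longrightarrow> b \<in> U \<Longrightarrow> i \<in> U \<Longrightarrow> unn a (adj b i) = adj (unn a b) i"
  by (rule extensionality) auto

lemma unn_emp: "a \<in> U \<Longrightarrow> unn a emp = a"
  by (rule extensionality) auto

lemma Fin_unn:
  assumes "Fin a" "Fin b" "a \<in> U" "b \<in> U" shows "Fin (unn a b)"
proof -
  show ?thesis
    by (rule Fin_induct[of "\<lambda>b. Fin (unn a b)"])
      (use assms in \<open>auto intro!: dfn Fin_adj simp: unn_emp unn_adj\<close>)
qed

lemma Fin_pairs:
  assumes "Fin a" "a \<in> U" "z \<in> U"
  shows "\<exists>b\<in>U. Fin b \<and> (\<forall>i\<in>U. i \<epsilon> a \<longrightarrow> pr i z \<epsilon> b)"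
proof (rule Fin_induct[of "\<lambda>a. \<exists>b\<in>U. Fin b \<and> (\<forall>i\<in>U. i \<epsilon> a \<longrightarrow> pr i z \<epsilon> b)"])
  fix x j assume xj: "x \<in> U" "j \<in> U" "\<exists>b\<in>U. Fin b \<and> (\<forall>i\<in>U. i \<epsilon> x \<longrightarrow> pr i z \<epsilon> b)"
  then obtain b where b: "b \<in> U" "Fin b" "\<forall>i\<in>U. i \<epsilon> x \<longrightarrow> pr i z \<epsilon> b" by blast
  then show "\<exists>b\<in>U. Fin b \<and> (\<forall>i\<in>U. i \<epsilon> adj x j \<longrightarrow> pr i z \<epsilon> b)"
    using xj assms by (intro bexI[of _ "adj b (pr j z)"]) (auto intro!: Fin_adj)
qed (use assms in \<open>auto intro!: dfn Fin_emp\<close>)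

text \<open>Carries the ultrafilter construction past limits: the finitely many relevant decisions
  made before \<open>a\<close> were all made at or before one stage \<open>m\<close> below
  \<open>a\<close>.\<close>

lemma Fin_max:
  assumes "Fin c" "c \<in> U" "a \<in> U" and ex: "\<exists>b\<in>U. b \<epsilon> c \<and> b \<sqsubset> a"
  shows "\<exists>m\<in>U. m \<sqsubset> a \<and> (\<forall>b\<in>U. b \<epsilon> c \<longrightarrow> b \<sqsubset> a \<longrightarrow> b \<sqsubseteq> m)"
proof -
  let ?P = "\<lambda>c. (\<exists>b\<in>U. b \<epsilon> c \<and> b \<sqsubset> a) \<longrightarrow> (\<exists>m\<in>U. m \<sqsubset> a \<and> (\<forall>b\<in>U. b \<epsilon> c \<longrightarrow> b \<sqsubset> a \<longrightarrow> b \<sqsubseteq> m))"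
  have "?P c"
  proof (rule Fin_induct[of ?P])
    show "D1 ?P" by (intro dfn assms)
    fix x i assume xi: "x \<in> U" "i \<in> U" and IH: "?P x"
    show "?P (adj x i)"
    proof
      assume "\<exists>b\<in>U. b \<epsilon> adj x i \<and> b \<sqsubset> a"
      show "\<exists>m\<in>U. m \<sqsubset> a \<and> (\<forall>b\<in>U. b \<epsilon> adj x i \<longrightarrow> b \<sqsubset> a \<longrightarrow> b \<sqsubseteq> m)"
      proof (cases "\<exists>b\<in>U. b \<epsilon> x \<and> b \<sqsubset> a")
        case True
        then obtain m where m: "m \<in> U" "m \<sqsubset> a" "\<forall>b\<in>U. b \<epsilon> x \<longrightarrow> b \<sqsubset> a \<longrightarrow> b \<sqsubseteq> m" using IH by blast
        show ?thesis
        proof (cases "i \<sqsubset> a \<and> m \<sqsubset> i")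
          case True
          have "b \<sqsubseteq> i" if "b \<in> U" "b \<epsilon> adj x i" "b \<sqsubset> a" for b
          proof (cases "b = i")
            case True
            then show ?thesis by (simp add: le_def)
          next
            case False
            then have "b \<sqsubseteq> m" using that m xi by auto
            then show ?thesis using True le_lt_trans[of b m i] that m xi True by (simp add: le_def)
          qed
          then show ?thesis using True xi by blast
        next
          case False
          have "b \<sqsubseteq> m" if "b \<in> U" "b \<epsilon> adj x i" "b \<sqsubset> a" for b
            using that m xi False not_lt[of m i] by auto
          then show ?thesis using m by blast
        qed
      next
        case False
        then have "\<forall>b\<in>U. b \<epsilon> adj x i \<longrightarrow> b \<sqsubset> a \<longrightarrow> b = i" using xi by auto
        then show ?thesis using \<open>\<exists>b\<in>U. b \<epsilon> adj x i \<and> b \<sqsubset> a\<close> by (auto simp: le_def)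
      qed
    qed
  qed (use assms in auto)
  then show ?thesis using ex by blast
qed

text \<open>A relation \<open>B\<close> stands for the family of the classes \<open>{x. B i x}\<close>; as a filter base it is
  closed only under internally finite intersections.\<close>

definition FIP :: "('a \<Rightarrow> 'a \<Rightarrow> bool) \<Rightarrow> bool" where
  "FIP B \<longleftrightarrow> (\<forall>e\<in>U. Fin e \<longrightarrow> (\<exists>x\<in>U. \<forall>i\<in>U. i \<epsilon> e \<longrightarrow> B i x))"

text \<open>The transfinite induction of the ultrafilter lemma: decide \<open>\<phi> a\<close> positively whenever this is
  consistent with \<open>B\<close> and the decisions made before.\<close>

lemma ultrafilter_step:
  assumes B: "D2 B" and \<phi>: "D2 \<phi>" and "FIP B"
  shows "\<exists>A. D1 A \<and> FIP (\<lambda>i x. B i x \<and> (\<phi> i x \<longleftrightarrow> A i))"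
proof -
  define ok where "ok e1 e2 a g x \<longleftrightarrow> (\<forall>i\<in>U. i \<epsilon> e1 \<longrightarrow> B i x) \<and>
    (\<forall>b\<in>U. b \<epsilon> e2 \<longrightarrow> b \<sqsubset> a \<longrightarrow> (\<phi> b x \<longleftrightarrow> b \<epsilon> g))" for e1 e2 a g x
  define \<Psi> where "\<Psi> g a \<longleftrightarrow> (\<forall>e1\<in>U. \<forall>e2\<in>U. Fin e1 \<longrightarrow> Fin e2 \<longrightarrow> (\<exists>x\<in>U. ok e1 e2 a g x \<and> \<phi> a x))" for g a
  have "D2 \<Psi>" unfolding \<Psi>_def ok_def by (intro dfn D2I[OF B] D2I[OF \<phi>])
  from wo_class.set_recursion[OF lt_wo this] obtain A where DA: "D1 A"
    and A: "\<And>x. x \<in> U \<Longrightarrow> small (\<lambda>y. (True \<and> y \<sqsubset> x) \<and> A y)"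
      "\<And>x. x \<in> U \<Longrightarrow> A x \<longleftrightarrow> \<Psi> (SetOf (\<lambda>y. (True \<and> y \<sqsubset> x) \<and> A y)) x" by blast
  define gg where "gg a = SetOf (\<lambda>y. (True \<and> y \<sqsubset> a) \<and> A y)" for a
  have gg: "b \<epsilon> gg a \<longleftrightarrow> A b" if "b \<sqsubset> a" "a \<in> U" "b \<in> U" for a b
    unfolding gg_def using mem_SetOf[OF A(1)[OF that(2)] that(3)] that(1) by simp
  have A': "A a \<longleftrightarrow> \<Psi> (gg a) a" if "a \<in> U" for a unfolding gg_def by (rule A(2)[OF that])
  \<comment> \<open>\<open>below\<close> and \<open>upto\<close> consult the finished class
    \<open>A\<close> instead of the set \<open>g\<close> of earlier decisions, so the invariant
    \<open>?P\<close> is a definable statement about \<open>A\<close> and can be proved by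
    induction.\<close>
  define below where "below a e1 e2 x \<longleftrightarrow> (\<forall>i\<in>U. i \<epsilon> e1 \<longrightarrow> B i x) \<and>
    (\<forall>b\<in>U. b \<epsilon> e2 \<longrightarrow> b \<sqsubset> a \<longrightarrow> (\<phi> b x \<longleftrightarrow> A b))" for a e1 e2 x
  define upto where "upto a e1 e2 x \<longleftrightarrow> (\<forall>i\<in>U. i \<epsilon> e1 \<longrightarrow> B i x) \<and>
    (\<forall>b\<in>U. b \<epsilon> e2 \<longrightarrow> b \<sqsubseteq> a \<longrightarrow> (\<phi> b x \<longleftrightarrow> A b))" for a e1 e2 x
  have ok_below: "ok e1 e2 a (gg a) x \<longleftrightarrow> below a e1 e2 x" if "a \<in> U" for a e1 e2 x
    unfolding ok_def below_def using gg that by blast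
  let ?P = "\<lambda>a. \<forall>e1\<in>U. \<forall>e2\<in>U. Fin e1 \<longrightarrow> Fin e2 \<longrightarrow> (\<exists>x\<in>U. upto a e1 e2 x)"
  have main: "?P a" if "a \<in> U" for a
  proof (rule lt_induct[of ?P])
    show "D1 ?P" unfolding upto_def by (intro dfn D2I[OF B] D2I[OF \<phi>] D1I[OF DA])
    fix a assume a: "a \<in> U" and IH: "\<And>b. b \<in> U \<Longrightarrow> b \<sqsubset> a \<Longrightarrow> ?P b"
    \<comment> \<open>Successors and limits are treated alike: the indices of \<open>e2\<close>
      below \<open>a\<close> are bounded by some \<open>m\<close> below \<open>a\<close>, where the
      induction hypothesis applies. If there are no such indices, \<open>FIP B\<close>
      suffices.\<close>
    have bel: "\<exists>x\<in>U. below a e1 e2 x" if e: "e1 \<in> U" "e2 \<in> U" "Fin e1" "Fin e2" for e1 e2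
    proof (cases "\<exists>b\<in>U. b \<epsilon> e2 \<and> b \<sqsubset> a")
      case True
      then obtain m where m: "m \<in> U" "m \<sqsubset> a" "\<forall>b\<in>U. b \<epsilon> e2 \<longrightarrow> b \<sqsubset> a \<longrightarrow> b \<sqsubseteq> m"
        using Fin_max[OF e(4,2) a] by blast
      obtain x where "x \<in> U" "upto m e1 e2 x" using IH[OF m(1,2)] e by blast
      then show ?thesis using m unfolding below_def upto_def by blast
    next
      case False
      obtain x where "x \<in> U" "\<forall>i\<in>U. i \<epsilon> e1 \<longrightarrow> B i x" using \<open>FIP B\<close> e unfolding FIP_def by blast
      then show ?thesis using False unfolding below_def by blast
    qed
    show "?P a"
    proof (intro ballI impI)
      fix e1 e2 assume e: "e1 \<in> U" "e2 \<in> U" "Fin e1" "Fin e2"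
      have split: "upto a e1 e2 x" if "below a e1 e2 x" "\<phi> a x \<longleftrightarrow> A a" for x
        using that unfolding upto_def below_def le_def by blast
      show "\<exists>x\<in>U. upto a e1 e2 x"
      proof (cases "A a")
        case True
        then have "\<Psi> (gg a) a" using A' a by blast
        then obtain x where "x \<in> U" "ok e1 e2 a (gg a) x" "\<phi> a x" using e unfolding \<Psi>_def by blast
        then show ?thesis using split ok_below[OF a] True by blast
      next
        case False
        \<comment> \<open>A rejection has finite reasons \<open>d1\<close> and \<open>d2\<close>. A
          point that satisfies these together with the given conditions must violate
          \<open>\<phi> a\<close>, as the decision demands.\<close>
        then have "\<not> \<Psi> (gg a) a" using A' a by blast
        then obtain d1 d2 where d: "d1 \<in> U" "d2 \<in> U" "Fin d1" "Fin d2"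
          "\<And>x. x \<in> U \<Longrightarrow> \<not> (below a d1 d2 x \<and> \<phi> a x)"
          unfolding \<Psi>_def using ok_below[OF a] by blast
        obtain x where x: "x \<in> U" "below a (unn e1 d1) (unn e2 d2) x"
          using bel[of "unn e1 d1" "unn e2 d2"] d e Fin_unn by auto
        have "below a e1 e2 x" "below a d1 d2 x"
          using x(2) e d unfolding below_def by auto
        then show ?thesis using split[of x] d(5)[OF x(1)] False x(1) by blast
      qed
    qed
  qed (rule that)
  have "FIP (\<lambda>i x. B i x \<and> (\<phi> i x \<longleftrightarrow> A i))" unfolding FIP_def
  proof (intro ballI impI)
    fix e assume e: "e \<in> U" "Fin e"
    obtain b where b: "b \<in> U" "\<forall>x\<in>U. x \<epsilon> e \<longrightarrow> x \<sqsubset> b" using small_bounded[OF small_mem[OF e(1)]] by blast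
    obtain x where "x \<in> U" "upto b e e x" using main[OF b(1)] e by blast
    then show "\<exists>x\<in>U. \<forall>i\<in>U. i \<epsilon> e \<longrightarrow> B i x \<and> (\<phi> i x \<longleftrightarrow> A i)"
      using b unfolding upto_def le_def by blast
  qed
  then show ?thesis using DA by blast
qed

text \<open>\<open>E\<close> is defined by recursion along \<open>\<sqsubset>\<close> and serves every element \<open>a\<close> once: a large enough pair
  \<open>pr a \<xi>\<close> is admitted if \<open>a\<close> is the least element not served before.\<close>

lemma sparse_class:
  assumes S: "F1 S"
  shows "\<exists>E. D1 E \<and> (\<forall>x\<in>U. \<forall>y\<in>U. E x \<longrightarrow> E y \<longrightarrow> x \<sqsubset> y \<longrightarrow> S x \<sqsubseteq> y) \<and>
    (\<forall>a\<in>U. \<exists>x\<in>U. E x \<and> pfst x = a \<and> psnd a \<sqsubset> x)"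
proof -
  define \<Psi> where "\<Psi> g x \<longleftrightarrow> (\<exists>a\<in>U. \<exists>\<xi>\<in>U. x = pr a \<xi> \<and> psnd a \<sqsubset> x \<and>
     (\<forall>y\<in>U. y \<epsilon> g \<longrightarrow> S y \<sqsubseteq> x \<and> pfst y \<noteq> a) \<and> (\<forall>a'\<in>U. a' \<sqsubset> a \<longrightarrow> (\<exists>y\<in>U. y \<epsilon> g \<and> pfst y = a')))" for g x
  have "D2 \<Psi>" unfolding \<Psi>_def by (intro dfn F1I[OF S])
  from wo_class.set_recursion[OF lt_wo this] obtain E where DE: "D1 E"
    and E: "\<And>x. x \<in> U \<Longrightarrow> small (\<lambda>y. (True \<and> y \<sqsubset> x) \<and> E y)"
      "\<And>x. x \<in> U \<Longrightarrow> E x \<longleftrightarrow> \<Psi> (SetOf (\<lambda>y. (True \<and> y \<sqsubset> x) \<and> E y)) x" by blast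
  define below where "below x = SetOf (\<lambda>y. (True \<and> y \<sqsubset> x) \<and> E y)" for x
  have below: "y \<epsilon> below x \<longleftrightarrow> y \<sqsubset> x \<and> E y" if "x \<in> U" "y \<in> U" for x y
    unfolding below_def using mem_SetOf[OF E(1)[OF that(1)] that(2)] by simp
  have E': "E x \<longleftrightarrow> (\<exists>a\<in>U. \<exists>\<xi>\<in>U. x = pr a \<xi> \<and> psnd a \<sqsubset> x \<and>
     (\<forall>y\<in>U. y \<sqsubset> x \<and> E y \<longrightarrow> S y \<sqsubseteq> x \<and> pfst y \<noteq> a) \<and>
     (\<forall>a'\<in>U. a' \<sqsubset> a \<longrightarrow> (\<exists>y\<in>U. (y \<sqsubset> x \<and> E y) \<and> pfst y = a')))" if "x \<in> U" for x
    using E(2)[OF that, folded below_def] unfolding \<Psi>_def by (simp add: below that cong: bex_cong ball_cong)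
  have SU [simp]: "S x \<in> U" if "x \<in> U" for x using F1_closed[OF S that] .
  have served: "\<exists>x\<in>U. E x \<and> pfst x = a" if "a \<in> U" for a
  proof (rule lt_induct[of "\<lambda>a. \<exists>x\<in>U. E x \<and> pfst x = a"])
    show "D1 (\<lambda>a. \<exists>x\<in>U. E x \<and> pfst x = a)" by (intro dfn D1I[OF DE])
    fix a assume a: "a \<in> U" and IH: "\<And>b. b \<in> U \<Longrightarrow> b \<sqsubset> a \<Longrightarrow> \<exists>x\<in>U. E x \<and> pfst x = b"
    show "\<exists>x\<in>U. E x \<and> pfst x = a"
    proof (rule ccontr)
      assume no: "\<not> ?thesis"
      \<comment> \<open>The first element of \<open>E\<close> that serves \<open>b\<close>. By
        replacement all these elements, for \<open>b\<close> below \<open>a\<close>, lie under a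
        common bound \<open>c\<close>.\<close>
      define k where "k b = Lst (\<lambda>x. E x \<and> pfst x = b)" for b
      have Fk: "F1 k" unfolding k_def by (rule Tm_Lst) (intro dfn D1I[OF DE])
      have k: "E (k b)" "pfst (k b) = b" "k b \<in> U" if b: "b \<in> U" "b \<sqsubset> a" for b
      proof -
        obtain x where x: "x \<in> U" "E x \<and> pfst x = b" using IH[OF b] by blast
        have "D1 (\<lambda>x. E x \<and> pfst x = b)" by (intro dfn D1I[OF DE] b)
        from Lst(1)[OF this x] show "E (k b)" "pfst (k b) = b" unfolding k_def by auto
        show "k b \<in> U" unfolding k_def by simp
      qed
      obtain c where c: "c \<in> U" "\<forall>x\<in>U. (\<exists>b\<in>U. b \<sqsubset> a \<and> x = k b) \<longrightarrow> x \<sqsubset> c"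
        using small_bounded[OF small_image[OF small_lt[OF a] Fk]] by blast
      have kc: "k b \<sqsubset> c" if "b \<in> U" "b \<sqsubset> a" for b using c(2) k[OF that] that by blast
      \<comment> \<open>Beyond \<open>c\<close> every element below \<open>a\<close> has been served
        already, and serving an element above \<open>a\<close> presupposes that \<open>a\<close> was
        served. With \<open>a\<close> unserved, \<open>E\<close> cannot go beyond
        \<open>c\<close>.\<close>
      have Ec: "x \<sqsubset> c" if x: "x \<in> U" "E x" for x
      proof (rule ccontr)
        assume "\<not> x \<sqsubset> c"
        then have cx: "c \<sqsubseteq> x" using not_lt x c by blast
        obtain b \<xi> where b: "b \<in> U" "\<xi> \<in> U" "x = pr b \<xi>"
          "\<forall>y\<in>U. y \<sqsubset> x \<and> E y \<longrightarrow> S y \<sqsubseteq> x \<and> pfst y \<noteq> b"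
          "\<forall>a'\<in>U. a' \<sqsubset> b \<longrightarrow> (\<exists>y\<in>U. (y \<sqsubset> x \<and> E y) \<and> pfst y = a')"
          using E'[OF x(1)] x(2) by blast
        have "b \<noteq> a" using no x b by auto
        moreover have "\<not> a \<sqsubset> b" using b(5) no a by blast
        ultimately have "b \<sqsubset> a" using lt_linear[OF a b(1)] by blast
        from k[OF b(1) this] kc[OF b(1) this] have "k b \<sqsubset> x" "E (k b)" "pfst (k b) = b"
          using lt_le_trans[of "k b" c x] cx c x by auto
        then show False using b(4) k(3)[OF b(1) \<open>b \<sqsubset> a\<close>] by blast
      qed
      obtain d where d: "d \<in> U" "\<forall>x\<in>U. (\<exists>y\<in>U. y \<sqsubset> c \<and> x = S y) \<longrightarrow> x \<sqsubset> d"
        using small_bounded[OF small_image[OF small_lt[OF c(1)] S]] by blast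
      obtain u where u: "u \<in> U" "\<forall>x\<in>U. (x = d \<or> x = c) \<or> x = psnd a \<longrightarrow> x \<sqsubset> u"
        using small_bounded[OF small_Un[OF small_upair[OF d(1) c(1)] small_single[OF psnd_closed]]] by blast
      \<comment> \<open>The pairs with first component \<open>a\<close> form a proper class, so they
        cannot all stay below \<open>u\<close>.\<close>
      have "\<exists>\<xi>\<in>U. u \<sqsubseteq> pr a \<xi>"
      proof (rule ccontr)
        assume "\<not> ?thesis"
        then have lt: "pr a \<xi> \<sqsubset> u" if "\<xi> \<in> U" for \<xi> using not_lt[of "pr a \<xi>" u] a u that by auto
        have "small (\<lambda>y. \<exists>x\<in>U. x \<sqsubset> u \<and> y = psnd x)"
          by (rule small_image[OF small_lt[OF u(1)]]) (intro dfn)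
        then have "small (\<lambda>_. True)"
        proof (rule small_iff)
          fix \<xi> assume "\<xi> \<in> U"
          then show "(\<exists>x\<in>U. x \<sqsubset> u \<and> \<xi> = psnd x) \<longleftrightarrow> True"
            using lt a by (auto intro!: bexI[of _ "pr a \<xi>"])
        qed
        then show False using not_small_True by blast
      qed
      then obtain \<xi> where \<xi>: "\<xi> \<in> U" "u \<sqsubseteq> pr a \<xi>" by blast
      let ?x = "pr a \<xi>"
      have x: "?x \<in> U" using a \<xi> by simp
      have big: "z \<sqsubset> ?x" if "z \<in> U" "z \<sqsubset> u" for z
        using lt_le_trans[OF that(1) u(1) x that(2) \<xi>(2)] .
      have "c \<sqsubset> ?x" "d \<sqsubset> ?x" "psnd a \<sqsubset> ?x" using big u c d by auto
      have "E ?x"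
      proof (rule E'[OF x, THEN iffD2], rule bexI[OF _ a], rule bexI[OF _ \<xi>(1)], intro conjI ballI impI)
        fix y assume y: "y \<in> U" "y \<sqsubset> ?x \<and> E y"
        then have "S y \<sqsubset> d" using Ec[of y] d(2) by auto
        then show "S y \<sqsubseteq> ?x" using lt_trans[OF _ d(1) x _ \<open>d \<sqsubset> ?x\<close>] y by (simp add: le_def)
        show "pfst y \<noteq> a" using no y by blast
      next
        fix b assume b: "b \<in> U" "b \<sqsubset> a"
        have "k b \<sqsubset> ?x" using lt_trans[OF k(3)[OF b] c(1) x kc[OF b] \<open>c \<sqsubset> ?x\<close>] .
        then show "\<exists>y\<in>U. (y \<sqsubset> ?x \<and> E y) \<and> pfst y = b" using k[OF b] by blast
      qed (use \<open>psnd a \<sqsubset> ?x\<close> in auto)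
      then show False using no x a \<xi> by (auto intro!: bexI[of _ ?x])
    qed
  qed (rule that)
  have "S x \<sqsubseteq> y" if "x \<in> U" "y \<in> U" "E x" "E y" "x \<sqsubset> y" for x y
    using E'[OF that(2)] that by blast
  moreover have "psnd a \<sqsubset> x" if "a \<in> U" "x \<in> U" "E x" "pfst x = a" for a x
    using E'[OF that(2)] that by auto
  ultimately show ?thesis using DE served by blast
qed

text \<open>In the notation of the introduction, \<open>B\<close> is the filter base for \<open>c\<^sub>n\<close>, and \<open>\<sigma>\<close> expresses \<open>c\<close>
  by \<open>c\<^sub>n\<close>; \<open>B2\<close> refines \<open>B\<close> by the decisions about \<open>D\<close> and \<open>f\<close>, and \<open>B'\<close> is the base for \<open>c\<^sub>n\<^sub>+\<^sub>1\<close>, where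
  \<open>c\<^sub>n = s c\<^sub>n\<^sub>+\<^sub>1\<close>. An element \<open>z\<close> of \<open>E\<close> has the form \<open>pr (pr e b) \<xi>\<close>, where \<open>e\<close> is its finite set of
  requirements.\<close>

lemma stage:
  fixes \<sigma> :: "'a \<Rightarrow> 'a" and B D :: "'a \<Rightarrow> 'a \<Rightarrow> bool"
  defines "f \<equiv> \<lambda>a x. Lst (\<lambda>y. D a (pr x y))"
  assumes \<sigma>: "F1 \<sigma>" and B: "D2 B" "FIP B" and D: "D2 D"
  shows "\<exists>B2 A s E B'. D2 B2 \<and> FIP B2 \<and> (\<forall>i\<in>U. \<forall>x\<in>U. B2 i x \<longrightarrow> B i x) \<and>
    D1 A \<and> (\<forall>i\<in>U. \<forall>x\<in>U. B2 i x \<longrightarrow> (D i (\<sigma> x) \<longleftrightarrow> A i)) \<and> F1 s \<and> D1 E \<and> D2 B' \<and> FIP B' \<and>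
    (\<forall>i\<in>U. \<forall>z\<in>U. B' i z \<longrightarrow> E z \<and> i \<sqsubset> z \<and> B2 i (s z)) \<and>
    (\<forall>a\<in>U. (\<exists>b\<in>U. \<forall>x\<in>U. B2 (pr a b) x \<longrightarrow> f a (\<sigma> x) \<sqsubseteq> b) \<or>
       (\<forall>z\<in>U. B' a z \<longrightarrow> z \<sqsubset> f a (\<sigma> (s z)))) \<and>
    (\<forall>z\<in>U. \<forall>z'\<in>U. \<forall>a\<in>U. E z \<longrightarrow> E z' \<longrightarrow> z \<sqsubset> z' \<longrightarrow> a \<sqsubset> z \<longrightarrow> f a (\<sigma> (s z)) \<sqsubset> z')"
proof -
  have Tf: "Tm t \<Longrightarrow> Tm u \<Longrightarrow> Tm (\<lambda>e. f (t e) (u e))" for t u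
    by (rule F2I[of f]) (auto simp: f_def intro!: dfn D2I[OF D] Tm_Lst)
  have fU [simp]: "f a x \<in> U" for a x unfolding f_def by simp
  have "D2 (\<lambda>i x. D i (\<sigma> x))" by (intro dfn D2I[OF D] F1I[OF \<sigma>])
  from ultrafilter_step[OF B(1) this B(2)] obtain A where A: "D1 A"
    and fip1: "FIP (\<lambda>i x. B i x \<and> (D i (\<sigma> x) \<longleftrightarrow> A i))" by blast
  have 1: "D2 (\<lambda>i x. B i x \<and> (D i (\<sigma> x) \<longleftrightarrow> A i))"
    by (intro dfn D2I[OF B(1)] D2I[OF D] F1I[OF \<sigma>] D1I[OF A])
  \<comment> \<open>The second round reads an index as a pair of a parameter and a proposed bound
    for the function with this parameter.\<close>
  have 2: "D2 (\<lambda>i x. f (pfst i) (\<sigma> x) \<sqsubseteq> psnd i)" by (intro dfn Tf F1I[OF \<sigma>])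
  from ultrafilter_step[OF 1 2 fip1] obtain A2 where A2: "D1 A2"
    and fip2: "FIP (\<lambda>i x. (B i x \<and> (D i (\<sigma> x) \<longleftrightarrow> A i)) \<and> (f (pfst i) (\<sigma> x) \<sqsubseteq> psnd i \<longleftrightarrow> A2 i))" by blast
  define B2 where "B2 i x \<longleftrightarrow> (B i x \<and> (D i (\<sigma> x) \<longleftrightarrow> A i)) \<and> (f (pfst i) (\<sigma> x) \<sqsubseteq> psnd i \<longleftrightarrow> A2 i)" for i x
  have DB2: "D2 B2" unfolding B2_def by (intro dfn D2I[OF 1] D2I[OF 2] D1I[OF A2])
  have fip: "FIP B2" using fip2 unfolding B2_def .
  define inE where "inE i z \<longleftrightarrow> Fin (pfst (pfst z)) \<and> i \<epsilon> pfst (pfst z)" for i z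
  have DinE: "D2 inE" unfolding inE_def by (intro dfn)
  \<comment> \<open>Each requirement \<open>i\<close> of \<open>z\<close> also demands
    \<open>B2 (pr i z)\<close>, the decision on whether \<open>z\<close> bounds the function with
    parameter \<open>i\<close>. If that function was found to be unbounded, this pushes its value
    above \<open>z\<close>. If \<open>pfst (pfst z)\<close> is not finite, there are no requirements
    and the value is the least element of the universe.\<close>
  define s where "s z = Lst (\<lambda>y. \<forall>i\<in>U. inE i z \<longrightarrow> B2 i y \<and> B2 (pr i z) y)" for z
  have Fs: "F1 s" unfolding s_def by (rule Tm_Lst) (intro dfn D2I[OF DinE] D2I[OF DB2])
  have sU [simp]: "s z \<in> U" for z unfolding s_def by simp
  have s: "B2 i (s z) \<and> B2 (pr i z) (s z)" if z: "z \<in> U" "i \<in> U" "inE i z" for i z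
  proof -
    let ?e = "pfst (pfst z)"
    have e: "Fin ?e" "?e \<in> U" using z unfolding inE_def by auto
    obtain b where b: "b \<in> U" "Fin b" "\<forall>i\<in>U. i \<epsilon> ?e \<longrightarrow> pr i z \<epsilon> b" using Fin_pairs[OF e z(1)] by blast
    have "Fin (unn ?e b)" "unn ?e b \<in> U" using Fin_unn e b by auto
    then obtain y where y: "y \<in> U" "\<forall>i\<in>U. i \<epsilon> unn ?e b \<longrightarrow> B2 i y" using fip unfolding FIP_def by blast
    have "\<forall>i\<in>U. inE i z \<longrightarrow> B2 i y \<and> B2 (pr i z) y"
      using y(2) b e z unfolding inE_def by auto
    moreover have "D1 (\<lambda>y. \<forall>i\<in>U. inE i z \<longrightarrow> B2 i y \<and> B2 (pr i z) y)"
      by (intro dfn D2I[OF DinE] D2I[OF DB2] z)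
    ultimately have "\<forall>i\<in>U. inE i z \<longrightarrow> B2 i (s z) \<and> B2 (pr i z) (s z)"
      using Lst(1)[of "\<lambda>y. \<forall>i\<in>U. inE i z \<longrightarrow> B2 i y \<and> B2 (pr i z) y" y] y(1) unfolding s_def by blast
    then show ?thesis using z by blast
  qed
  \<comment> \<open>The gap to be left after \<open>z\<close>: a strict bound for the values at
    \<open>s z\<close> of all functions with parameters below \<open>z\<close>.\<close>
  define S where "S z = Lst (\<lambda>u. \<forall>a\<in>U. a \<sqsubset> z \<longrightarrow> f a (\<sigma> (s z)) \<sqsubset> u)" for z
  have FS: "F1 S" unfolding S_def by (rule Tm_Lst) (intro dfn Tf F1I[OF \<sigma>] F1I[OF Fs])
  have S: "f a (\<sigma> (s z)) \<sqsubset> S z" if "a \<in> U" "z \<in> U" "a \<sqsubset> z" for a z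
  proof -
    have "F1 (\<lambda>a. f a (\<sigma> (s z)))" by (intro Tf F1I[OF \<sigma>] F1I[OF Fs] dfn that)
    from small_bounded[OF small_image[OF small_lt[OF that(2)] this]]
    obtain u where u: "u \<in> U" "\<forall>x\<in>U. (\<exists>a\<in>U. a \<sqsubset> z \<and> x = f a (\<sigma> (s z))) \<longrightarrow> x \<sqsubset> u" by blast
    then have "\<forall>a\<in>U. a \<sqsubset> z \<longrightarrow> f a (\<sigma> (s z)) \<sqsubset> u" using fU by blast
    moreover have "D1 (\<lambda>u. \<forall>a\<in>U. a \<sqsubset> z \<longrightarrow> f a (\<sigma> (s z)) \<sqsubset> u)"
      by (intro dfn Tf F1I[OF \<sigma>] F1I[OF Fs] that)
    ultimately show ?thesis
      using Lst(1)[of "\<lambda>u. \<forall>a\<in>U. a \<sqsubset> z \<longrightarrow> f a (\<sigma> (s z)) \<sqsubset> u" u] u(1) that unfolding S_def by blast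
  qed
  obtain E where E: "D1 E" "\<forall>x\<in>U. \<forall>y\<in>U. E x \<longrightarrow> E y \<longrightarrow> x \<sqsubset> y \<longrightarrow> S x \<sqsubseteq> y"
    "\<forall>a\<in>U. \<exists>x\<in>U. E x \<and> pfst x = a \<and> psnd a \<sqsubset> x" using sparse_class[OF FS] by blast
  define B' where "B' i z \<longleftrightarrow> E z \<and> inE i z \<and> i \<sqsubset> z" for i z
  have DB': "D2 B'" unfolding B'_def by (intro dfn D1I[OF E(1)] D2I[OF DinE])
  have fip': "FIP B'" unfolding FIP_def
  proof (intro ballI impI)
    fix e assume e: "e \<in> U" "Fin e"
    obtain b where b: "b \<in> U" "\<forall>x\<in>U. x \<epsilon> e \<longrightarrow> x \<sqsubset> b" using small_bounded[OF small_mem[OF e(1)]] by blast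
    \<comment> \<open>The element that serves \<open>pr e b\<close> has exactly \<open>e\<close> as
      its set of requirements. Being above \<open>b\<close>, it is also above every member of
      \<open>e\<close>.\<close>
    obtain x where x: "x \<in> U" "E x" "pfst x = pr e b" "psnd (pr e b) \<sqsubset> x" using bspec[OF E(3) pr_closed[OF e(1) b(1)]] by blast
    have "b \<sqsubset> x" using x(4) e b by simp
    have "B' i x" if "i \<in> U" "i \<epsilon> e" for i
      unfolding B'_def inE_def using x e b that lt_trans[of i b x] \<open>b \<sqsubset> x\<close> by simp
    then show "\<exists>x\<in>U. \<forall>i\<in>U. i \<epsilon> e \<longrightarrow> B' i x" using x(1) by blast
  qed
  have dich: "(\<exists>b\<in>U. \<forall>x\<in>U. B2 (pr a b) x \<longrightarrow> f a (\<sigma> x) \<sqsubseteq> b) \<or>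
       (\<forall>z\<in>U. B' a z \<longrightarrow> z \<sqsubset> f a (\<sigma> (s z)))" if a: "a \<in> U" for a
  \<comment> \<open>If some bound was accepted, the function is bounded. Otherwise all bounds were
    rejected, in particular the bound \<open>z\<close> that is put to the test by
    \<open>B2 (pr a z)\<close>.\<close>
  proof (cases "\<exists>b\<in>U. A2 (pr a b)")
    case True
    then show ?thesis using a unfolding B2_def by auto
  next
    case False
    have "z \<sqsubset> f a (\<sigma> (s z))" if z: "z \<in> U" "B' a z" for z
    proof -
      have "B2 (pr a z) (s z)" using s[OF z(1) a] z unfolding B'_def by blast
      then have "\<not> f a (\<sigma> (s z)) \<sqsubseteq> z" using False z a unfolding B2_def by auto
      then show ?thesis using not_le[OF fU z(1)] by blast
    qed
    then show ?thesis by blast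
  qed
  have gap: "f a (\<sigma> (s z)) \<sqsubset> z'" if "z \<in> U" "z' \<in> U" "a \<in> U" "E z" "E z'" "z \<sqsubset> z'" "a \<sqsubset> z" for z z' a
    using lt_le_trans[OF fU F1_closed[OF FS that(1)] that(2) S[OF that(3,1,7)]] E(2) that by blast
  have B': "E z \<and> i \<sqsubset> z \<and> B2 i (s z)" if "i \<in> U" "z \<in> U" "B' i z" for i z
    using s[OF that(2,1)] that unfolding B'_def by blast
  have B2: "B2 i x \<Longrightarrow> B i x" "B2 i x \<Longrightarrow> (D i (\<sigma> x) \<longleftrightarrow> A i)" for i x unfolding B2_def by blast+
  show ?thesis
  proof (rule exI[of _ B2], rule exI[of _ A], rule exI[of _ s], rule exI[of _ E], rule exI[of _ B'], intro conjI)
    show "\<forall>i\<in>U. \<forall>x\<in>U. B2 i x \<longrightarrow> B i x" "\<forall>i\<in>U. \<forall>x\<in>U. B2 i x \<longrightarrow> (D i (\<sigma> x) \<longleftrightarrow> A i)"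
      using B2 by blast+
    show "\<forall>i\<in>U. \<forall>z\<in>U. B' i z \<longrightarrow> E z \<and> i \<sqsubset> z \<and> B2 i (s z)" using B' by blast
    show "\<forall>a\<in>U. (\<exists>b\<in>U. \<forall>x\<in>U. B2 (pr a b) x \<longrightarrow> f a (\<sigma> x) \<sqsubseteq> b) \<or>
       (\<forall>z\<in>U. B' a z \<longrightarrow> z \<sqsubset> f a (\<sigma> (s z)))" using dich by blast
    show "\<forall>z\<in>U. \<forall>z'\<in>U. \<forall>a\<in>U. E z \<longrightarrow> E z' \<longrightarrow> z \<sqsubset> z' \<longrightarrow> a \<sqsubset> z \<longrightarrow> f a (\<sigma> (s z)) \<sqsubset> z'"
      using gap by blast
  qed (fact DB2 fip A Fs E(1) DB' fip')+
qed

end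

section \<open>The ultrafilter\<close>

instance fm :: countable
  by countable_datatype

definition (in ordered_model) stage_rel where
  "stage_rel D \<sigma> B B2 A s E B' \<longleftrightarrow> D2 B2 \<and> FIP B2 \<and> (\<forall>i\<in>U. \<forall>x\<in>U. B2 i x \<longrightarrow> B i x) \<and>
    D1 A \<and> (\<forall>i\<in>U. \<forall>x\<in>U. B2 i x \<longrightarrow> (D i (\<sigma> x) \<longleftrightarrow> A i)) \<and> F1 s \<and> D1 E \<and> D2 B' \<and> FIP B' \<and>
    (\<forall>i\<in>U. \<forall>z\<in>U. B' i z \<longrightarrow> E z \<and> i \<sqsubset> z \<and> B2 i (s z)) \<and>
    (\<forall>a\<in>U. (\<exists>b\<in>U. \<forall>x\<in>U. B2 (pr a b) x \<longrightarrow> Lst (\<lambda>y. D a (pr (\<sigma> x) y)) \<sqsubseteq> b) \<or>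
       (\<forall>z\<in>U. B' a z \<longrightarrow> z \<sqsubset> Lst (\<lambda>y. D a (pr (\<sigma> (s z)) y)))) \<and>
    (\<forall>z\<in>U. \<forall>z'\<in>U. \<forall>a\<in>U. E z \<longrightarrow> E z' \<longrightarrow> z \<sqsubset> z' \<longrightarrow> a \<sqsubset> z \<longrightarrow> Lst (\<lambda>y. D a (pr (\<sigma> (s z)) y)) \<sqsubset> z')"

context zf_model
begin

section \<open>Enumeration of the definable relations with one parameter\<close>

primrec dec :: "nat \<Rightarrow> 'a \<Rightarrow> 'a" where
  "dec 0 a = pfst a"
| "dec (Suc i) a = dec i (psnd a)"

primrec enc :: "'a list \<Rightarrow> 'a" where
  "enc [] = emp"
| "enc (x # xs) = pr x (enc xs)"

lemma enc_closed [simp]: "set xs \<subseteq> U \<Longrightarrow> enc xs \<in> U"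
  by (induction xs) auto

lemma dec_enc: "set xs \<subseteq> U \<Longrightarrow> j < length xs \<Longrightarrow> dec j (enc xs) = xs ! j"
  by (induction j arbitrary: xs; case_tac xs) auto

lemma Tm_dec [dfn]: "Tm t \<Longrightarrow> Tm (\<lambda>e. dec j (t e))"
  by (induction j arbitrary: t) (auto intro: dfn)

text \<open>The \<open>n\<close>-th formula with one parameter \<open>a\<close>, which codes the values of all variables
  other than 0.\<close>

definition Dn :: "nat \<Rightarrow> 'a \<Rightarrow> 'a \<Rightarrow> bool" where
  "Dn n a x \<longleftrightarrow> sat M (\<lambda>i. case i of 0 \<Rightarrow> x | Suc j \<Rightarrow> dec j a) (from_nat n)"

lemma Dfn_Dn: "D2 (Dn n)"
  unfolding Dn_def
proof -
  have "Dfn (\<lambda>e. sat M (\<lambda>i. (case i of 0 \<Rightarrow> (\<lambda>e. e (Suc 0)) | Suc j \<Rightarrow> (\<lambda>e. dec j (e 0))) e) (from_nat n))"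
    by (rule Dfn_sat) (auto split: nat.split intro: dfn)
  then show "Dfn (\<lambda>e. sat M (\<lambda>i. case i of 0 \<Rightarrow> e (Suc 0) | Suc j \<Rightarrow> dec j (e 0)) (from_nat n))"
    by (rule Dfn_cong) (auto intro!: sat_cong split: nat.split)
qed

text \<open>The parameters of the formula from variable 2 on are put into one list \<open>k\<close>.
  In \<open>pr a k\<close> the head is then read by variable 1 and entry \<open>j\<close> of
  \<open>k\<close> by variable \<open>j + 2\<close>.\<close>

lemma Dn_exhaust:
  assumes "D2 R"
  shows "\<exists>n c. F1 c \<and> (\<forall>a\<in>U. \<forall>x\<in>U. R a x \<longleftrightarrow> Dn n (c a) x)"
proof -
  have "Dfn (\<lambda>e. R (e (Suc 0)) (e 0))" by (intro D2I[OF assms] dfn)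
  from Dfn_formula[OF this emp(1)] obtain \<phi> s where s: "range s \<subseteq> U"
    "\<forall>x\<in>U. \<forall>y\<in>U. sat M (s(0 := x, 1 := y)) \<phi> \<longleftrightarrow> R y x" by auto
  obtain m where m: "\<And>i. i \<in> vars \<phi> \<Longrightarrow> i < m"
    using finite_nat_set_iff_bounded[of "vars \<phi>"] by auto
  define k where "k = enc (map s [2..<m])"
  have k: "k \<in> U" unfolding k_def using s(1) by (intro enc_closed) auto
  have dec: "dec j k = s (j + 2)" if "j + 2 < m" for j
    unfolding k_def using s(1) that by (subst dec_enc) (auto simp: add.commute)
  have "F1 (\<lambda>a. pr a k)" by (intro dfn k)
  moreover have "R a x \<longleftrightarrow> Dn (to_nat \<phi>) (pr a k) x" if "a \<in> U" "x \<in> U" for a x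
  proof -
    have "R a x \<longleftrightarrow> sat M (s(0 := x, 1 := a)) \<phi>" using s(2) that by auto
    also have "\<dots> \<longleftrightarrow> sat M (\<lambda>i. case i of 0 \<Rightarrow> x | Suc j \<Rightarrow> dec j (pr a k)) \<phi>"
    proof (rule sat_cong)
      fix i assume "i \<in> vars \<phi>"
      then have "i < m" by (rule m)
      then show "(s(0 := x, 1 := a)) i = (case i of 0 \<Rightarrow> x | Suc j \<Rightarrow> dec j (pr a k))"
        using that k dec[of "i - 2"] by (cases i; cases "i - 1") auto
    qed
    finally show ?thesis by (simp add: Dn_def)
  qed
  ultimately show ?thesis by (intro exI[of _ "to_nat \<phi>"] exI[of _ "\<lambda>a. pr a k"]) auto
qed

end

context ordered_model
begin

section \<open>The tower of filter bases\<close>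

lemma stage_rel_exists:
  assumes "F1 \<sigma>" "D2 B" "FIP B" "D2 D"
  shows "\<exists>B2 A s E B'. stage_rel D \<sigma> B B2 A s E B'"
  unfolding stage_rel_def by (rule stage[OF assms])

lemma stage_rel_next:
  assumes "stage_rel D \<sigma> B B2 A s E B'" shows "F1 s" "D2 B'" "FIP B'"
  using assms unfolding stage_rel_def by - (elim conjE, assumption)+

lemma pairs_unbounded:
  assumes "a \<in> U" "u \<in> U" shows "\<exists>\<xi>\<in>U. u \<sqsubset> pr a \<xi>"
proof (rule ccontr)
  assume "\<not> ?thesis"
  then have le: "pr a \<xi> \<sqsubseteq> u" if "\<xi> \<in> U" for \<xi> using not_lt[of u "pr a \<xi>"] assms that by auto
  have 1: "small (\<lambda>y. \<exists>x\<in>U. x \<sqsubseteq> u \<and> y = psnd x)"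
    by (rule small_image[OF small_le[OF assms(2)]]) (intro dfn)
  have "small (\<lambda>_. True)"
  proof (rule small_iff[OF 1])
    fix \<xi> assume "\<xi> \<in> U"
    then show "(\<exists>x\<in>U. x \<sqsubseteq> u \<and> \<xi> = psnd x) \<longleftrightarrow> True"
      using le assms by (auto intro!: bexI[of _ "pr a \<xi>"])
  qed
  then show False using not_small_True by blast
qed

text \<open>The two demands have different uses: \<open>i \<sqsubset> x\<close> makes the generator
  unbounded, so that \<open>N\<close> is a proper extension of \<open>M*\<close>; the finite set
  \<open>pfst x\<close> containing \<open>i\<close> yields the element of \<open>M*\<close> outside
  \<open>M\<close>.\<close>

definition B0 :: "'a \<Rightarrow> 'a \<Rightarrow> bool" where
  "B0 i x \<longleftrightarrow> i \<sqsubset> x \<and> Fin (pfst x) \<and> i \<epsilon> pfst x"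

lemma B0: "D2 B0" "FIP B0"
proof -
  show "D2 B0" unfolding B0_def by (intro dfn)
  show "FIP B0" unfolding FIP_def
  proof (intro ballI impI)
    fix e assume e: "e \<in> U" "Fin e"
    obtain b where b: "b \<in> U" "\<forall>x\<in>U. x \<epsilon> e \<longrightarrow> x \<sqsubset> b" using small_bounded[OF small_mem[OF e(1)]] by blast
    obtain \<xi> where \<xi>: "\<xi> \<in> U" "b \<sqsubset> pr e \<xi>" using pairs_unbounded[OF e(1) b(1)] by blast
    have "B0 i (pr e \<xi>)" if "i \<in> U" "i \<epsilon> e" for i
      unfolding B0_def using lt_trans[of i b "pr e \<xi>"] that b \<xi> e by simp
    then show "\<exists>x\<in>U. \<forall>i\<in>U. i \<epsilon> e \<longrightarrow> B0 i x" using e \<xi> by (intro bexI[of _ "pr e \<xi>"]) auto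
  qed
qed

text \<open>Dependent choice in the metatheory, along the standard natural numbers. Only
  \<open>\<sigma>\<close> and \<open>B\<close> are passed from one stage to the next; the other
  components are chosen afterwards. Each stage is definable in \<open>M\<close>, but no definability
  of the sequence is claimed.\<close>

lemma tower_exists:
  "\<exists>\<sigma> B B2 A s E. \<sigma> 0 = (\<lambda>x. x) \<and> B 0 = B0 \<and> (\<forall>n. F1 (\<sigma> n) \<and>
     stage_rel (Dn n) (\<sigma> n) (B n) (B2 n) (A n) (s n) (E n) (B (Suc n)) \<and>
     \<sigma> (Suc n) = (\<lambda>x. \<sigma> n (s n x)))"
proof -
  let ?P = "\<lambda>n p. F1 (fst p) \<and> D2 (snd p) \<and> FIP (snd p) \<and> (n = 0 \<longrightarrow> p = ((\<lambda>x. x), B0))"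
  let ?Q = "\<lambda>n p q. \<exists>B2 A s E. stage_rel (Dn n) (fst p) (snd p) B2 A s E (snd q) \<and>
     fst q = (\<lambda>x. fst p (s x))"
  have "\<exists>f. \<forall>n. ?P n (f n) \<and> ?Q n (f n) (f (Suc n))"
  proof (rule dependent_nat_choice)
    show "\<exists>p. ?P 0 p" using B0 by (intro exI[of _ "((\<lambda>x. x), B0)"]) (auto intro: dfn)
    fix p :: "('a \<Rightarrow> 'a) \<times> ('a \<Rightarrow> 'a \<Rightarrow> bool)" and n :: nat assume p: "?P n p"
    obtain B2 A s E B' where st: "stage_rel (Dn n) (fst p) (snd p) B2 A s E B'"
    proof -
      have p': "F1 (fst p)" "D2 (snd p)" "FIP (snd p)"
        using conjunct1[OF p] conjunct1[OF conjunct2[OF p]] conjunct1[OF conjunct2[OF conjunct2[OF p]]] by this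
      have "\<exists>B2 A s E B'. stage_rel (Dn n) (fst p) (snd p) B2 A s E B'"
        by (rule stage_rel_exists[of "fst p" "snd p" "Dn n"]) (rule p' Dfn_Dn)+
      then show ?thesis using that by (elim exE)
    qed
    note Fs = stage_rel_next[OF st]
    have 1: "F1 (\<lambda>x. fst p (s x))"
      by (rule F1I[of "fst p"]) (rule conjunct1[OF p] Fs(1))+
    have "?P (Suc n) ((\<lambda>x. fst p (s x)), B')"
      unfolding fst_conv snd_conv by (intro conjI 1 Fs impI) simp
    moreover have "?Q n p ((\<lambda>x. fst p (s x)), B')"
      unfolding fst_conv snd_conv
      by (rule exI[of _ B2], rule exI[of _ A], rule exI[of _ s], rule exI[of _ E], rule conjI[OF st refl])
    ultimately have "?P (Suc n) ((\<lambda>x. fst p (s x)), B') \<and> ?Q n p ((\<lambda>x. fst p (s x)), B')"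
      by (rule conjI)
    then show "\<exists>q. ?P (Suc n) q \<and> ?Q n p q" by (rule exI[of _ "((\<lambda>x. fst p (s x)), B')"])
  qed
  then obtain f where f: "\<forall>n. ?P n (f n) \<and> ?Q n (f n) (f (Suc n))" by (elim exE) (rule that)
  define R where "R n B2 A s E \<longleftrightarrow> stage_rel (Dn n) (fst (f n)) (snd (f n)) B2 A s E (snd (f (Suc n))) \<and>
     fst (f (Suc n)) = (\<lambda>x. fst (f n) (s x))" for n B2 A s E
  have "\<forall>n. \<exists>B2 A s E. R n B2 A s E"
    unfolding R_def by (rule allI, rule conjunct2[OF spec[OF f]])
  from choice[OF this] obtain B2 where "\<forall>n. \<exists>A s E. R n (B2 n) A s E" by (elim exE) (rule that)
  from choice[OF this] obtain A where "\<forall>n. \<exists>s E. R n (B2 n) (A n) s E" by (elim exE) (rule that)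
  from choice[OF this] obtain s where "\<forall>n. \<exists>E. R n (B2 n) (A n) (s n) E" by (elim exE) (rule that)
  from choice[OF this] obtain E where R: "\<forall>n. R n (B2 n) (A n) (s n) (E n)" by (elim exE) (rule that)
  have f0: "f 0 = ((\<lambda>x. x), B0)"
    using conjunct1[OF spec[OF f, of 0]] by (elim conjE impE) (rule refl)
  show ?thesis
  proof (rule exI[of _ "\<lambda>n. fst (f n)"], rule exI[of _ "\<lambda>n. snd (f n)"], rule exI[of _ B2], rule exI[of _ A],
      rule exI[of _ s], rule exI[of _ E], intro conjI allI)
    show "fst (f 0) = (\<lambda>x. x)" "snd (f 0) = B0" unfolding f0 by (rule fst_conv snd_conv)+
    show "F1 (fst (f n))" for n by (rule conjunct1[OF conjunct1[OF spec[OF f]]])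
    show "stage_rel (Dn n) (fst (f n)) (snd (f n)) (B2 n) (A n) (s n) (E n) (snd (f (Suc n)))"
      "fst (f (Suc n)) = (\<lambda>x. fst (f n) (s n x))" for n
      using R[rule_format, of n] unfolding R_def by blast+
  qed
qed

end

locale tower = ordered_model +
  fixes w :: 'a and \<sigma> :: "nat \<Rightarrow> 'a \<Rightarrow> 'a" and B B2 :: "nat \<Rightarrow> 'a \<Rightarrow> 'a \<Rightarrow> bool"
    and A :: "nat \<Rightarrow> 'a \<Rightarrow> bool" and s :: "nat \<Rightarrow> 'a \<Rightarrow> 'a" and E :: "nat \<Rightarrow> 'a \<Rightarrow> bool"
  assumes w: "w \<in> U" "is_omega M w"
    and \<sigma>_0: "\<sigma> 0 = (\<lambda>x. x)" and B_0: "B 0 = B0" and F1_\<sigma>: "F1 (\<sigma> n)"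
    and tower: "stage_rel (Dn n) (\<sigma> n) (B n) (B2 n) (A n) (s n) (E n) (B (Suc n))"
    and \<sigma>_Suc: "\<sigma> (Suc n) = (\<lambda>x. \<sigma> n (s n x))"
begin

section \<open>The ultrafilter generated by the tower\<close>

definition fn :: "nat \<Rightarrow> 'a \<Rightarrow> 'a \<Rightarrow> 'a" where
  "fn n a x = Lst (\<lambda>y. Dn n a (pr x y))"

lemma fn_closed [simp]: "fn n a x \<in> U"
  by (simp add: fn_def)

lemma
  shows FIP_B2: "FIP (B2 n)"
    and B2_B: "i \<in> U \<Longrightarrow> x \<in> U \<Longrightarrow> B2 n i x \<Longrightarrow> B n i x"
    and D1_A: "D1 (A n)"
    and B2_A: "i \<in> U \<Longrightarrow> x \<in> U \<Longrightarrow> B2 n i x \<Longrightarrow> Dn n i (\<sigma> n x) \<longleftrightarrow> A n i"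
    and F1_s: "F1 (s n)" and D1_E: "D1 (E n)"
    and B_Suc: "i \<in> U \<Longrightarrow> z \<in> U \<Longrightarrow> B (Suc n) i z \<Longrightarrow> E n z \<and> i \<sqsubset> z \<and> B2 n i (s n z)"
    and dichotomy: "a \<in> U \<Longrightarrow> (\<exists>b\<in>U. \<forall>x\<in>U. B2 n (pr a b) x \<longrightarrow> fn n a (\<sigma> n x) \<sqsubseteq> b) \<or>
       (\<forall>z\<in>U. B (Suc n) a z \<longrightarrow> z \<sqsubset> fn n a (\<sigma> (Suc n) z))"
    and gap: "z \<in> U \<Longrightarrow> z' \<in> U \<Longrightarrow> a \<in> U \<Longrightarrow> E n z \<Longrightarrow> E n z' \<Longrightarrow> z \<sqsubset> z' \<Longrightarrow> a \<sqsubset> z \<Longrightarrow>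
       fn n a (\<sigma> (Suc n) z) \<sqsubset> z'"
  using tower[of n] unfolding stage_rel_def fn_def \<sigma>_Suc by blast+

lemma \<sigma>_closed [simp]: "x \<in> U \<Longrightarrow> \<sigma> n x \<in> U"
  by (rule F1_closed[OF F1_\<sigma>])

lemma s_closed [simp]: "x \<in> U \<Longrightarrow> s n x \<in> U"
  by (rule F1_closed[OF F1_s])

text \<open>The requirements in \<open>e\<close> are imposed on \<open>z\<close>, the candidate for
  the generator of level \<open>n\<close>, and are then transported along \<open>\<sigma> n\<close>
  to the values of the original generator.\<close>

definition G :: "nat \<Rightarrow> 'a \<Rightarrow> 'a \<Rightarrow> bool" where
  "G n e x \<longleftrightarrow> (\<exists>z\<in>U. x = \<sigma> n z \<and> (\<forall>i\<in>U. i \<epsilon> e \<longrightarrow> B2 n i z))"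

definition UF :: "('a \<Rightarrow> bool) \<Rightarrow> bool" where
  "UF P \<longleftrightarrow> (\<exists>n. \<exists>e\<in>U. Fin e \<and> (\<forall>x\<in>U. G n e x \<longrightarrow> P x))"

lemma G_nonempty: "e \<in> U \<Longrightarrow> Fin e \<Longrightarrow> \<exists>x\<in>U. G n e x"
  using FIP_B2[of n] unfolding FIP_def G_def by (metis \<sigma>_closed)

text \<open>A witness \<open>z\<close> at level \<open>Suc n\<close> gives the witness
  \<open>s n z\<close> at level \<open>n\<close>. So the levels refine each other, and two members
  of the filter can be intersected at the later of their levels.\<close>

lemma G_Suc: "G (Suc n) e x \<Longrightarrow> G n e x"
  unfolding G_def \<sigma>_Suc using B2_B[of _ _ "Suc n"] B_Suc[of _ _ n] s_closed by blast

lemma G_le: "n \<le> m \<Longrightarrow> G m e x \<Longrightarrow> G n e x"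
  by (induction rule: dec_induct) (auto dest: G_Suc)

lemma G_subset: "(\<And>i. i \<in> U \<Longrightarrow> i \<epsilon> d \<Longrightarrow> i \<epsilon> e) \<Longrightarrow> G n e x \<Longrightarrow> G n d x"
  unfolding G_def by blast

lemma UF_mono: "UF P \<Longrightarrow> (\<And>x. x \<in> U \<Longrightarrow> P x \<Longrightarrow> Q x) \<Longrightarrow> UF Q"
  unfolding UF_def by blast

lemma UF_cong: "(\<And>x. x \<in> U \<Longrightarrow> P x \<longleftrightarrow> Q x) \<Longrightarrow> UF P \<longleftrightarrow> UF Q"
  using UF_mono by blast

lemma UF_conj: "UF (\<lambda>x. P x \<and> Q x) \<longleftrightarrow> UF P \<and> UF Q"
proof
  assume "UF P \<and> UF Q"
  then obtain n d m e where 1: "d \<in> U" "Fin d" "\<forall>x\<in>U. G n d x \<longrightarrow> P x"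
    and 2: "e \<in> U" "Fin e" "\<forall>x\<in>U. G m e x \<longrightarrow> Q x" unfolding UF_def by blast
  have "P x \<and> Q x" if "x \<in> U" "G (max n m) (unn d e) x" for x
  proof -
    have "G (max n m) d x" "G (max n m) e x"
      using that(2) G_subset[of d "unn d e"] G_subset[of e "unn d e"] 1 2 by auto
    then show ?thesis using G_le[of n "max n m"] G_le[of m "max n m"] 1(3) 2(3) that(1) by auto
  qed
  then show "UF (\<lambda>x. P x \<and> Q x)" unfolding UF_def
    using Fin_unn[OF 1(2) 2(2) 1(1) 2(1)] unn(1)[OF 1(1) 2(1)] by blast
qed (auto elim: UF_mono)

lemma UF_ex: "UF P \<Longrightarrow> \<exists>x\<in>U. P x"
  unfolding UF_def using G_nonempty by blast

lemma UF_const [simp]: "UF (\<lambda>x. P) \<longleftrightarrow> P"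
  using UF_ex[of "\<lambda>_. P"] Fin_emp emp(1) unfolding UF_def by blast

lemma UF_level:
  assumes "i \<in> U" "\<And>z. z \<in> U \<Longrightarrow> B2 n i z \<Longrightarrow> P (\<sigma> n z)" shows "UF P"
  unfolding UF_def G_def
  by (intro exI[of _ n] bexI[of _ "adj emp i"] conjI Fin_adj Fin_emp)
    (use assms in auto)

lemma UF_Dn: "a \<in> U \<Longrightarrow> UF (Dn n a) \<longleftrightarrow> A n a"
  and UF_not_Dn: "a \<in> U \<Longrightarrow> UF (\<lambda>x. \<not> Dn n a x) \<longleftrightarrow> \<not> A n a"
proof -
  assume a: "a \<in> U"
  have 1: "A n a \<Longrightarrow> UF (Dn n a)" by (rule UF_level[OF a, of n]) (use B2_A a in auto)
  have 2: "\<not> A n a \<Longrightarrow> UF (\<lambda>x. \<not> Dn n a x)" by (rule UF_level[OF a, of n]) (use B2_A a in auto)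
  have "\<not> (UF (Dn n a) \<and> UF (\<lambda>x. \<not> Dn n a x))" using UF_conj[of "Dn n a" "\<lambda>x. \<not> Dn n a x"] by auto
  with 1 2 show "UF (Dn n a) \<longleftrightarrow> A n a" "UF (\<lambda>x. \<not> Dn n a x) \<longleftrightarrow> \<not> A n a" by blast+
qed

text \<open>The stage that treats the formula of \<open>R\<close> has stored its decisions for all
  parameters in the definable class \<open>A n\<close>. This definability, one formula at a time, is
  what conservativity rests on.\<close>

lemma UF_definable:
  assumes "D2 R" shows "D1 (\<lambda>a. UF (R a))"
proof -
  obtain n c where c: "F1 c" "\<forall>a\<in>U. \<forall>x\<in>U. R a x \<longleftrightarrow> Dn n (c a) x" using Dn_exhaust[OF assms] by blast
  have "D1 (\<lambda>a. A n (c a))" by (intro D1I[OF D1_A] c)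
  then show ?thesis
  proof (rule Dfn_cong)
    fix e :: "nat \<Rightarrow> 'a" assume "\<And>i. e i \<in> U"
    then show "A n (c (e 0)) \<longleftrightarrow> UF (R (e 0))"
      using UF_Dn[of "c (e 0)" n] F1_closed[OF c(1)] UF_cong[of "R (e 0)" "Dn n (c (e 0))"] c(2) by simp
  qed
qed

lemma UF_not:
  assumes "D1 P" shows "UF (\<lambda>x. \<not> P x) \<longleftrightarrow> \<not> UF P"
proof -
  have "D2 (\<lambda>a x. P x)" by (intro D1I[OF assms] dfn)
  from Dn_exhaust[OF this] obtain n c where c: "F1 c" "\<forall>a\<in>U. \<forall>x\<in>U. P x \<longleftrightarrow> Dn n (c a) x" by blast
  have "UF P \<longleftrightarrow> UF (Dn n (c emp))" "UF (\<lambda>x. \<not> P x) \<longleftrightarrow> UF (\<lambda>x. \<not> Dn n (c emp) x)"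
    using c(2) emp(1) by (auto intro!: UF_cong)
  then show ?thesis using UF_Dn UF_not_Dn F1_closed[OF c(1) emp(1)] by blast
qed

text \<open>The graph of \<open>g\<close> is a definable class of pairs, hence occurs in the
  enumeration; \<open>Lst\<close> then selects the only value in each fibre.\<close>

lemma fn_exhaust:
  assumes "F1 g" shows "\<exists>n. \<exists>a\<in>U. \<forall>x\<in>U. fn n a x = g x"
proof -
  have "D2 (\<lambda>a z. psnd z = g (pfst z))" by (intro dfn F1I[OF assms])
  from Dn_exhaust[OF this] obtain n c where c: "F1 c" "\<forall>a\<in>U. \<forall>z\<in>U. psnd z = g (pfst z) \<longleftrightarrow> Dn n (c a) z"
    by blast
  have cU: "c emp \<in> U" using F1_closed[OF c(1)] by simp
  have "fn n (c emp) x = g x" if x: "x \<in> U" for x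
  proof -
    have 1: "Dn n (c emp) (pr x y) \<longleftrightarrow> y = g x" if "y \<in> U" for y
      using bspec[OF bspec[OF c(2) emp(1)], of "pr x y"] x that by auto
    have 2: "D1 (\<lambda>y. Dn n (c emp) (pr x y))" by (intro D2I[OF Dfn_Dn] dfn x cU)
    show ?thesis unfolding fn_def
      using Lst(1)[OF 2, of "g x"] 1 F1_closed[OF assms x] by simp
  qed
  then show ?thesis using cU by blast
qed

lemma UF_unbounded: "b \<in> U \<Longrightarrow> UF (\<lambda>x. b \<sqsubset> x)"
  by (rule UF_level[of b 0]) (use B2_B[of b _ 0] in \<open>auto simp: \<sigma>_0 B_0 B0_def\<close>)

lemma UF_Fin: "i \<in> U \<Longrightarrow> UF (\<lambda>x. Fin (pfst x) \<and> i \<epsilon> pfst x)"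
  by (rule UF_level[of i 0]) (use B2_B[of i _ 0] in \<open>auto simp: \<sigma>_0 B_0 B0_def\<close>)

lemma bounded_or_generator:
  assumes "F1 g"
  shows "(\<exists>b\<in>U. UF (\<lambda>x. g x \<sqsubseteq> b)) \<or> (\<exists>T. F1 T \<and> UF (\<lambda>x. T (g x) = x))"
proof -
  obtain n a where a: "a \<in> U" "\<And>x. x \<in> U \<Longrightarrow> fn n a x = g x" using fn_exhaust[OF assms] by blast
  from dichotomy[OF a(1), of n] show ?thesis
  proof
    assume "\<exists>b\<in>U. \<forall>x\<in>U. B2 n (pr a b) x \<longrightarrow> fn n a (\<sigma> n x) \<sqsubseteq> b"
    then obtain b where b: "b \<in> U" "\<forall>x\<in>U. B2 n (pr a b) x \<longrightarrow> fn n a (\<sigma> n x) \<sqsubseteq> b" by blast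
    have "UF (\<lambda>x. g x \<sqsubseteq> b)"
      by (rule UF_level[of "pr a b" n]) (use a b in auto)
    then show ?thesis using b(1) by blast
  next
    assume lt: "\<forall>z\<in>U. B (Suc n) a z \<longrightarrow> z \<sqsubset> fn n a (\<sigma> (Suc n) z)"
    \<comment> \<open>\<open>R y z\<close> says that \<open>z\<close> is the last element of
      \<open>E n\<close> below \<open>y\<close>. For an unbounded value \<open>y\<close> this
      recovers the generator of level \<open>Suc n\<close>, by the gap after it, and
      \<open>\<sigma> (Suc n)\<close> leads from there to the original one.\<close>
    define R where "R y z \<longleftrightarrow> E n z \<and> z \<sqsubset> y \<and> (\<forall>z'\<in>U. E n z' \<longrightarrow> z' \<sqsubset> y \<longrightarrow> z' \<sqsubseteq> z)" for y z
    define T where "T y = \<sigma> (Suc n) (The0 (R y))" for y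
    have "Tm (\<lambda>e. The0 (R (e 0)))" unfolding R_def by (rule Tm_The0) (intro dfn D1I[OF D1_E])
    then have "F1 T" unfolding T_def by (rule F1I[OF F1_\<sigma>])
    moreover have "UF (\<lambda>x. T (g x) = x)"
    proof (rule UF_level[OF a(1), of "Suc n"])
      fix z assume z: "z \<in> U" "B2 (Suc n) a z"
      then have Bz: "B (Suc n) a z" using B2_B a by blast
      let ?y = "fn n a (\<sigma> (Suc n) z)"
      have y: "?y = g (\<sigma> (Suc n) z)" using a z by simp
      have Ez: "E n z" "a \<sqsubset> z" using B_Suc[OF a(1) z(1) Bz] by auto
      have R: "R ?y z" unfolding R_def
      proof (intro conjI ballI impI)
        show "z \<sqsubset> ?y" using lt z Bz by blast
        show "z' \<sqsubseteq> z" if "z' \<in> U" "E n z'" "z' \<sqsubset> ?y" for z'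
        proof (rule ccontr)
          assume "\<not> z' \<sqsubseteq> z"
          then have "z \<sqsubset> z'" using not_le that z by blast
          from gap[OF z(1) that(1) a(1) Ez(1) that(2) this Ez(2)] that(3) show False
            using lt_trans[of "?y" z' "?y"] lt_irrefl[of "?y"] that(1) by simp
        qed
      qed (rule Ez)
      have "The0 (R ?y) = z"
      proof (rule The0_eq[of z "R ?y"])
        show "z' = z" if "z' \<in> U" "R ?y z'" for z'
          using that R lt_linear[OF that(1) z(1)] not_le[OF that(1) z(1)] not_le[OF z(1) that(1)] z(1)
          unfolding R_def by blast
      qed (use z(1) R in auto)
      then show "T (g (\<sigma> (Suc n) z)) = \<sigma> (Suc n) z" unfolding T_def y[symmetric] by simp
    qed
    ultimately show ?thesis by blast
  qed
qed

end

section \<open>The definable ultrapower\<close>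

lemma sat_copy:
  assumes "inj j" "\<And>i. s i \<in> univ M"
  shows "sat (copy j M) (\<lambda>i. j (s i)) \<phi> \<longleftrightarrow> sat M s \<phi>"
  using assms(2)
proof (induction \<phi> arbitrary: s)
  case (Mem a b)
  then show ?case using assms(1) by (auto simp: copy_def dest: injD)
next
  case (Eq a b)
  then show ?case using assms(1) by (auto dest: injD)
next
  case (Ex i \<phi>)
  have e: "(\<lambda>k. j (s k))(i := j a) = (\<lambda>k. j ((s(i := a)) k))" for a by auto
  have "sat (copy j M) ((\<lambda>k. j (s k))(i := j a)) \<phi> \<longleftrightarrow> sat M (s(i := a)) \<phi>" if "a \<in> univ M" for a
    unfolding e by (rule Ex.IH) (use Ex.prems that in simp)
  then show ?case by (simp add: copy_def)
qed auto

context set_struct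
begin

lemma F1_section:
  assumes "Tm t" "\<And>i. d i \<in> U" shows "F1 (\<lambda>y. t (case_nat y d))"
proof -
  let ?\<sigma> = "\<lambda>i. case i of 0 \<Rightarrow> Inl 0 | Suc 0 \<Rightarrow> Inl (Suc 0) | Suc (Suc j) \<Rightarrow> Inr (d j)"
  have "Dfn (\<lambda>e. e 0 = t (\<lambda>i. e (Suc i)))" using assms(1) by (simp add: Tm_def)
  then have 1: "Dfn (\<lambda>e. (\<lambda>e. e 0 = t (\<lambda>i. e (Suc i))) (\<lambda>i. case_sum e id (?\<sigma> i)))"
    by (rule Dfn_subst_const) (use assms(2) in \<open>auto split: nat.splits\<close>)
  have "(\<lambda>i. case_sum e id (?\<sigma> (Suc i))) = case_nat (e (Suc 0)) d" for e :: "nat \<Rightarrow> 'a"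
    by (auto simp: fun_eq_iff split: nat.split)
  then have "Dfn (\<lambda>e. e 0 = t (case_nat (e (Suc 0)) d))" using 1 by simp
  moreover have "t (case_nat (e 0) d) \<in> U" if "\<forall>i. e i \<in> U" for e
    by (rule Tm_closed[OF assms(1)]) (use that assms(2) in \<open>auto split: nat.split\<close>)
  ultimately show ?thesis unfolding Tm_def by (intro conjI allI impI)
qed

end

context tower
begin

lemma UF_both: "UF P \<Longrightarrow> UF Q \<Longrightarrow> (\<And>x. x \<in> U \<Longrightarrow> P x \<Longrightarrow> Q x \<Longrightarrow> R x) \<Longrightarrow> UF R"
  using UF_mono[of "\<lambda>x. P x \<and> Q x" R] UF_conj[of P Q] by blast

text \<open>The condition under \<open>SOME\<close> depends on \<open>F\<close> only up to equality
  on a set of the ultrafilter, so equivalent functions receive the same name.\<close>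

definition rep :: "('a \<Rightarrow> 'a) \<Rightarrow> nat \<times> 'a" where
  "rep F = (SOME p. snd p \<in> U \<and> UF (\<lambda>x. fn (fst p) (snd p) x = F x))"

lemma rep: assumes "F1 F" shows "snd (rep F) \<in> U" "UF (\<lambda>x. fn (fst (rep F)) (snd (rep F)) x = F x)"
proof -
  obtain n a where na: "a \<in> U" "\<forall>x\<in>U. fn n a x = F x" using fn_exhaust[OF assms] by blast
  have "UF (\<lambda>x. fn n a x = F x) \<longleftrightarrow> UF (\<lambda>x. True)" by (rule UF_cong) (use na in simp)
  then have "snd (n, a) \<in> U \<and> UF (\<lambda>x. fn (fst (n, a)) (snd (n, a)) x = F x)" using na by simp
  from someI[of "\<lambda>p. snd p \<in> U \<and> UF (\<lambda>x. fn (fst p) (snd p) x = F x)", OF this]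
  show "snd (rep F) \<in> U" "UF (\<lambda>x. fn (fst (rep F)) (snd (rep F)) x = F x)" unfolding rep_def by blast+
qed

lemma rep_cong: assumes "UF (\<lambda>x. F x = H x)" shows "rep F = rep H"
proof -
  have "UF (\<lambda>x. g x = F x) \<longleftrightarrow> UF (\<lambda>x. g x = H x)" for g
    using UF_both[of "\<lambda>x. g x = F x" "\<lambda>x. F x = H x" "\<lambda>x. g x = H x"]
      UF_both[of "\<lambda>x. g x = H x" "\<lambda>x. F x = H x" "\<lambda>x. g x = F x"] assms by auto
  then show ?thesis unfolding rep_def by simp
qed

text \<open>The elements of the ultrapower are placed into the type \<open>'a + 'a\<close>: constants are mapped
  by \<open>Inl\<close>, and any other definable function is named by a formula number and a parameter.\<close>

definition emb :: "('a \<Rightarrow> 'a) \<Rightarrow> 'a + 'a" where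
  "emb F = (if \<exists>m\<in>U. UF (\<lambda>x. F x = m) then Inl (THE m. m \<in> U \<and> UF (\<lambda>x. F x = m))
     else Inr (pr (num (fst (rep F))) (snd (rep F))))"

lemma emb_const_eq: "m \<in> U \<Longrightarrow> UF (\<lambda>x. F x = m) \<Longrightarrow> emb F = Inl m"
proof -
  assume m: "m \<in> U" "UF (\<lambda>x. F x = m)"
  have "(THE m. m \<in> U \<and> UF (\<lambda>x. F x = m)) = m"
  proof (rule the_equality)
    fix m' assume m': "m' \<in> U \<and> UF (\<lambda>x. F x = m')"
    then have "UF (\<lambda>x. m' = m)" using UF_both[of "\<lambda>x. F x = m" "\<lambda>x. F x = m'" "\<lambda>x. m' = m"] m by auto
    then show "m' = m" by simp
  qed (use m in blast)
  then show ?thesis using m unfolding emb_def by auto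
qed

lemma emb_const [simp]: "m \<in> U \<Longrightarrow> emb (\<lambda>x. m) = Inl m"
  by (rule emb_const_eq) auto

lemma emb_eq_iff:
  assumes "F1 F" "F1 H" shows "emb F = emb H \<longleftrightarrow> UF (\<lambda>x. F x = H x)"
proof
  assume eq: "UF (\<lambda>x. F x = H x)"
  have "UF (\<lambda>x. F x = m) \<longleftrightarrow> UF (\<lambda>x. H x = m)" for m
    using UF_both[of "\<lambda>x. F x = m" "\<lambda>x. F x = H x" "\<lambda>x. H x = m"]
      UF_both[of "\<lambda>x. H x = m" "\<lambda>x. F x = H x" "\<lambda>x. F x = m"] eq by auto
  then show "emb F = emb H" unfolding emb_def rep_cong[OF eq] by simp
next
  assume eq: "emb F = emb H"
  consider m where "m \<in> U" "UF (\<lambda>x. F x = m)" | m where "m \<in> U" "UF (\<lambda>x. H x = m)" |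
    "\<not> (\<exists>m\<in>U. UF (\<lambda>x. F x = m))" "\<not> (\<exists>m\<in>U. UF (\<lambda>x. H x = m))" by blast
  then show "UF (\<lambda>x. F x = H x)"
  proof cases
    case 1
    then have "emb H = Inl m" using emb_const_eq eq by simp
    then obtain m' where m': "m' \<in> U" "UF (\<lambda>x. H x = m')" by (auto simp: emb_def split: if_splits)
    then have "m' = m" using emb_const_eq[OF m'] \<open>emb H = Inl m\<close> by simp
    then show ?thesis using UF_both[of "\<lambda>x. F x = m" "\<lambda>x. H x = m" "\<lambda>x. F x = H x"] 1 m' by auto
  next
    case 2
    then have "emb F = Inl m" using emb_const_eq eq by simp
    then obtain m' where m': "m' \<in> U" "UF (\<lambda>x. F x = m')" by (auto simp: emb_def split: if_splits)
    then have "m' = m" using emb_const_eq[OF m'] \<open>emb F = Inl m\<close> by simp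
    then show ?thesis using UF_both[of "\<lambda>x. F x = m" "\<lambda>x. H x = m" "\<lambda>x. F x = H x"] 2 m' by auto
  next
    case 3
    then have "pr (num (fst (rep F))) (snd (rep F)) = pr (num (fst (rep H))) (snd (rep H))"
      using eq unfolding emb_def by simp
    then have "num (fst (rep F)) = num (fst (rep H)) \<and> snd (rep F) = snd (rep H)"
      using pr_eq_iff[OF num_closed rep(1)[OF assms(1)] num_closed rep(1)[OF assms(2)]] by blast
    then have "rep F = rep H" unfolding num_eq_iff by (simp add: prod_eq_iff)
    then show ?thesis
      using UF_both[OF rep(2)[OF assms(1)] rep(2)[OF assms(2)], of "\<lambda>x. F x = H x"] by simp
  qed
qed

definition N :: "('a + 'a) struct" where
  "N = \<lparr>univ = emb ` {F. F1 F},
     mem = (\<lambda>u v. \<exists>F H. F1 F \<and> F1 H \<and> u = emb F \<and> v = emb H \<and> UF (\<lambda>x. F x \<epsilon> H x))\<rparr>"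

lemma univ_N: "univ N = emb ` {F. F1 F}"
  by (simp add: N_def)

lemma emb_N: "F1 F \<Longrightarrow> emb F \<in> univ N"
  by (simp add: univ_N)

lemma N_emb: "u \<in> univ N \<Longrightarrow> \<exists>F. F1 F \<and> u = emb F"
  by (auto simp: univ_N)

lemma F1_const: "m \<in> U \<Longrightarrow> F1 (\<lambda>x. m)"
  by (rule Tm_const)

lemma mem_N:
  assumes "F1 F" "F1 H" shows "mem N (emb F) (emb H) \<longleftrightarrow> UF (\<lambda>x. F x \<epsilon> H x)"
proof
  assume "mem N (emb F) (emb H)"
  then obtain F' H' where *: "F1 F'" "F1 H'" "emb F = emb F'" "emb H = emb H'" "UF (\<lambda>x. F' x \<epsilon> H' x)"
    unfolding N_def by auto
  have "UF (\<lambda>x. F x = F' x)" "UF (\<lambda>x. H x = H' x)"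
    using emb_eq_iff[OF assms(1) *(1)] emb_eq_iff[OF assms(2) *(2)] *(3,4) by simp_all
  then have "UF (\<lambda>x. F x = F' x \<and> H x = H' x)" by (simp add: UF_conj)
  then show "UF (\<lambda>x. F x \<epsilon> H x)" using *(5) by (rule UF_both) simp
qed (use assms in \<open>auto simp: N_def\<close>)

lemma Dfn_sat_functions:
  assumes "\<And>i. F1 (Fs i)" shows "D1 (\<lambda>x. sat M (\<lambda>i. Fs i x) \<phi>)"
  using Dfn_sat[of "\<lambda>i e. Fs i (e 0)"] assms by blast

lemma F1_witness:
  assumes "\<And>i. F1 (Fs i)" shows "F1 (\<lambda>x. Lst (\<lambda>y. sat M ((\<lambda>i. Fs i x)(j := y)) \<phi>))"
proof (rule Tm_Lst)
  have "Dfn (\<lambda>e. sat M (\<lambda>i. (if i = j then (\<lambda>e. e 0) else (\<lambda>e. Fs i (e (Suc 0)))) e) \<phi>)"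
    by (rule Dfn_sat) (auto intro: dfn F1I[OF assms])
  then show "Dfn (\<lambda>e. sat M ((\<lambda>i. Fs i (e (Suc 0)))(j := e 0)) \<phi>)"
    by (simp add: fun_upd_def if_distrib[of "\<lambda>f. f _"] cong: if_cong)
qed

lemma witness:
  assumes "\<And>i. F1 (Fs i)" "x \<in> U" "y \<in> U" "sat M ((\<lambda>i. Fs i x)(j := y)) \<phi>"
  shows "sat M ((\<lambda>i. Fs i x)(j := Lst (\<lambda>y. sat M ((\<lambda>i. Fs i x)(j := y)) \<phi>))) \<phi>"
proof (rule Lst(1)[of "\<lambda>y. sat M ((\<lambda>i. Fs i x)(j := y)) \<phi>"])
  have "Dfn (\<lambda>e. sat M (\<lambda>i. (if i = j then (\<lambda>e. e 0) else (\<lambda>e. Fs i x)) e) \<phi>)"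
    by (rule Dfn_sat) (auto intro!: dfn simp: F1_closed[OF assms(1,2)])
  then show "D1 (\<lambda>y. sat M ((\<lambda>i. Fs i x)(j := y)) \<phi>)"
    by (simp add: fun_upd_def if_distrib[of "\<lambda>f. f _"] cong: if_cong)
qed (use assms in auto)

lemma upd_emb: "(\<lambda>i. emb (Fs i))(j := emb H) = (\<lambda>i. emb ((Fs(j := H)) i))"
  by auto

lemma upd_fun: "(\<lambda>i. Fs i x)(j := H x) = (\<lambda>i. (Fs(j := H)) i x)"
  by auto

text \<open>Quantifiers are handled by least witnesses, which form a definable function of the
  argument. Negations are handled by \<open>UF_not\<close>, which applies because the truth sets
  involved are definable.\<close>

theorem Los:
  assumes "\<And>i. F1 (Fs i)"
  shows "sat N (\<lambda>i. emb (Fs i)) \<phi> \<longleftrightarrow> UF (\<lambda>x. sat M (\<lambda>i. Fs i x) \<phi>)"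
  using assms
proof (induction \<phi> arbitrary: Fs)
  case (Mem i j)
  then show ?case by (simp add: mem_N)
next
  case (Eq i j)
  then show ?case by (simp add: emb_eq_iff)
next
  case (Nand \<phi> \<psi>)
  have "D1 (\<lambda>x. sat M (\<lambda>i. Fs i x) \<phi> \<and> sat M (\<lambda>i. Fs i x) \<psi>)"
    by (intro Dfn_conj Dfn_sat_functions Nand.prems)
  from UF_not[OF this] show ?case using Nand.IH[OF Nand.prems] by (simp add: UF_conj)
next
  case (Ex j \<phi>)
  have upd: "sat N ((\<lambda>i. emb (Fs i))(j := emb H)) \<phi> \<longleftrightarrow> UF (\<lambda>x. sat M ((\<lambda>i. Fs i x)(j := H x)) \<phi>)"
    if "F1 H" for H
    unfolding upd_emb upd_fun by (rule Ex.IH) (use that Ex.prems in simp)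
  show ?case
  proof
    assume "sat N (\<lambda>i. emb (Fs i)) (fm.Ex j \<phi>)"
    then obtain u where "u \<in> univ N" "sat N ((\<lambda>i. emb (Fs i))(j := u)) \<phi>" by auto
    moreover from this obtain H where H: "F1 H" "u = emb H" using N_emb by blast
    ultimately have "UF (\<lambda>x. sat M ((\<lambda>i. Fs i x)(j := H x)) \<phi>)" using upd by simp
    then show "UF (\<lambda>x. sat M (\<lambda>i. Fs i x) (fm.Ex j \<phi>))"
      by (rule UF_mono) (use F1_closed[OF H(1)] in auto)
  next
    assume ex: "UF (\<lambda>x. sat M (\<lambda>i. Fs i x) (fm.Ex j \<phi>))"
    let ?H = "\<lambda>x. Lst (\<lambda>y. sat M ((\<lambda>i. Fs i x)(j := y)) \<phi>)"
    have H: "F1 ?H" by (rule F1_witness[OF Ex.prems])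
    have "UF (\<lambda>x. sat M ((\<lambda>i. Fs i x)(j := ?H x)) \<phi>)"
      using ex by (rule UF_mono) (use witness[OF Ex.prems] in auto)
    then have "sat N ((\<lambda>i. emb (Fs i))(j := emb ?H)) \<phi>" using upd[OF H] by blast
    then show "sat N (\<lambda>i. emb (Fs i)) (fm.Ex j \<phi>)"
      unfolding sat.simps by (rule bexI[OF _ emb_N[OF H]])
  qed
qed

lemma sat_N_Inl:
  assumes "\<And>i. t i \<in> U" shows "sat N (\<lambda>i. Inl (t i)) \<phi> \<longleftrightarrow> sat M t \<phi>"
proof -
  have "(\<lambda>i. Inl (t i)) = (\<lambda>i. emb ((\<lambda>i _. t i) i))" using assms by auto
  then show ?thesis using Los[of "\<lambda>i _. t i" \<phi>] F1_const[OF assms] by simp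
qed

section \<open>Bounded definable functions\<close>

definition bdd :: "('a \<Rightarrow> 'a) \<Rightarrow> bool" where
  "bdd F \<longleftrightarrow> (\<exists>b\<in>U. UF (\<lambda>x. F x \<sqsubseteq> b))"

lemma bdd_iff:
  assumes "F1 F" shows "bdd F \<longleftrightarrow> (\<exists>m\<in>U. UF (\<lambda>x. F x \<epsilon> m))"
proof
  assume "bdd F"
  then obtain b where b: "b \<in> U" "UF (\<lambda>x. F x \<sqsubseteq> b)" unfolding bdd_def by blast
  have "UF (\<lambda>x. F x \<epsilon> SetOf (\<lambda>y. y \<sqsubseteq> b))"
    using b(2) by (rule UF_mono) (use mem_SetOf[OF small_le[OF b(1)]] F1_closed[OF assms] in auto)
  then show "\<exists>m\<in>U. UF (\<lambda>x. F x \<epsilon> m)" using SetOf_closed[OF small_le[OF b(1)]] by blast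
next
  assume "\<exists>m\<in>U. UF (\<lambda>x. F x \<epsilon> m)"
  then obtain m where m: "m \<in> U" "UF (\<lambda>x. F x \<epsilon> m)" by blast
  obtain b where b: "b \<in> U" "\<forall>x\<in>U. x \<epsilon> m \<longrightarrow> x \<sqsubset> b" using small_bounded[OF small_mem[OF m(1)]] by blast
  have "UF (\<lambda>x. F x \<sqsubseteq> b)"
    using m(2) by (rule UF_mono) (use b F1_closed[OF assms] in \<open>auto simp: le_def\<close>)
  then show "bdd F" using b(1) unfolding bdd_def by blast
qed

text \<open>Replacement for several arguments: \<open>t'\<close> takes a bound over the possible
  values of entry 0 and leaves a term in one argument fewer. Fixing the entries from
  \<open>n\<close> on makes the family of environments effectively \<open>n\<close>-dimensional;
  \<open>n\<close> is a standard number.\<close>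

lemma tuple_bound:
  assumes "b \<in> U" "Tm t"
  shows "\<exists>b'\<in>U. \<forall>e. (\<forall>i. e i \<in> U) \<longrightarrow> (\<forall>i<n. e i \<sqsubseteq> b) \<longrightarrow> (\<forall>i\<ge>n. e i = emp) \<longrightarrow> t e \<sqsubseteq> b'"
  using assms(2)
proof (induction n arbitrary: t)
  case 0
  show ?case
  proof (rule bexI[of _ "t (\<lambda>_. emp)"], intro allI impI)
    fix e :: "nat \<Rightarrow> 'a" assume "\<forall>i\<ge>0. e i = emp"
    then have "e = (\<lambda>_. emp)" by (intro ext) simp
    then show "t e \<sqsubseteq> t (\<lambda>_. emp)" by (simp add: le_def)
  qed (rule Tm_closed[OF 0], simp)
next
  case (Suc n)
  let ?c = "\<lambda>y e. case_nat y (e :: nat \<Rightarrow> 'a)"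
  define t' where "t' e = Lst (\<lambda>u. \<forall>y\<in>U. y \<sqsubseteq> b \<longrightarrow> t (?c y e) \<sqsubseteq> u)" for e
  have tt: "Tm (\<lambda>e. t (\<lambda>i. e (case i of 0 \<Rightarrow> 0 | Suc j \<Rightarrow> Suc (Suc j))))" by (rule Tm_subst[OF Suc.prems])
  have cc: "(\<lambda>i. e (case i of 0 \<Rightarrow> 0 | Suc j \<Rightarrow> Suc (Suc j))) = ?c (e 0) (\<lambda>i. e (Suc (Suc i)))" for e :: "nat \<Rightarrow> 'a"
    by (auto simp: fun_eq_iff split: nat.split)
  have "Tm (\<lambda>e. t (?c (e 0) (\<lambda>i. e (Suc (Suc i)))))" using tt unfolding cc .
  then have "Dfn (\<lambda>e. \<forall>y\<in>U. y \<sqsubseteq> b \<longrightarrow> t (?c y (\<lambda>i. e (Suc i))) \<sqsubseteq> e 0)"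
    by (intro dfn assms(1))
  then have t': "Tm t'" unfolding t'_def by (rule Tm_Lst)
  from Suc.IH[OF this] obtain b' where b': "b' \<in> U"
    "\<forall>e. (\<forall>i. e i \<in> U) \<longrightarrow> (\<forall>i<n. e i \<sqsubseteq> b) \<longrightarrow> (\<forall>i\<ge>n. e i = emp) \<longrightarrow> t' e \<sqsubseteq> b'" by blast
  have "t e \<sqsubseteq> b'" if e: "\<forall>i. e i \<in> U" "\<forall>i<Suc n. e i \<sqsubseteq> b" "\<forall>i\<ge>Suc n. e i = emp" for e
  proof -
    let ?d = "\<lambda>i. e (Suc i)"
    have ce: "?c (e 0) ?d = e" by (auto simp: fun_eq_iff split: nat.split)
    have Ft: "F1 (\<lambda>y. t (?c y ?d))" by (rule F1_section[OF Suc.prems]) (use e in blast)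
    obtain u where u: "u \<in> U" "\<forall>x\<in>U. (\<exists>y\<in>U. y \<sqsubseteq> b \<and> x = t (?c y ?d)) \<longrightarrow> x \<sqsubset> u"
      using small_bounded[OF small_image[OF small_le[OF assms(1)] Ft]] by blast
    have "\<forall>y\<in>U. y \<sqsubseteq> b \<longrightarrow> t (?c y ?d) \<sqsubseteq> u" using u F1_closed[OF Ft] unfolding le_def by blast
    moreover have "D1 (\<lambda>u. \<forall>y\<in>U. y \<sqsubseteq> b \<longrightarrow> t (?c y ?d) \<sqsubseteq> u)"
      by (intro dfn F1I[OF Ft] assms(1))
    ultimately have "\<forall>y\<in>U. y \<sqsubseteq> b \<longrightarrow> t (?c y ?d) \<sqsubseteq> t' ?d"
      unfolding t'_def using Lst(1)[of "\<lambda>u. \<forall>y\<in>U. y \<sqsubseteq> b \<longrightarrow> t (?c y ?d) \<sqsubseteq> u" u] u(1) by blast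
    then have "t (?c (e 0) ?d) \<sqsubseteq> t' ?d" using e(1,2) by simp
    then have 1: "t e \<sqsubseteq> t' ?d" unfolding ce .
    have 2: "t' ?d \<sqsubseteq> b'" using b'(2)[rule_format, of ?d] e by simp
    have "t e \<in> U" by (rule Tm_closed[OF Suc.prems]) (use e in blast)
    moreover have "t' ?d \<in> U" by (rule Tm_closed[OF t']) (use e in blast)
    ultimately show ?thesis using le_trans[OF _ _ b'(1) 1 2] by blast
  qed
  then show ?case using b'(1) by blast
qed

end

section \<open>The bounded part of the ultrapower\<close>

context tower
begin

definition Mstar :: "('a + 'a) struct" where
  "Mstar = \<lparr>univ = {u \<in> univ N. \<exists>m\<in>U. mem N u (Inl m)}, mem = mem N\<rparr>"

lemma univ_Mstar: "univ Mstar = {u \<in> univ N. \<exists>m\<in>U. mem N u (Inl m)}"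
  and mem_Mstar [simp]: "mem Mstar = mem N"
  by (simp_all add: Mstar_def)

lemma emb_Mstar: "F1 F \<Longrightarrow> emb F \<in> univ Mstar \<longleftrightarrow> bdd F"
proof -
  assume F: "F1 F"
  have "mem N (emb F) (Inl m) \<longleftrightarrow> UF (\<lambda>x. F x \<epsilon> m)" if "m \<in> U" for m
    using mem_N[OF F F1_const[OF that]] that by simp
  then show ?thesis using emb_N[OF F] bdd_iff[OF F] by (auto simp: univ_Mstar)
qed

lemma Mstar_subset: "univ Mstar \<subseteq> univ N"
  by (auto simp: univ_Mstar)

lemma Inl_Mstar: "m \<in> U \<Longrightarrow> Inl m \<in> univ Mstar"
proof -
  assume m: "m \<in> U"
  have "bdd (\<lambda>x. m)" unfolding bdd_def using m by (intro bexI[of _ m]) (auto simp: le_def)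
  then show ?thesis using emb_Mstar[OF F1_const[OF m]] m by simp
qed

lemma env_N:
  assumes "\<And>i. t i \<in> univ N" shows "\<exists>Fs. (\<forall>i. F1 (Fs i)) \<and> t = (\<lambda>i. emb (Fs i))"
proof -
  have "\<forall>i. \<exists>F. F1 F \<and> t i = emb F" using N_emb[OF assms] by blast
  from choice[OF this] obtain Fs where "\<forall>i. F1 (Fs i) \<and> t i = emb (Fs i)" by (elim exE)
  then show ?thesis by (intro exI[of _ Fs]) (auto simp: fun_eq_iff)
qed

text \<open>The variables occurring in the formula are finitely many, so one \<open>b\<close> bounds
  all relevant arguments on a set of the ultrafilter, and \<open>tuple_bound\<close> then bounds the
  least witness.\<close>

lemma bdd_witness:
  assumes F: "\<And>i. F1 (Fs i)" and bdd: "\<And>i. bdd (Fs i)"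
  shows "bdd (\<lambda>x. Lst (\<lambda>y. sat M ((\<lambda>i. Fs i x)(j := y)) \<phi>))"
proof -
  have "\<exists>b\<in>U. UF (\<lambda>x. \<forall>i<k. Fs i x \<sqsubseteq> b)" for k
  proof (induction k)
    case 0
    show ?case by (rule bexI[of _ emp]) simp_all
  next
    case (Suc k)
    then obtain b where b: "b \<in> U" "UF (\<lambda>x. \<forall>i<k. Fs i x \<sqsubseteq> b)" by blast
    obtain c where c: "c \<in> U" "UF (\<lambda>x. Fs k x \<sqsubseteq> c)" using bdd[of k] unfolding bdd_def by blast
    obtain u where u: "u \<in> U" "b \<sqsubset> u" "c \<sqsubset> u"
      using small_bounded[OF small_upair[OF b(1) c(1)]] b(1) c(1) by blast
    have "UF (\<lambda>x. \<forall>i<Suc k. Fs i x \<sqsubseteq> u)"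
    proof (rule UF_both[OF b(2) c(2)])
      fix x assume x: "x \<in> U" "\<forall>i<k. Fs i x \<sqsubseteq> b" "Fs k x \<sqsubseteq> c"
      have Fx: "Fs i x \<in> U" for i by (rule F1_closed[OF F x(1)])
      show "\<forall>i<Suc k. Fs i x \<sqsubseteq> u"
      proof (intro allI impI)
        fix i assume "i < Suc k"
        then consider "i < k" | "i = k" by linarith
        then have "Fs i x \<sqsubset> u"
        proof cases
          case 1
          with x(2) have "Fs i x \<sqsubseteq> b" by blast
          then show ?thesis by (rule le_lt_trans[OF Fx b(1) u(1) _ u(2)])
        next
          case 2
          with x(3) have "Fs i x \<sqsubseteq> c" by blast
          then show ?thesis by (rule le_lt_trans[OF Fx c(1) u(1) _ u(3)])
        qed
        then show "Fs i x \<sqsubseteq> u" by (simp add: le_def)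
      qed
    qed
    then show ?case using u(1) by blast
  qed
  note ex = this
  obtain n where n: "\<And>i. i \<in> vars \<phi> \<Longrightarrow> i < n"
    using finite_nat_set_iff_bounded[of "vars \<phi>"] by auto
  obtain b where b: "b \<in> U" "UF (\<lambda>x. \<forall>i<n. Fs i x \<sqsubseteq> b)" using ex[of n] by blast
  define t where "t e = Lst (\<lambda>y. sat M (e(j := y)) \<phi>)" for e
  have "Dfn (\<lambda>e. sat M (\<lambda>i. (if i = j then (\<lambda>e. e 0) else (\<lambda>e. e (Suc i))) e) \<phi>)"
    by (rule Dfn_sat) (auto intro: dfn)
  then have "Dfn (\<lambda>e. sat M ((\<lambda>i. e (Suc i))(j := e 0)) \<phi>)"
    by (simp add: fun_upd_def if_distrib[of "\<lambda>f. f _"] cong: if_cong)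
  then have "Tm t" unfolding t_def by (rule Tm_Lst)
  from tuple_bound[OF b(1) this, of n] obtain b' where b': "b' \<in> U"
    "\<forall>e. (\<forall>i. e i \<in> U) \<longrightarrow> (\<forall>i<n. e i \<sqsubseteq> b) \<longrightarrow> (\<forall>i\<ge>n. e i = emp) \<longrightarrow> t e \<sqsubseteq> b'" by blast
  have "UF (\<lambda>x. Lst (\<lambda>y. sat M ((\<lambda>i. Fs i x)(j := y)) \<phi>) \<sqsubseteq> b')"
    using b(2)
  proof (rule UF_mono)
    fix x assume x: "x \<in> U" "\<forall>i<n. Fs i x \<sqsubseteq> b"
    let ?e = "\<lambda>i. if i < n then Fs i x else emp"
    have "sat M ((\<lambda>i. Fs i x)(j := y)) \<phi> \<longleftrightarrow> sat M (?e(j := y)) \<phi>" for y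
      by (rule sat_cong) (use n in auto)
    then have "Lst (\<lambda>y. sat M ((\<lambda>i. Fs i x)(j := y)) \<phi>) = t ?e" unfolding t_def by presburger
    moreover have "t ?e \<sqsubseteq> b'"
      by (rule b'(2)[rule_format]) (use x F1_closed[OF F x(1)] in auto)
    ultimately show "Lst (\<lambda>y. sat M ((\<lambda>i. Fs i x)(j := y)) \<phi>) \<sqsubseteq> b'" by simp
  qed
  then show ?thesis using b'(1) unfolding bdd_def by blast
qed

text \<open>The Tarski-Vaught test. A given witness in \<open>N\<close> may be unbounded; it is
  exchanged for the least witness, which is bounded because the parameters are.\<close>

lemma sat_Mstar: "(\<And>i. t i \<in> univ Mstar) \<Longrightarrow> sat Mstar t \<phi> \<longleftrightarrow> sat N t \<phi>"
proof (induction \<phi> arbitrary: t)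
  case (Nand \<phi> \<psi>)
  then show ?case by simp
next
  case (Ex j \<phi>)
  have IH: "sat Mstar (t(j := u)) \<phi> \<longleftrightarrow> sat N (t(j := u)) \<phi>" if "u \<in> univ Mstar" for u
    by (rule Ex.IH) (use that Ex.prems in simp)
  show ?case
  proof
    assume "sat Mstar t (fm.Ex j \<phi>)"
    then obtain u where "u \<in> univ Mstar" "sat Mstar (t(j := u)) \<phi>" by auto
    then have "u \<in> univ N" "sat N (t(j := u)) \<phi>" using IH Mstar_subset by blast+
    then show "sat N t (fm.Ex j \<phi>)" unfolding sat.simps by blast
  next
    assume ex: "sat N t (fm.Ex j \<phi>)"
    have "t i \<in> univ N" for i using Ex.prems Mstar_subset by blast
    from env_N[of t, OF this] obtain Fs where Fs: "\<And>i. F1 (Fs i)" "t = (\<lambda>i. emb (Fs i))" by blast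
    have bdd: "bdd (Fs i)" for i using emb_Mstar[OF Fs(1)] Ex.prems[of i] Fs(2) by simp
    let ?H = "\<lambda>x. Lst (\<lambda>y. sat M ((\<lambda>i. Fs i x)(j := y)) \<phi>)"
    have H: "F1 ?H" by (rule F1_witness[OF Fs(1)])
    have "UF (\<lambda>x. sat M (\<lambda>i. Fs i x) (fm.Ex j \<phi>))"
      using ex Los[of Fs "fm.Ex j \<phi>", OF Fs(1)] unfolding Fs(2) by (rule iffD1[rotated])
    then have "UF (\<lambda>x. sat M ((\<lambda>i. Fs i x)(j := ?H x)) \<phi>)"
      by (rule UF_mono) (use witness[OF Fs(1)] in auto)
    then have "UF (\<lambda>x. sat M (\<lambda>i. (Fs(j := ?H)) i x) \<phi>)"
      unfolding upd_fun[of Fs _ j ?H] .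
    then have "sat N (\<lambda>i. emb ((Fs(j := ?H)) i)) \<phi>" by (subst Los) (use Fs(1) H in simp_all)
    then have "sat N (t(j := emb ?H)) \<phi>" unfolding Fs(2) upd_emb .
    moreover have "emb ?H \<in> univ Mstar" unfolding emb_Mstar[OF H] by (rule bdd_witness[OF Fs(1) bdd])
    ultimately show "sat Mstar t (fm.Ex j \<phi>)" unfolding sat.simps using IH by blast
  qed
qed simp_all

text \<open>By induction on finite sets, the natural numbers in \<open>e\<close> all lie below some
  internal natural number \<open>n\<close>. This \<open>n\<close> is then missing from
  \<open>e\<close>.\<close>

lemma not_Fin_omega:
  assumes "e \<in> U" "Fin e" shows "\<exists>i\<in>U. i \<epsilon> w \<and> \<not> i \<epsilon> e"
proof -
  let ?P = "\<lambda>x. \<exists>n\<in>U. n \<epsilon> w \<and> (\<forall>i\<in>U. i \<epsilon> w \<longrightarrow> i \<epsilon> x \<longrightarrow> i \<epsilon> n)"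
  have "?P e"
  proof (rule Fin_induct[of ?P])
    show "D1 ?P" by (intro dfn w)
    show "?P emp" using omega_emp[OF w] by (intro bexI[of _ emp]) auto
    fix x i assume xi: "x \<in> U" "i \<in> U" "?P x"
    then obtain n where n: "n \<in> U" "n \<epsilon> w" "\<forall>i\<in>U. i \<epsilon> w \<longrightarrow> i \<epsilon> x \<longrightarrow> i \<epsilon> n" by blast
    show "?P (adj x i)"
    proof (cases "i \<epsilon> w")
      case True
      show ?thesis
      proof (rule omega_max[OF w n(1) suc(1)[OF xi(2)] n(2) omega_suc[OF w xi(2) True]])
        fix k assume k: "k \<in> U" "k \<epsilon> w" "\<And>i. i \<in> U \<Longrightarrow> i \<epsilon> n \<Longrightarrow> i \<epsilon> k" "\<And>j. j \<in> U \<Longrightarrow> j \<epsilon> suc i \<Longrightarrow> j \<epsilon> k"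
        have "i \<epsilon> k" using k(4)[OF xi(2)] xi(2) by simp
        then have "j \<epsilon> k" if "j \<in> U" "j \<epsilon> w" "j \<epsilon> adj x i" for j using that n(3) k(3) xi by auto
        then show ?thesis using k(1,2) by blast
      qed
    next
      case False
      then show ?thesis using n xi by (intro bexI[OF _ n(1)]) auto
    qed
  qed (use assms in auto)
  then show ?thesis using not_mem_self by blast
qed

text \<open>The new element is the set of natural numbers in the first component of the generator;
  it is bounded because it is a subset of \<open>w\<close>. Were it a constant \<open>m\<close>,
  every natural number would belong to \<open>m\<close>, as each is a requirement on the generator,
  yet \<open>m\<close> would be contained in the finite set \<open>pfst x\<close> for a single
  \<open>x\<close>.\<close>

lemma new_element: "\<exists>u\<in>univ Mstar. u \<notin> Inl ` U"
proof -
  define K where "K x = SetOf (\<lambda>i. i \<epsilon> w \<and> i \<epsilon> pfst x)" for x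
  have sm: "small (\<lambda>i. i \<epsilon> w \<and> i \<epsilon> pfst x)" for x
    by (rule small_Collect[OF w(1)]) (intro dfn pfst_closed)
  have K: "i \<epsilon> K x \<longleftrightarrow> i \<epsilon> w \<and> i \<epsilon> pfst x" if "i \<in> U" for i x
    unfolding K_def by (rule mem_SetOf[OF sm that])
  have KU: "K x \<in> U" for x unfolding K_def by (rule SetOf_closed[OF sm])
  have F1K: "F1 K" unfolding K_def by (rule Tm_SetOf) (intro dfn w sm)+
  have "K x \<epsilon> Pw w" for x using K KU w by (simp add: is_subset_def)
  then have "bdd K" using bdd_iff[OF F1K] w by (auto intro!: bexI[of _ "Pw w"])
  then have 1: "emb K \<in> univ Mstar" using emb_Mstar[OF F1K] by blast
  have "emb K \<noteq> Inl m" if m: "m \<in> U" for m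
  proof
    assume "emb K = Inl m"
    then have "emb K = emb (\<lambda>_. m)" using m by simp
    then have eq: "UF (\<lambda>x. K x = m)" using emb_eq_iff[OF F1K F1_const[OF m]] by blast
    have wm: "\<exists>x\<in>U. K x = m \<and> Fin (pfst x) \<and> i \<epsilon> pfst x" if "i \<in> U" for i
      by (rule UF_ex) (use eq UF_Fin[OF that] in \<open>simp add: UF_conj\<close>)
    obtain x where x: "x \<in> U" "K x = m" "Fin (pfst x)" using wm[OF emp(1)] by blast
    obtain i where i: "i \<in> U" "i \<epsilon> w" "\<not> i \<epsilon> pfst x" using not_Fin_omega[OF pfst_closed x(3)] by blast
    obtain y where y: "K y = m" "i \<epsilon> pfst y" using wm[OF i(1)] by blast
    have "i \<epsilon> m" using K[OF i(1), of y] y i by simp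
    then show False using K[OF i(1), of x] x i by simp
  qed
  then show ?thesis using 1 by blast
qed

lemma generator_notin: "emb (\<lambda>x. x) \<in> univ N" "emb (\<lambda>x. x) \<notin> univ Mstar"
proof -
  have F: "F1 (\<lambda>x. x)" by (rule Tm_var)
  show "emb (\<lambda>x. x) \<in> univ N" by (rule emb_N[OF F])
  have "\<not> bdd (\<lambda>x. x)"
  proof
    assume "bdd (\<lambda>x. x)"
    then obtain b where b: "b \<in> U" "UF (\<lambda>x. x \<sqsubseteq> b)" unfolding bdd_def by blast
    have "\<exists>x\<in>U. x \<sqsubseteq> b \<and> b \<sqsubset> x"
      by (rule UF_ex) (use b UF_unbounded[OF b(1)] in \<open>simp add: UF_conj\<close>)
    then obtain x where "x \<in> U" "x \<sqsubseteq> b" "b \<sqsubset> x" by blast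
    then show False using not_le[OF _ b(1)] by blast
  qed
  then show "emb (\<lambda>x. x) \<notin> univ Mstar" using emb_Mstar[OF F] by blast
qed

section \<open>The copy of \<open>M\<close>, its extension \<open>M*\<close> and the end extension
  \<open>N\<close>\<close>

lemma univ_copy: "univ (copy Inl M) = Inl ` U"
  by (simp add: copy_def)

lemma env_copy:
  assumes "range t \<subseteq> Inl ` U" shows "\<exists>t'. (\<forall>i. t' i \<in> U) \<and> t = (\<lambda>i. Inl (t' i))"
proof -
  have "\<forall>i. \<exists>m. m \<in> U \<and> t i = Inl m" using assms by blast
  from choice[OF this] obtain t' where "\<forall>i. t' i \<in> U \<and> t i = Inl (t' i)" by (elim exE)
  then show ?thesis by (intro exI[of _ t']) (auto simp: fun_eq_iff)
qed

lemma mem_N_Inl: "a \<in> U \<Longrightarrow> b \<in> U \<Longrightarrow> mem N (Inl a) (Inl b) \<longleftrightarrow> a \<epsilon> b"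
  using mem_N[OF F1_const F1_const, of a b] by simp

lemma submodel_copy: "submodel (copy Inl M) Mstar"
  unfolding submodel_def univ_copy
  using Inl_Mstar by (auto simp: mem_N_Inl copy_def)

lemma copy_elem: "copy Inl M \<prec> Mstar"
  unfolding elem_submodel_def
proof (intro conjI allI impI)
  show "univ (copy Inl M) \<noteq> univ Mstar" using new_element unfolding univ_copy by blast
  fix \<phi> and t :: "nat \<Rightarrow> 'a + 'a" assume "range t \<subseteq> univ (copy Inl M)"
  from env_copy[OF this[unfolded univ_copy]]
  obtain t' where t': "\<And>i. t' i \<in> U" "t = (\<lambda>i. Inl (t' i))" by blast
  have "sat (copy Inl M) t \<phi> \<longleftrightarrow> sat M t' \<phi>" unfolding t'(2) by (rule sat_copy) (use t'(1) in auto)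
  also have "\<dots> \<longleftrightarrow> sat N t \<phi>" unfolding t'(2) by (rule sat_N_Inl[OF t'(1), symmetric])
  also have "\<dots> \<longleftrightarrow> sat Mstar t \<phi>" by (rule sat_Mstar[symmetric]) (use t' Inl_Mstar in simp)
  finally show "sat (copy Inl M) t \<phi> \<longleftrightarrow> sat Mstar t \<phi>" .
qed (rule submodel_copy)

lemma Mstar_elem: "Mstar \<prec> N"
  unfolding elem_submodel_def submodel_def
  using Mstar_subset generator_notin sat_Mstar by (auto simp: range_subsetD)

text \<open>If \<open>H\<close> takes values in \<open>m\<close>, then the elements of these values
  lie in the single set \<open>Unn m\<close>, so every member of a bounded element is
  bounded.\<close>

lemma Mstar_end: "end_extension Mstar N"
  unfolding end_extension_def
proof (intro conjI ballI)
  show "submodel Mstar N" using Mstar_elem unfolding elem_submodel_def by blast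
  fix a assume a: "a \<in> univ Mstar"
  then obtain H where H: "F1 H" "a = emb H" using Mstar_subset N_emb by blast
  obtain m where m: "m \<in> U" "UF (\<lambda>x. H x \<epsilon> m)" using a H emb_Mstar bdd_iff by blast
  have "u \<in> univ Mstar" if u: "u \<in> univ N" "mem N u a" for u
  proof -
    obtain F where F: "F1 F" "u = emb F" using N_emb[OF u(1)] by blast
    have "UF (\<lambda>x. F x \<epsilon> H x)" using mem_N[OF F(1) H(1)] u(2) F(2) H(2) by simp
    then have "UF (\<lambda>x. F x \<epsilon> Unn m)" using m(2)
      by (rule UF_both) (use m(1) F1_closed[OF F(1)] F1_closed[OF H(1)] in auto)
    then have "bdd F" using bdd_iff[OF F(1)] Unn(1)[OF m(1)] by blast
    then show ?thesis using emb_Mstar F by blast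
  qed
  then show "Ext N a = Ext Mstar a" unfolding Ext_def using Mstar_subset by auto
qed

lemma cofinal: "cofinal_extension (copy Inl M) Mstar"
  unfolding cofinal_extension_def univ_copy
  using submodel_copy by (auto simp: univ_Mstar Ext_def)

text \<open>Truth in \<open>M*\<close> is truth in \<open>N\<close>, which by \<open>Los\<close>
  asks whether a class depending definably on \<open>m\<close> belongs to the ultrafilter. By
  \<open>UF_definable\<close> this is a definable condition on \<open>m\<close>, even though the
  parameters of \<open>D\<close> lie outside \<open>M\<close>.\<close>

lemma conservative: "conservative_extension (copy Inl M) Mstar"
  unfolding conservative_extension_def
proof (intro conjI allI impI)
  fix D assume "definable Mstar D"
  then obtain \<phi> t where t: "range t \<subseteq> univ Mstar" "D = {x \<in> univ Mstar. sat Mstar (t(0 := x)) \<phi>}"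
    unfolding definable_def by blast
  have tM: "t i \<in> univ Mstar" for i using t(1) by blast
  then have "t i \<in> univ N" for i using Mstar_subset by blast
  from env_N[of t, OF this] obtain Fs where Fs: "\<And>i. F1 (Fs i)" "t = (\<lambda>i. emb (Fs i))" by blast
  define P where "P m \<longleftrightarrow> UF (\<lambda>x. sat M ((\<lambda>i. Fs i x)(0 := m)) \<phi>)" for m
  have D: "Inl m \<in> D \<longleftrightarrow> P m" if m: "m \<in> U" for m
  proof -
    have "Inl m \<in> D \<longleftrightarrow> sat Mstar (t(0 := Inl m)) \<phi>" using t(2) Inl_Mstar[OF m] by blast
    also have "\<dots> \<longleftrightarrow> sat N (t(0 := Inl m)) \<phi>" by (rule sat_Mstar) (use tM Inl_Mstar[OF m] in simp)
    also have "t(0 := Inl m) = (\<lambda>i. emb ((Fs(0 := \<lambda>_. m)) i))"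
      unfolding Fs(2) using m by (auto simp: fun_eq_iff)
    also have "sat N (\<lambda>i. emb ((Fs(0 := \<lambda>_. m)) i)) \<phi> \<longleftrightarrow> UF (\<lambda>x. sat M (\<lambda>i. (Fs(0 := \<lambda>_. m)) i x) \<phi>)"
      by (rule Los) (use Fs(1) F1_const[OF m] in simp)
    also have "\<dots> \<longleftrightarrow> P m" unfolding P_def upd_fun[of Fs _ 0 "\<lambda>_. m"] ..
    finally show ?thesis .
  qed
  have "Dfn (\<lambda>e. sat M (\<lambda>i. (if i = 0 then (\<lambda>e. e 0) else (\<lambda>e. Fs i (e (Suc 0)))) e) \<phi>)"
    by (rule Dfn_sat) (auto intro: dfn F1I[OF Fs(1)])
  then have "D2 (\<lambda>m x. sat M ((\<lambda>i. Fs i x)(0 := m)) \<phi>)"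
    by (simp add: fun_upd_def if_distrib[of "\<lambda>f. f _"] cong: if_cong)
  from UF_definable[OF this] have "D1 P" unfolding P_def .
  from Dfn_formula[OF this emp(1)] obtain \<psi> s' where \<psi>: "range s' \<subseteq> U"
    "\<forall>x\<in>U. \<forall>y\<in>U. sat M (s'(0 := x, 1 := y)) \<psi> \<longleftrightarrow> P x" by auto
  have s'U: "s' i \<in> U" for i using \<psi>(1) by blast
  have sP: "sat (copy Inl M) ((\<lambda>i. Inl (s' i))(0 := Inl x)) \<psi> \<longleftrightarrow> P x" if x: "x \<in> U" for x
  proof -
    have e: "(\<lambda>i. Inl (s' i))(0 := Inl x) = (\<lambda>i. Inl ((s'(0 := x)) i))" by auto
    have "s'(0 := x, 1 := s' 1) = s'(0 := x)" by (simp add: fun_eq_iff)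
    moreover have "sat (copy Inl M) (\<lambda>i. Inl ((s'(0 := x)) i)) \<psi> \<longleftrightarrow> sat M (s'(0 := x)) \<psi>"
      by (rule sat_copy) (use s'U x in auto)
    ultimately show ?thesis using \<psi>(2)[rule_format, OF x s'U[of 1]] unfolding e by simp
  qed
  have "D \<inter> univ (copy Inl M) = {x \<in> univ (copy Inl M). sat (copy Inl M) ((\<lambda>i. Inl (s' i))(0 := x)) \<psi>}"
    unfolding univ_copy using D sP by auto
  then show "definable (copy Inl M) (D \<inter> univ (copy Inl M))"
    unfolding definable_def by (intro exI[of _ \<psi>] exI[of _ "\<lambda>i. Inl (s' i)"]) (use s'U in \<open>auto simp: univ_copy\<close>)
qed (rule submodel_copy)

text \<open>The value of \<open>T\<close> at \<open>emb F\<close> is definable in \<open>N\<close>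
  from \<open>emb F\<close> and parameters in \<open>M\<close>, all of which lie in
  \<open>K\<close>. Elementarity provides a solution in \<open>K\<close>, and the solution in
  \<open>N\<close> is unique.\<close>

lemma dcl_closed:
  assumes K: "K \<prec> N" and Inl: "Inl ` U \<subseteq> univ K" and F: "F1 F" "emb F \<in> univ K" and T: "F1 T"
  shows "emb (\<lambda>x. T (F x)) \<in> univ K"
proof -
  have "Dfn (\<lambda>e. e (Suc 0) = T (e 0))" by (intro dfn T)
  from Dfn_formula[OF this emp(1)] obtain \<psi> s' where \<psi>: "range s' \<subseteq> U"
    "\<forall>x\<in>U. \<forall>y\<in>U. sat M (s'(0 := x, 1 := y)) \<psi> \<longleftrightarrow> y = T x" by auto
  have s'U: "s' i \<in> U" for i using \<psi>(1) by blast
  let ?t = "(\<lambda>i. Inl (s' i))(0 := emb F)"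
  have sat: "sat N (?t(1 := emb H)) \<psi> \<longleftrightarrow> UF (\<lambda>x. H x = T (F x))" if H: "F1 H" for H
  proof -
    let ?Fs = "(\<lambda>i _. s' i)(0 := F, 1 := H)"
    have "?t(1 := emb H) = (\<lambda>i. emb (?Fs i))" using s'U by (auto simp: fun_eq_iff)
    then have "sat N (?t(1 := emb H)) \<psi> \<longleftrightarrow> sat N (\<lambda>i. emb (?Fs i)) \<psi>" by (simp only:)
    also have "\<dots> \<longleftrightarrow> UF (\<lambda>x. sat M (\<lambda>i. ?Fs i x) \<psi>)"
      by (rule Los) (use F H F1_const[OF s'U] in simp)
    also have "\<dots> \<longleftrightarrow> UF (\<lambda>x. H x = T (F x))"
    proof (rule UF_cong)
      fix x assume x: "x \<in> U"
      have "(\<lambda>i. ?Fs i x) = s'(0 := F x, 1 := H x)" by (auto simp: fun_eq_iff)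
      then show "sat M (\<lambda>i. ?Fs i x) \<psi> \<longleftrightarrow> H x = T (F x)"
        using \<psi>(2)[rule_format, OF F1_closed[OF F(1) x] F1_closed[OF H x]] by simp
    qed
    finally show ?thesis .
  qed
  have TF: "F1 (\<lambda>x. T (F x))" by (rule F1I[OF T F(1)])
  have KN: "univ K \<subseteq> univ N" and el: "\<And>\<phi> s. range s \<subseteq> univ K \<Longrightarrow> sat K s \<phi> \<longleftrightarrow> sat N s \<phi>"
    using K unfolding elem_submodel_def submodel_def by blast+
  have tK: "range ?t \<subseteq> univ K" using F(2) Inl s'U by auto
  have "sat N (?t(1 := emb (\<lambda>x. T (F x)))) \<psi>" using sat[OF TF] by simp
  then have "sat N ?t (fm.Ex 1 \<psi>)" unfolding sat.simps by (rule bexI) (rule emb_N[OF TF])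
  then have "sat K ?t (fm.Ex 1 \<psi>)" using el[OF tK] by blast
  then obtain k where k: "k \<in> univ K" "sat K (?t(1 := k)) \<psi>" unfolding sat.simps by blast
  have "range (?t(1 := k)) \<subseteq> univ K" using tK k(1) by (auto split: if_splits)
  then have "sat N (?t(1 := k)) \<psi>" using el k(2) by blast
  moreover obtain H where H: "F1 H" "k = emb H" using k(1) KN N_emb by blast
  ultimately have "emb H = emb (\<lambda>x. T (F x))" using sat[OF H(1)] emb_eq_iff[OF H(1) TF] by simp
  then show ?thesis using k(1) H(2) by simp
qed

text \<open>An element of \<open>K\<close> outside \<open>M*\<close> is the value of an unbounded
  function at the generator, so it computes the generator, which therefore lies in \<open>K\<close>.
  Since every element of \<open>N\<close> is a definable function of the generator, \<open>K\<close>
  is all of \<open>N\<close>.\<close>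

lemma minimal: "minimal_elem_end_extension Mstar N"
  unfolding minimal_elem_end_extension_def
proof (intro conjI notI)
  assume "\<exists>K. Mstar \<prec> K \<and> K \<prec> N"
  then obtain K where K: "Mstar \<prec> K" "K \<prec> N" by blast
  have sub: "univ Mstar \<subseteq> univ K" "univ Mstar \<noteq> univ K" "univ K \<subseteq> univ N" "univ K \<noteq> univ N"
    using K unfolding elem_submodel_def submodel_def by blast+
  have Inl: "Inl ` U \<subseteq> univ K" using sub(1) Inl_Mstar by blast
  obtain u where u: "u \<in> univ K" "u \<notin> univ Mstar" using sub by blast
  obtain F where F: "F1 F" "u = emb F" using u sub N_emb by blast
  have "\<not> bdd F" using emb_Mstar[OF F(1)] u F by blast
  then obtain T where T: "F1 T" "UF (\<lambda>x. T (F x) = x)"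
    using bounded_or_generator[OF F(1)] unfolding bdd_def by blast
  have "F1 (\<lambda>x. T (F x))" by (rule F1I[OF T(1) F(1)])
  then have "emb (\<lambda>x. T (F x)) = emb (\<lambda>x. x)" using emb_eq_iff[of "\<lambda>x. T (F x)" "\<lambda>x. x"] Tm_var T(2) by blast
  then have id: "emb (\<lambda>x. x) \<in> univ K" using dcl_closed[OF K(2) Inl F(1) _ T(1)] u F by simp
  have "v \<in> univ K" if v: "v \<in> univ N" for v
  proof -
    obtain H where "F1 H" "v = emb H" using N_emb[OF v] by blast
    then show ?thesis using dcl_closed[OF K(2) Inl Tm_var id, of H] by simp
  qed
  then show False using sub by blast
qed (rule Mstar_elem Mstar_end)+

end

theorem theorem3p4:
  fixes M :: "'a struct"
  assumes "models_ZF M" and "models_ex_V_eq_HOD M"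
  shows "\<exists>Mstar :: ('a + 'a) struct.
    copy Inl M \<prec> Mstar \<and>
    cofinal_extension (copy Inl M) Mstar \<and>
    conservative_extension (copy Inl M) Mstar \<and>
    (\<exists>N :: ('a + 'a) struct. minimal_elem_end_extension Mstar N)"
proof -
  interpret zf_model M by unfold_locales (rule assms(1))
  obtain h where h: "F1 h" "\<forall>x\<in>univ M. Od (h x)" "inj_on h (univ M)"
    using ordinal_injection_if_HOD[OF assms(2)] by blast
  obtain w where w: "w \<in> univ M" "is_omega M w"
    using ordinal_injection_if_HOD[OF assms(2)] by blast
  interpret ordered_model M h by unfold_locales (use h in auto)
  obtain \<sigma> B B2 A s E where t: "\<sigma> 0 = (\<lambda>x. x) \<and> B 0 = B0 \<and> (\<forall>n. F1 (\<sigma> n) \<and>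
     stage_rel (Dn n) (\<sigma> n) (B n) (B2 n) (A n) (s n) (E n) (B (Suc n)) \<and>
     \<sigma> (Suc n) = (\<lambda>x. \<sigma> n (s n x)))"
    using tower_exists by (elim exE) (rule that)
  interpret tower M h w \<sigma> B B2 A s E
    by unfold_locales (use t w in auto)
  show ?thesis using copy_elem cofinal conservative minimal by blast
qed

end
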